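(* Let $K$ be the integral operator on $L^2(\mathbb{R}_+)$ with kernel $\frac1\pi\operatorname{sinc}(x-y)$ and let $V: L^2(0,1)\to L^2(\mathbb{R}_+)$ be the Hilbert space isomorphism with kernel $q_+$, both as defined in the context. Then for every $h\in L^2(0,1)$ $$\big(V^{-1}K\,V\,h\big)(s)=s\,h(s)\quad\text{for almost every } s\in\,]0,1[ .$$
   Context: $\mathbb{R}_+=\{x\in\mathbb{R}:x>0\}$. All $L^2$ spaces are complex, with respect to Lebesgue measure. $\operatorname{sinc}(x)=\frac{\sin x}{x}$ for $x\neq 0$, $\operatorname{sinc}(0)=1$. The bounded operator $K$ on $L^2(\mathbb{R}_+)$ is $$(Kg)(x)=\int_0^\infty \tfrac1\pi\operatorname{sinc}(x-y)\,g(y)\,dy .$$ The real-valued kernel $q_+:\,]0,1[\times\mathbb{R}_+\to\mathbb{R}$ is $$q_+(s,x)=\tfrac12\pi^{-3/2}s^{-1}(1-s)^{-1/2}\int_{-1}^1 e^{-ixu}(1-u^2)^{-1/2}\exp\Big(\tfrac{i}{2\pi}\ln\big(\tfrac1s-1\big)\ln\big(\tfrac{1-u}{1+u}\big)\Big)du .$$ $V:L^2(0,1)\to L^2(\mathbb{R}_+)$ is given by $Vh=\operatorname{l.i.m.}_{0<\alpha,\alpha'\to0}\int_\alpha^{1-\alpha'}q_+(s,\cdot)h(s)\,ds$, where $\operatorname{l.i.m.}$ is the limit in $L^2$; it is a Hilbert space isomorphism (surjective linear isometry). *)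

theory Defs
  imports "HOL-Probability.Sinc_Integral"
begin

text \<open>
  Elements of the complex space \<open>L\<^sup>2(S)\<close> are represented by square integrable, Lebesgue measurable
  functions on \<open>S\<close>; two such functions represent the same element iff they agree almost everywhere
  on \<open>S\<close>. Values outside \<open>S\<close> are irrelevant.
\<close>

definition L2 :: "real set \<Rightarrow> (real \<Rightarrow> complex) set" where
  "L2 S = {f. f \<in> borel_measurable (lebesgue_on S) \<and>
              integrable (lebesgue_on S) (\<lambda>x. (cmod (f x))\<^sup>2)}"

definition L2_norm :: "real set \<Rightarrow> (real \<Rightarrow> complex) \<Rightarrow> real" where
  "L2_norm S f = sqrt (integral\<^sup>L (lebesgue_on S) (\<lambda>x. (cmod (f x))\<^sup>2))"

text \<open>
  Convergence in \<open>L\<^sup>2(S)\<close>. Membership of the approximants in \<open>L\<^sup>2(S)\<close> is required explicitly, because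
  the Bochner integral of a non-integrable function is \<open>0\<close>.
\<close>

definition L2_tendsto ::
  "real set \<Rightarrow> ('i \<Rightarrow> real \<Rightarrow> complex) \<Rightarrow> (real \<Rightarrow> complex) \<Rightarrow> 'i filter \<Rightarrow> bool" where
  "L2_tendsto S F f A \<longleftrightarrow>
     f \<in> L2 S \<and> (\<forall>\<^sub>F i in A. F i \<in> L2 S) \<and>
     ((\<lambda>i. L2_norm S (\<lambda>x. F i x - f x)) \<longlongrightarrow> 0) A"

definition K_op :: "(real \<Rightarrow> complex) \<Rightarrow> real \<Rightarrow> complex" where
  "K_op g x = integral\<^sup>L (lebesgue_on {0<..}) (\<lambda>y. of_real (1 / pi * sinc (x - y)) * g y)"

text \<open>
  The kernel is given by a complex formula whose values are real: the substitution \<open>u \<mapsto> - u\<close>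
  turns the integrand into its complex conjugate.
\<close>

definition q_plus :: "real \<Rightarrow> real \<Rightarrow> complex" where
  "q_plus s x =
     of_real (1 / 2 * pi powr (- 3 / 2) * inverse s * (1 - s) powr (- 1 / 2)) *
     integral\<^sup>L (lebesgue_on {-1..1})
       (\<lambda>u. exp (- \<i> * of_real (x * u)) * of_real ((1 - u\<^sup>2) powr (- 1 / 2)) *
            exp (\<i> / of_real (2 * pi) * of_real (ln (1 / s - 1) * ln ((1 - u) / (1 + u)))))"

definition V_trunc :: "(real \<Rightarrow> complex) \<Rightarrow> real \<times> real \<Rightarrow> real \<Rightarrow> complex" where
  "V_trunc h = (\<lambda>(\<alpha>, \<alpha>') x.
     integral\<^sup>L (lebesgue_on {\<alpha>..1 - \<alpha>'}) (\<lambda>s. q_plus s x * h s))"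

text \<open>
  Limits and preimages in \<open>L\<^sup>2\<close> are determined only up to equality almost everywhere, so \<open>V\<close> and its
  inverse pick a representative.
\<close>

definition V_op :: "(real \<Rightarrow> complex) \<Rightarrow> real \<Rightarrow> complex" where
  "V_op h = (SOME f. L2_tendsto {0<..} (V_trunc h) f (at_right 0 \<times>\<^sub>F at_right 0))"

definition V_inv :: "(real \<Rightarrow> complex) \<Rightarrow> real \<Rightarrow> complex" where
  "V_inv f = (SOME h. h \<in> L2 {0<..<1} \<and> (AE x in lebesgue_on {0<..}. V_op h x = f x))"

end

theory Submission
  imports Defs "HOL-Complex_Analysis.Complex_Analysis" "HOL-Probability.Characteristic_Functions"
    "HOL-Real_Asymp.Real_Asymp"
begin

text \<open>
  Put \<open>\<xi> = ln (1/s - 1)\<close>. The substitution \<open>u = - tanh (w/2)\<close> turns the integral in \<open>q\<^sub>+\<close> into a Fourier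
  integral over the real line of a function holomorphic in the strip \<open>\<bar>Im w\<bar> < \<pi>\<close>. Moving the line
  to \<open>Im w = \<pi>/2\<close> (so that \<open>- u\<close> runs through the upper unit half circle) produces the kernel
  \<open>E(x,w) = exp (i x tanh (z/2)) / (2 cosh (z/2))\<close>, \<open>z = w + i\<pi>/2\<close>, which decays in \<open>x > 0\<close> and satisfies
  \<open>\<integral>\<^sub>0\<^sup>\<infinity> E(x,w) cnj E(x,v) dx = 1 / (4 cosh ((w - v)/2))\<close>. No singular integral is left, and since \<open>1/cosh\<close>
  is its own Fourier transform, the operator \<open>\<psi> \<mapsto> \<integral> E(x,w) \<psi>(w) dw\<close> becomes, after a Fourier
  transform, an isometry for the weight \<open>1/cosh (\<xi>/2)\<close>, up to a constant. The identity
  \<open>exp (- \<xi>/2) / (2 cosh (\<xi>/2)) = s\<close> then makes \<open>V\<close> isometric.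

  The sinc kernel is of the same form, \<open>\<pi> k(x,y) = \<integral> E(y,w) E(-x,w) dw\<close>, so the same Parseval identity
  evaluates \<open>K V h\<close>. The function \<open>cnj E(-x,w)\<close> that appears lives on the line \<open>Im w = - \<pi>/2\<close>; the shift
  back to \<open>Im w = \<pi>/2\<close> together with the weight contributes exactly the factor \<open>s\<close>. Both facts pass from
  continuous \<open>h\<close> with compact support to all of \<open>L\<^sup>2\<close>, and injectivity of \<open>V\<close> finishes the proof.
\<close>

section \<open>The space \<open>L\<^sup>2\<close>\<close>

text \<open>On the real line the factor exp (i x tanh (w/2)) has modulus one, so a product of two
  such kernels is not absolutely integrable over x > 0. On Im w = pi/2 it decays like exp (- x /
  cosh w), and the modulus of a product has integral at most 1/4, uniformly in w and v; Parseval is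
  then plain Fubini for integrable densities. The densities that come from h are inverse Fourier
  transforms of continuous functions with compact support and need not be integrable. Gaussian
  damping repairs this; it is removed by a Cauchy argument in L2 combined with pointwise
  convergence. Constants: inversion with frequency xi / (2 pi) and no prefactor costs 4 pi^2, so the
  norm identity carries (4 pi^2)^2 / (8 pi) = 2 pi^3. The prefactor pi^(-3/2) / 2 of
  \<open>q_plus\<close> squares to 1 / (4 pi^3), which leaves the 1/2 in 1 / (2 cosh (xi/2)).
  \<open>V_op\<close> and \<open>V_inv\<close> choose representatives, so each choice needs an
  existence proof: completeness of L2 for \<open>V_op\<close>, the explicit preimage s h(s) for
  \<open>V_inv\<close>.\<close>

lemma L2_norm_nonneg: "0 \<le> L2_norm S f"
  by (simp add: L2_norm_def)

lemma L2_norm_power2: "(L2_norm S f)\<^sup>2 = integral\<^sup>L (lebesgue_on S) (\<lambda>x. (cmod (f x))\<^sup>2)"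
  by (simp add: L2_norm_def)

lemma L2_mult_norm_integrable:
  assumes "f \<in> L2 S" "g \<in> L2 S"
  shows "integrable (lebesgue_on S) (\<lambda>x. cmod (f x) * cmod (g x))"
proof (rule Bochner_Integration.integrable_bound)
  show "integrable (lebesgue_on S) (\<lambda>x. (cmod (f x))\<^sup>2 + (cmod (g x))\<^sup>2)"
    using assms by (auto simp: L2_def)
  show "(\<lambda>x. cmod (f x) * cmod (g x)) \<in> borel_measurable (lebesgue_on S)"
    using assms by (auto simp: L2_def)
  have "a * b \<le> a\<^sup>2 + b\<^sup>2" if "0 \<le> a" "0 \<le> b" for a b :: real
  proof -
    have "0 \<le> (a - b)\<^sup>2" "0 \<le> a * b" using that by auto
    then show ?thesis by (simp add: power2_diff)
  qed
  then show "AE x in lebesgue_on S. norm (cmod (f x) * cmod (g x)) \<le> norm ((cmod (f x))\<^sup>2 + (cmod (g x))\<^sup>2)"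
    by (auto simp: abs_mult)
qed

lemma L2_mult_integrable:
  assumes "f \<in> L2 S" "g \<in> L2 S"
  shows "integrable (lebesgue_on S) (\<lambda>x. f x * g x)"
  by (rule Bochner_Integration.integrable_bound[OF L2_mult_norm_integrable[OF assms]])
     (use assms in \<open>auto simp: L2_def norm_mult\<close>)

lemma L2_cmult:
  assumes "f \<in> L2 S"
  shows "(\<lambda>x. c * f x) \<in> L2 S"
  using assms by (auto simp: L2_def norm_mult power_mult_distrib)

lemma L2_add:
  assumes "f \<in> L2 S" "g \<in> L2 S"
  shows "(\<lambda>x. f x + g x) \<in> L2 S"
proof -
  have "integrable (lebesgue_on S) (\<lambda>x. (cmod (f x + g x))\<^sup>2)"
  proof (rule Bochner_Integration.integrable_bound)
    show "integrable (lebesgue_on S)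
        (\<lambda>x. (cmod (f x))\<^sup>2 + 2 * (cmod (f x) * cmod (g x)) + (cmod (g x))\<^sup>2)"
      using assms L2_mult_norm_integrable[OF assms] by (auto simp: L2_def)
    show "(\<lambda>x. (cmod (f x + g x))\<^sup>2) \<in> borel_measurable (lebesgue_on S)"
      using assms by (auto simp: L2_def)
    have "(cmod (f x + g x))\<^sup>2 \<le> (cmod (f x) + cmod (g x))\<^sup>2" for x
      by (intro power_mono norm_triangle_ineq) auto
    then show "AE x in lebesgue_on S. norm ((cmod (f x + g x))\<^sup>2) \<le>
        norm ((cmod (f x))\<^sup>2 + 2 * (cmod (f x) * cmod (g x)) + (cmod (g x))\<^sup>2)"
      by (auto simp: power2_sum algebra_simps intro!: order_trans[OF _ abs_ge_self])
  qed
  then show ?thesis using assms by (auto simp: L2_def)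
qed

lemma L2_diff:
  assumes "f \<in> L2 S" "g \<in> L2 S"
  shows "(\<lambda>x. f x - g x) \<in> L2 S"
  using L2_add[OF assms(1) L2_cmult[OF assms(2), of "-1"]] by simp

lemma L2_cnj: "f \<in> L2 S \<Longrightarrow> (\<lambda>x. cnj (f x)) \<in> L2 S"
  by (auto simp: L2_def intro: measurable_compose[OF _ borel_measurable_continuous_onI] continuous_intros)

text \<open>The squared norm of |f| - t |g| is a nonnegative quadratic in t, and its discriminant
  gives the bound. Stated for moduli, so that the complex inequality and the triangle inequality
  both follow from it.\<close>

lemma L2_Cauchy_Schwarz_norm:
  assumes "f \<in> L2 S" "g \<in> L2 S"
  shows "integral\<^sup>L (lebesgue_on S) (\<lambda>x. cmod (f x) * cmod (g x)) \<le> L2_norm S f * L2_norm S g"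
proof -
  let ?M = "lebesgue_on S"
  define a b c where "a = L2_norm S f" and "b = L2_norm S g"
    and "c = integral\<^sup>L ?M (\<lambda>x. cmod (f x) * cmod (g x))"
  have [simp]: "0 \<le> a" "0 \<le> b" by (auto simp: a_def b_def L2_norm_nonneg)
  have q_const: "0 \<le> c" unfolding c_def by (intro integral_nonneg_AE) auto
  have quad: "0 \<le> a\<^sup>2 - 2 * t * c + t\<^sup>2 * b\<^sup>2" for t
  proof -
    have "0 \<le> integral\<^sup>L ?M (\<lambda>x. (cmod (f x) - t * cmod (g x))\<^sup>2)"
      by (intro integral_nonneg_AE) auto
    also have "\<dots> = integral\<^sup>L ?M (\<lambda>x. (cmod (f x))\<^sup>2 - 2 * t * (cmod (f x) * cmod (g x)) + t\<^sup>2 * (cmod (g x))\<^sup>2)"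
      by (intro Bochner_Integration.integral_cong) (auto simp: power2_eq_square algebra_simps)
    also have "\<dots> = a\<^sup>2 - 2 * t * c + t\<^sup>2 * b\<^sup>2"
      using assms L2_mult_norm_integrable[OF assms]
      by (subst Bochner_Integration.integral_add, simp_all add: L2_def a_def b_def c_def L2_norm_power2)
    finally show ?thesis .
  qed
  have "c \<le> a * b"
  proof (cases "b = 0")
    case True
    have "c = 0"
    proof (rule ccontr)
      assume "c \<noteq> 0"
      then have "0 < c" using q_const by simp
      \<comment> \<open>For b = 0 the quadratic is linear in t; at this t it takes the value
        -1.\<close>
      then show False using quad[of "(a\<^sup>2 + 1) / (2 * c)"] True by simp
    qed
    then show ?thesis using True by simp
  next
    case False
    then have "0 < b\<^sup>2" by simp
    have "c\<^sup>2 \<le> a\<^sup>2 * b\<^sup>2"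
    proof -
      \<comment> \<open>The quadratic attains its minimum at t = c / b^2.\<close>
      have "(c / b\<^sup>2)\<^sup>2 * b\<^sup>2 = c * (c / b\<^sup>2)" using \<open>0 < b\<^sup>2\<close> by (simp add: power2_eq_square)
      then have "c\<^sup>2 / b\<^sup>2 \<le> a\<^sup>2"
        using quad[of "c / b\<^sup>2"] by (simp add: power2_eq_square)
      then show ?thesis using \<open>0 < b\<^sup>2\<close> by (simp add: pos_divide_le_eq)
    qed
    then have "c\<^sup>2 \<le> (a * b)\<^sup>2" by (simp add: power_mult_distrib)
    then show ?thesis by (rule power2_le_imp_le) simp
  qed
  then show ?thesis by (simp add: a_def b_def c_def)
qed

lemma L2_Cauchy_Schwarz:
  assumes "f \<in> L2 S" "g \<in> L2 S"
  shows "cmod (integral\<^sup>L (lebesgue_on S) (\<lambda>x. f x * g x)) \<le> L2_norm S f * L2_norm S g"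
proof -
  have "cmod (integral\<^sup>L (lebesgue_on S) (\<lambda>x. f x * g x)) \<le> integral\<^sup>L (lebesgue_on S) (\<lambda>x. cmod (f x * g x))"
    by (rule integral_norm_bound)
  also have "\<dots> \<le> L2_norm S f * L2_norm S g"
    using L2_Cauchy_Schwarz_norm[OF assms] by (simp add: norm_mult)
  finally show ?thesis .
qed

lemma L2_norm_triangle:
  assumes "f \<in> L2 S" "g \<in> L2 S"
  shows "L2_norm S (\<lambda>x. f x + g x) \<le> L2_norm S f + L2_norm S g"
proof (rule power2_le_imp_le)
  let ?M = "lebesgue_on S"
  have "(L2_norm S (\<lambda>x. f x + g x))\<^sup>2 = integral\<^sup>L ?M (\<lambda>x. (cmod (f x + g x))\<^sup>2)"
    by (rule L2_norm_power2)
  also have "\<dots> \<le> integral\<^sup>L ?M (\<lambda>x. (cmod (f x))\<^sup>2 + 2 * (cmod (f x) * cmod (g x)) + (cmod (g x))\<^sup>2)"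
  proof (intro integral_mono)
    show "integrable ?M (\<lambda>x. (cmod (f x + g x))\<^sup>2)"
      using L2_add[OF assms] by (simp add: L2_def)
    show "integrable ?M (\<lambda>x. (cmod (f x))\<^sup>2 + 2 * (cmod (f x) * cmod (g x)) + (cmod (g x))\<^sup>2)"
      using assms L2_mult_norm_integrable[OF assms] by (auto simp: L2_def)
    fix x
    have "(cmod (f x + g x))\<^sup>2 \<le> (cmod (f x) + cmod (g x))\<^sup>2"
      by (intro power_mono norm_triangle_ineq) auto
    then show "(cmod (f x + g x))\<^sup>2 \<le> (cmod (f x))\<^sup>2 + 2 * (cmod (f x) * cmod (g x)) + (cmod (g x))\<^sup>2"
      by (simp add: power2_sum algebra_simps)
  qed
  also have "\<dots> = (L2_norm S f)\<^sup>2 + 2 * integral\<^sup>L ?M (\<lambda>x. cmod (f x) * cmod (g x)) + (L2_norm S g)\<^sup>2"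
    using assms L2_mult_norm_integrable[OF assms]
    by (subst Bochner_Integration.integral_add, simp_all add: L2_def L2_norm_power2)
  also have "\<dots> \<le> (L2_norm S f + L2_norm S g)\<^sup>2"
    using L2_Cauchy_Schwarz_norm[OF assms] by (simp add: power2_sum algebra_simps)
  finally show "(L2_norm S (\<lambda>x. f x + g x))\<^sup>2 \<le> (L2_norm S f + L2_norm S g)\<^sup>2" .
qed (simp add: L2_norm_nonneg)

abbreviation L2_dist :: "real set \<Rightarrow> (real \<Rightarrow> complex) \<Rightarrow> (real \<Rightarrow> complex) \<Rightarrow> real" where
  "L2_dist S f g \<equiv> L2_norm S (\<lambda>x. f x - g x)"

lemma L2_norm_minus_commute: "L2_dist S f g = L2_dist S g f"
  by (simp add: L2_norm_def norm_minus_commute)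

lemma L2_norm_diff_triangle:
  assumes "f \<in> L2 S" "g \<in> L2 S" "k \<in> L2 S"
  shows "L2_dist S f k \<le> L2_dist S f g + L2_dist S g k"
  using L2_norm_triangle[OF L2_diff[OF assms(1,2)] L2_diff[OF assms(2,3)]] by simp

lemma L2_norm_diff_abs:
  assumes "f \<in> L2 S" "g \<in> L2 S"
  shows "\<bar>L2_norm S f - L2_norm S g\<bar> \<le> L2_dist S f g"
  using L2_norm_triangle[OF L2_diff[OF assms] assms(2)] L2_norm_triangle[OF L2_diff[OF assms(2,1)] assms(1)]
    L2_norm_minus_commute[of S f g] by simp

lemma L2_norm_tendsto:
  assumes "\<And>n. F n \<in> L2 S" "f \<in> L2 S" "((\<lambda>n. L2_dist S (F n) f) \<longlongrightarrow> 0) A"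
  shows "((\<lambda>n. L2_norm S (F n)) \<longlongrightarrow> L2_norm S f) A"
proof -
  have "((\<lambda>n. L2_norm S (F n) - L2_norm S f) \<longlongrightarrow> 0) A"
    by (rule Lim_null_comparison[OF _ assms(3)]) (simp add: L2_norm_diff_abs[OF assms(1,2)])
  then show ?thesis by (simp add: LIM_zero_iff)
qed

lemma L2_norm_eq_0_AE:
  assumes "f \<in> L2 S" "L2_norm S f = 0"
  shows "AE x in lebesgue_on S. f x = 0"
proof -
  have "integral\<^sup>L (lebesgue_on S) (\<lambda>x. (cmod (f x))\<^sup>2) = 0"
    using assms(2) L2_norm_power2[of S f] by simp
  then have "AE x in lebesgue_on S. (cmod (f x))\<^sup>2 = 0"
    using assms(1) by (subst (asm) integral_nonneg_eq_0_iff_AE) (auto simp: L2_def)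
  then show ?thesis by auto
qed

lemma L2_norm_cong_AE:
  assumes "f \<in> borel_measurable (lebesgue_on S)" "g \<in> borel_measurable (lebesgue_on S)"
    "AE x in lebesgue_on S. f x = g x"
  shows "L2_norm S f = L2_norm S g"
  unfolding L2_norm_def using assms
  by (intro arg_cong[where f=sqrt] integral_cong_AE) auto

lemma L2_cong_AE:
  assumes "f \<in> L2 S" "g \<in> borel_measurable (lebesgue_on S)" "AE x in lebesgue_on S. f x = g x"
  shows "g \<in> L2 S"
proof -
  have "integrable (lebesgue_on S) (\<lambda>x. (cmod (g x))\<^sup>2)"
    by (rule Bochner_Integration.integrable_cong_AE_imp[of _ "\<lambda>x. (cmod (f x))\<^sup>2"]) (use assms in \<open>auto simp: L2_def\<close>)
  then show ?thesis using assms(2) by (simp add: L2_def)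
qed

lemma nn_integral_L2:
  assumes "f \<in> L2 S"
  shows "(\<integral>\<^sup>+x. ennreal ((cmod (f x))\<^sup>2) \<partial>lebesgue_on S) = ennreal ((L2_norm S f)\<^sup>2)"
  using assms by (subst nn_integral_eq_integral) (auto simp: L2_def L2_norm_power2)

text \<open>The form in which an estimate from Fatou's lemma yields membership and norm bound at
  once.\<close>

lemma L2_nn_bound:
  assumes "f \<in> borel_measurable (lebesgue_on S)" "0 \<le> r"
    and "(\<integral>\<^sup>+x. ennreal ((cmod (f x))\<^sup>2) \<partial>lebesgue_on S) \<le> ennreal (r\<^sup>2)"
  shows "f \<in> L2 S" "L2_norm S f \<le> r"
proof -
  have "integrable (lebesgue_on S) (\<lambda>x. (cmod (f x))\<^sup>2)"
    using assms by (intro integrableI_bounded) (auto intro: le_less_trans)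
  then show "f \<in> L2 S" using assms(1) by (simp add: L2_def)
  then have "(L2_norm S f)\<^sup>2 \<le> r\<^sup>2"
    using assms(3) by (simp add: nn_integral_L2)
  then show "L2_norm S f \<le> r" using assms(2) by (rule power2_le_imp_le)
qed

section \<open>Cauchy sequences, pointwise limits and completeness\<close>

definition L2_Cauchy :: "real set \<Rightarrow> (nat \<Rightarrow> real \<Rightarrow> complex) \<Rightarrow> bool" where
  "L2_Cauchy S F \<longleftrightarrow> (\<forall>n. F n \<in> L2 S) \<and>
     (\<forall>e>0. \<exists>N. \<forall>m\<ge>N. \<forall>n\<ge>N. L2_dist S (F m) (F n) \<le> e)"

lemma L2_Cauchy_subseq: "L2_Cauchy S F \<Longrightarrow> strict_mono r \<Longrightarrow> L2_Cauchy S (F \<circ> r)"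
  unfolding L2_Cauchy_def o_def by (meson order_trans seq_suble)

lemma L2_convergent_imp_Cauchy:
  assumes "\<And>n. F n \<in> L2 S" "f \<in> L2 S" "(\<lambda>n. L2_dist S (F n) f) \<longlonglongrightarrow> 0"
  shows "L2_Cauchy S F"
  unfolding L2_Cauchy_def
proof (intro conjI allI impI)
  fix e :: real assume "0 < e"
  then obtain N where N: "\<And>n. n \<ge> N \<Longrightarrow> L2_dist S (F n) f < e / 2"
    using LIMSEQ_D[OF assms(3), of "e/2"] by (auto simp: L2_norm_nonneg)
  have "L2_dist S (F m) (F n) \<le> e" if "m \<ge> N" "n \<ge> N" for m n
    using L2_norm_diff_triangle[OF assms(1)[of m] assms(2) assms(1)[of n]] N[OF that(1)] N[OF that(2)]
      L2_norm_minus_commute[of S f "F n"] by simp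
  then show "\<exists>N. \<forall>m\<ge>N. \<forall>n\<ge>N. L2_dist S (F m) (F n) \<le> e" by blast
qed (rule assms(1))

text \<open>Fatou's lemma in m turns the Cauchy bound for \<open>F n - F m\<close> into a bound for
  \<open>F n - f\<close>. This upgrades the pointwise limits, which the integral formulas supply, to
  limits in L2.\<close>

lemma L2_Cauchy_pointwise_limit:
  assumes "L2_Cauchy S F" "f \<in> borel_measurable (lebesgue_on S)"
    and lim: "AE x in lebesgue_on S. (\<lambda>n. F n x) \<longlonglongrightarrow> f x"
  shows "f \<in> L2 S" "(\<lambda>n. L2_dist S (F n) f) \<longlonglongrightarrow> 0"
proof -
  let ?M = "lebesgue_on S"
  have F: "F n \<in> L2 S" for n using assms(1) by (simp add: L2_Cauchy_def)
  then have [measurable]: "F n \<in> borel_measurable ?M" for n by (simp add: L2_def)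
  have key: "\<exists>N. \<forall>n\<ge>N. (\<lambda>x. F n x - f x) \<in> L2 S \<and> L2_dist S (F n) f \<le> e" if "0 < e" for e
  proof -
    obtain N where N: "\<And>m n. m \<ge> N \<Longrightarrow> n \<ge> N \<Longrightarrow> L2_dist S (F m) (F n) \<le> e"
      using assms(1) \<open>0 < e\<close> unfolding L2_Cauchy_def by blast
    have "(\<lambda>x. F n x - f x) \<in> L2 S \<and> L2_dist S (F n) f \<le> e" if n: "n \<ge> N" for n
    proof -
      have "(\<integral>\<^sup>+x. ennreal ((cmod (F n x - f x))\<^sup>2) \<partial>?M) =
          (\<integral>\<^sup>+x. liminf (\<lambda>m. ennreal ((cmod (F n x - F m x))\<^sup>2)) \<partial>?M)"
      proof (rule nn_integral_cong_AE, use lim in eventually_elim)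
        fix x assume "(\<lambda>m. F m x) \<longlonglongrightarrow> f x"
        then have "(\<lambda>m. ennreal ((cmod (F n x - F m x))\<^sup>2)) \<longlonglongrightarrow> ennreal ((cmod (F n x - f x))\<^sup>2)"
          by (intro tendsto_intros)
        then show "ennreal ((cmod (F n x - f x))\<^sup>2) = liminf (\<lambda>m. ennreal ((cmod (F n x - F m x))\<^sup>2))"
          by (rule lim_imp_Liminf[symmetric, rotated]) simp
      qed
      also have "\<dots> \<le> liminf (\<lambda>m. \<integral>\<^sup>+x. ennreal ((cmod (F n x - F m x))\<^sup>2) \<partial>?M)"
        by (intro nn_integral_liminf) measurable
      also have "\<dots> \<le> ennreal (e\<^sup>2)"
      proof (rule Liminf_le)
        show "\<forall>\<^sub>F m in sequentially. (\<integral>\<^sup>+x. ennreal ((cmod (F n x - F m x))\<^sup>2) \<partial>?M) \<le> ennreal (e\<^sup>2)"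
          using eventually_ge_at_top[of N]
        proof eventually_elim
          case (elim m)
          then show ?case
            using N[OF n elim] by (subst nn_integral_L2[OF L2_diff[OF F F]]) (auto intro!: ennreal_leI power_mono simp: L2_norm_nonneg)
        qed
      qed simp
      finally have "(\<integral>\<^sup>+x. ennreal ((cmod (F n x - f x))\<^sup>2) \<partial>?M) \<le> ennreal (e\<^sup>2)" .
      then show ?thesis
        using L2_nn_bound[of "\<lambda>x. F n x - f x" S e] \<open>0 < e\<close> F[of n] assms(2) by (auto simp: L2_def)
    qed
    then show ?thesis by blast
  qed
  obtain n where "(\<lambda>x. F n x - f x) \<in> L2 S" using key[of 1] by auto
  from L2_diff[OF F[of n] this] show "f \<in> L2 S" by simp
  show "(\<lambda>n. L2_dist S (F n) f) \<longlonglongrightarrow> 0"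
  proof (rule LIMSEQ_I)
    fix r :: real assume "0 < r"
    then obtain N where "\<forall>n\<ge>N. L2_dist S (F n) f \<le> r / 2" using key[of "r/2"] by auto
    then show "\<exists>no. \<forall>n\<ge>no. norm (L2_dist S (F n) f - 0) < r"
      using \<open>0 < r\<close> by (intro exI[of _ N]) (auto simp: L2_norm_nonneg intro: le_less_trans)
  qed
qed

lemma L2_limits_agree_AE:
  assumes "\<And>n. F n \<in> L2 S" "f \<in> L2 S" "(\<lambda>n. L2_dist S (F n) f) \<longlonglongrightarrow> 0"
    and "g \<in> L2 S" "(\<lambda>n. L2_dist S (F n) g) \<longlonglongrightarrow> 0"
  shows "AE x in lebesgue_on S. f x = g x"
proof -
  have "L2_dist S f g \<le> 0"
  proof (rule LIMSEQ_le_const)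
    show "(\<lambda>n. L2_dist S (F n) f + L2_dist S (F n) g) \<longlonglongrightarrow> 0"
      using tendsto_add[OF assms(3,5)] by simp
    show "\<exists>N. \<forall>n\<ge>N. L2_dist S f g \<le> L2_dist S (F n) f + L2_dist S (F n) g"
      using L2_norm_diff_triangle[OF assms(2) assms(1) assms(4)] L2_norm_minus_commute[of S f] by auto
  qed
  then have "L2_dist S f g = 0" using L2_norm_nonneg[of S "\<lambda>x. f x - g x"] by simp
  from L2_norm_eq_0_AE[OF L2_diff[OF assms(2,4)] this] show ?thesis by simp
qed

text \<open>Links the two modes of convergence. In the end it identifies
  \<open>K_op (V_op h)\<close>, known as a pointwise limit, with an element that is known only as a
  limit in norm.\<close>

lemma L2_pointwise_limit_AE_eq:
  assumes "\<And>n. F n \<in> L2 S" "f \<in> L2 S" "(\<lambda>n. L2_dist S (F n) f) \<longlonglongrightarrow> 0"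
    and "g \<in> borel_measurable (lebesgue_on S)" "AE x in lebesgue_on S. (\<lambda>n. F n x) \<longlonglongrightarrow> g x"
  shows "AE x in lebesgue_on S. f x = g x"
  using L2_limits_agree_AE[OF assms(1-3)]
    L2_Cauchy_pointwise_limit[OF L2_convergent_imp_Cauchy[OF assms(1-3)] assms(4,5)] by blast

text \<open>Riesz-Fischer: a subsequence whose steps \<open>d k\<close> have norm at most 4^-k
  converges almost everywhere, and the whole sequence follows it. The limit behind
  \<open>V_op\<close> has no formula in advance, so its existence rests on this.\<close>

lemma L2_complete:
  assumes "L2_Cauchy S F"
  shows "\<exists>f. f \<in> L2 S \<and> (\<lambda>n. L2_dist S (F n) f) \<longlonglongrightarrow> 0"
proof -
  let ?M = "lebesgue_on S"
  have F: "F n \<in> L2 S" for n using assms by (simp add: L2_Cauchy_def)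
  then have [measurable]: "F n \<in> borel_measurable ?M" for n by (simp add: L2_def)
  have "\<exists>N. \<forall>m\<ge>N. \<forall>n\<ge>N. L2_dist S (F m) (F n) \<le> (1/4)^k" for k :: nat
    using assms unfolding L2_Cauchy_def by (meson zero_less_divide_1_iff zero_less_numeral zero_less_power)
  then obtain N where N: "\<And>k m n. m \<ge> N k \<Longrightarrow> n \<ge> N k \<Longrightarrow> L2_dist S (F m) (F n) \<le> (1/4)^k"
    by metis
  define r where "r = rec_nat (N 0) (\<lambda>k a. max (Suc a) (N (Suc k)))"
  have r_Suc: "r (Suc k) = max (Suc (r k)) (N (Suc k))" for k by (simp add: r_def)
  have rN: "N k \<le> r k" for k by (cases k) (auto simp: r_def)
  have r_less: "r k < r (Suc k)" for k by (simp add: r_Suc less_max_iff_disj)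
  have sm: "strict_mono r" by (simp add: strict_mono_Suc_iff r_less)
  define d where "d = (\<lambda>k x. F (r (Suc k)) x - F (r k) x)"
  have dL2: "d k \<in> L2 S" for k unfolding d_def by (intro L2_diff F)
  have dn: "L2_norm S (d k) \<le> (1/4)^k" for k
    unfolding d_def using rN[of k] r_less[of k] by (intro N) auto
  have [measurable]: "d k \<in> borel_measurable ?M" for k using dL2 by (simp add: L2_def)
  \<comment> \<open>The weight 4^k is balanced: the k-th term integrates to at most 4^k 16^-k =
    4^-k, while a finite sum at x forces |d k x| <= sqrt C 2^-k, so the steps are summable
    there.\<close>
  have "(\<integral>\<^sup>+x. (\<Sum>k. ennreal (4^k * (cmod (d k x))\<^sup>2)) \<partial>?M) = (\<Sum>k. \<integral>\<^sup>+x. ennreal (4^k * (cmod (d k x))\<^sup>2) \<partial>?M)"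
    by (intro nn_integral_suminf) measurable
  also have "\<dots> \<le> (\<Sum>k. ennreal ((1/4)^k))"
  proof (intro suminf_le)
    fix k :: nat
    have "(\<integral>\<^sup>+x. ennreal (4^k * (cmod (d k x))\<^sup>2) \<partial>?M) = ennreal (4^k) * (\<integral>\<^sup>+x. ennreal ((cmod (d k x))\<^sup>2) \<partial>?M)"
      by (subst nn_integral_cmult[symmetric]) (auto simp: ennreal_mult)
    also have "\<dots> = ennreal (4^k * (L2_norm S (d k))\<^sup>2)"
      by (simp add: nn_integral_L2[OF dL2] ennreal_mult)
    also have "\<dots> \<le> ennreal (4^k * ((1/4)^k)\<^sup>2)"
      using dn[of k] by (intro ennreal_leI mult_left_mono power_mono) (auto simp: L2_norm_nonneg)
    also have "4^k * ((1/4)^k)\<^sup>2 = ((1/4)^k :: real)"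
      by (simp add: power2_eq_square power_one_over)
    finally show "(\<integral>\<^sup>+x. ennreal (4^k * (cmod (d k x))\<^sup>2) \<partial>?M) \<le> ennreal ((1/4)^k)" .
  qed auto
  also have "\<dots> < \<infinity>"
    by (subst suminf_ennreal2) (auto simp: summable_geometric)
  finally have "AE x in ?M. (\<Sum>k. ennreal (4^k * (cmod (d k x))\<^sup>2)) \<noteq> \<infinity>"
    by (intro nn_integral_PInf_AE) auto
  then have conv: "AE x in ?M. convergent (\<lambda>k. F (r k) x)"
  proof eventually_elim
    case (elim x)
    then have "summable (\<lambda>k. 4^k * (cmod (d k x))\<^sup>2)"
      by (intro summable_suminf_not_top) auto
    then have "bounded (range (\<lambda>k. 4^k * (cmod (d k x))\<^sup>2))"
      using summable_imp_bounded by blast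
    then obtain C where C: "\<And>k. 4^k * (cmod (d k x))\<^sup>2 \<le> C"
      by (auto simp: bounded_iff)
    have "summable (\<lambda>k. d k x)"
    proof (rule summable_comparison_test')
      show "summable (\<lambda>k. sqrt C * (1/2)^k)" by (intro summable_mult summable_geometric) simp
      fix k :: nat
      have "(2^k * cmod (d k x))\<^sup>2 \<le> C"
        using C[of k] by (simp add: power_mult_distrib power_mult[symmetric] mult.commute[of k] power_mult)
      then have "2^k * cmod (d k x) \<le> sqrt C" by (rule real_le_rsqrt)
      then show "norm (d k x) \<le> sqrt C * (1/2)^k" by (simp add: field_simps power_one_over)
    qed
    then have "convergent (\<lambda>n. (\<Sum>k<n. d k x) + F (r 0) x)"
      by (intro convergent_add convergent_const) (simp add: summable_iff_convergent)
    moreover have "(\<Sum>k<n. d k x) + F (r 0) x = F (r n) x" for n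
      unfolding d_def by (subst sum_lessThan_telescope) simp
    ultimately show ?case by simp
  qed
  define f where "f = (\<lambda>x. lim (\<lambda>k. F (r k) x))"
  have fm: "f \<in> borel_measurable ?M" unfolding f_def by measurable
  have "AE x in ?M. (\<lambda>k. (F \<circ> r) k x) \<longlonglongrightarrow> f x"
    using conv by eventually_elim (simp add: f_def convergent_LIMSEQ_iff)
  note * = L2_Cauchy_pointwise_limit[OF L2_Cauchy_subseq[OF assms sm] fm this]
  have "(\<lambda>n. L2_dist S (F n) f) \<longlonglongrightarrow> 0"
  proof (rule LIMSEQ_I)
    fix e :: real assume e: "0 < e"
    obtain M where M: "\<And>m n. m \<ge> M \<Longrightarrow> n \<ge> M \<Longrightarrow> L2_dist S (F m) (F n) \<le> e / 2"
      using assms e unfolding L2_Cauchy_def by (meson half_gt_zero)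
    obtain k0 where k0: "\<And>k. k \<ge> k0 \<Longrightarrow> L2_dist S (F (r k)) f < e / 2"
      using LIMSEQ_D[OF *(2), of "e/2"] e by (auto simp: L2_norm_nonneg)
    define k where "k = max k0 M"
    have "r k \<ge> M" using seq_suble[OF sm, of k] by (simp add: k_def)
    have "L2_dist S (F n) f < e" if "n \<ge> M" for n
      using L2_norm_diff_triangle[OF F[of n] F[of "r k"] *(1)] M[OF that \<open>r k \<ge> M\<close>] k0[of k]
      by (simp add: k_def)
    then show "\<exists>no. \<forall>n\<ge>no. norm (L2_dist S (F n) f - 0) < e"
      by (intro exI[of _ M]) (auto simp: L2_norm_nonneg)
  qed
  then show ?thesis using *(1) by blast
qed

section \<open>Integrals over rectangles and hyperbolic functions\<close>

lemma integrable_exp_neg_abs: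
  fixes c :: real assumes "0 < c"
  shows "integrable lborel (\<lambda>w. exp (- c * \<bar>w\<bar>))"
proof -
  have 1: "set_integrable lborel {0..} (\<lambda>w. exp (- c * w))"
  proof -
    have "(\<lambda>w. exp (- c * w)) integrable_on {0..}"
      using has_integral_exp_minus_to_infinity[OF assms, of 0] by (auto simp: integrable_on_def)
    then have "(\<lambda>w. exp (- c * w)) absolutely_integrable_on {0..}"
      by (intro nonnegative_absolutely_integrable_1) auto
    then show ?thesis
      unfolding set_integrable_def by (subst (asm) integrable_completion) auto
  qed
  have "set_integrable lborel {..0} (\<lambda>w. exp (- c * (- w)))"
    using lborel_integrable_real_affine[of "\<lambda>w. indicator {0..} w *\<^sub>R exp (- c * w)" "-1" 0] 1
    by (auto simp: set_integrable_def indicator_def)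
  then have 2: "set_integrable lborel {..<0} (\<lambda>w. exp (c * w))"
    by (auto intro: set_integrable_subset)
  have "set_integrable lborel {0..} (\<lambda>w. exp (- c * \<bar>w\<bar>))"
    using 1 by (rule set_integrable_cong[THEN iffD1, rotated 3]) auto
  moreover have "set_integrable lborel {..<0} (\<lambda>w. exp (- c * \<bar>w\<bar>))"
    using 2 by (rule set_integrable_cong[THEN iffD1, rotated 3]) auto
  ultimately have "set_integrable lborel ({0..} \<union> {..<0}) (\<lambda>w. exp (- c * \<bar>w\<bar>))"
    by (intro set_integrable_Un) auto
  moreover have "{0..} \<union> {..<0} = (UNIV :: real set)" by auto
  ultimately show ?thesis by (simp add: set_integrable_def)
qed

text \<open>The common integrability criterion for the kernels on horizontal lines, all of which
  decay exponentially in |w|.\<close>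

lemma integrable_exp_neg_abs_bound:
  fixes f :: "real \<Rightarrow> 'a::{banach, second_countable_topology}"
  assumes "f \<in> borel_measurable borel" "0 < c" "\<And>w. norm (f w) \<le> C * exp (- c * \<bar>w\<bar>)"
  shows "integrable lborel f"
  by (rule Bochner_Integration.integrable_bound[OF integrable_mult_right[OF integrable_exp_neg_abs[OF assms(2)], of C]])
     (use assms(1) in simp, intro AE_I2 order_trans[OF assms(3)], simp)

lemma inverse_cosh_le: "1 / cosh y \<le> 2 * exp (- \<bar>y\<bar>)" for y :: real
proof -
  have "exp \<bar>y\<bar> \<le> 2 * cosh \<bar>y\<bar>" by (simp add: cosh_field_def)
  then have "exp \<bar>y\<bar> \<le> 2 * cosh y" by simp
  then show ?thesis by (simp add: exp_minus field_simps)
qed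

lemma inverse_sqrt_cosh_le: "1 / sqrt (2 * cosh y) \<le> exp (- (1/2) * \<bar>y\<bar>)" for y :: real
proof -
  have "exp \<bar>y\<bar> \<le> 2 * cosh \<bar>y\<bar>" by (simp add: cosh_field_def)
  then have "(exp (\<bar>y\<bar> / 2))\<^sup>2 \<le> 2 * cosh y" by (simp flip: exp_of_nat_mult)
  then have "exp (\<bar>y\<bar> / 2) \<le> sqrt (2 * cosh y)" by (rule real_le_rsqrt)
  then show ?thesis by (simp add: exp_minus field_simps)
qed

section \<open>Hyperbolic functions of a complex argument\<close>

lemma cosh_of_real_complex: "cosh (of_real x) = (of_real (cosh x) :: complex)"
  by (simp add: cosh_field_def flip: exp_of_real of_real_minus)

lemma sinh_of_real_complex: "sinh (of_real x) = (of_real (sinh x) :: complex)"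
  by (simp add: sinh_field_def flip: exp_of_real of_real_minus)

lemma cosh_i_times: "cosh (\<i> * z) = cos (z::complex)"
  by (simp add: cos_conv_cosh)

lemma sinh_i_times: "sinh (\<i> * z) = \<i> * sin (z::complex)"
  by (simp add: sin_conv_sinh)

lemma cosh_complex_add:
  "cosh (of_real a + \<i> * of_real b) = complex_of_real (cosh a * cos b) + \<i> * of_real (sinh a * sin b)"
  by (simp add: cosh_add cosh_i_times sinh_i_times cosh_of_real_complex sinh_of_real_complex
      cos_of_real sin_of_real)

lemma sinh_complex_add:
  "sinh (of_real a + \<i> * of_real b) = complex_of_real (sinh a * cos b) + \<i> * of_real (cosh a * sin b)"
  by (simp add: sinh_add cosh_i_times sinh_i_times cosh_of_real_complex sinh_of_real_complex
      cos_of_real sin_of_real)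

lemma cmod_cosh_half: "(cmod (cosh (z/2)))\<^sup>2 = (cosh (Re z) + cos (Im z)) / 2"
proof -
  define a b where "a = Re z / 2" and "b = Im z / 2"
  have z: "z/2 = of_real a + \<i> * of_real b" by (simp add: complex_eq_iff a_def b_def)
  have "(cmod (cosh (z/2)))\<^sup>2 = (cosh a * cos b)\<^sup>2 + (sinh a * sin b)\<^sup>2"
    unfolding z cosh_complex_add by (simp add: cmod_power2)
  also have "\<dots> = (cosh (2*a) + cos (2*b)) / 2"
  proof -
    have "cosh (2*a) = 2 * (cosh a)\<^sup>2 - 1" "cos (2*b) = 2 * (cos b)\<^sup>2 - 1"
      by (rule cosh_double_cosh, rule cos_double_cos)
    then show ?thesis by (simp add: power_mult_distrib sinh_square_eq sin_squared_eq algebra_simps)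
  qed
  finally show ?thesis by (simp add: a_def b_def)
qed

lemma cmod_sinh_half: "(cmod (sinh (z/2)))\<^sup>2 = (cosh (Re z) - cos (Im z)) / 2"
proof -
  define a b where "a = Re z / 2" and "b = Im z / 2"
  have z: "z/2 = of_real a + \<i> * of_real b" by (simp add: complex_eq_iff a_def b_def)
  have "(cmod (sinh (z/2)))\<^sup>2 = (sinh a * cos b)\<^sup>2 + (cosh a * sin b)\<^sup>2"
    unfolding z sinh_complex_add by (simp add: cmod_power2)
  also have "\<dots> = (cosh (2*a) - cos (2*b)) / 2"
  proof -
    have "cosh (2*a) = 2 * (cosh a)\<^sup>2 - 1" "cos (2*b) = 2 * (cos b)\<^sup>2 - 1"
      by (rule cosh_double_cosh, rule cos_double_cos)
    then show ?thesis by (simp add: power_mult_distrib sinh_square_eq sin_squared_eq algebra_simps)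
  qed
  finally show ?thesis by (simp add: a_def b_def)
qed

text \<open>In this strip cos (Im z) > -1, while cosh (Re z) >= 1, so \<open>cmod_cosh_half\<close>
  is positive.\<close>

lemma cosh_half_nonzero: "\<bar>Im z\<bar> < pi \<Longrightarrow> cosh (z/2) \<noteq> (0::complex)"
proof
  assume "\<bar>Im z\<bar> < pi" "cosh (z/2) = 0"
  have "cos pi < cos \<bar>Im z\<bar>"
    using \<open>\<bar>Im z\<bar> < pi\<close> by (intro cos_monotone_0_pi) auto
  then have "- 1 < cos (Im z)" by simp
  then have "0 < cosh (Re z) + cos (Im z)" using cosh_real_ge_1[of "Re z"] by linarith
  then show False using cmod_cosh_half[of z] \<open>cosh (z/2) = 0\<close> by simp
qed

text \<open>Here cos (Im z) is nonnegative, so both bounds can be read off from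
  \<open>cmod_cosh_half\<close> and \<open>cmod_sinh_half\<close>. They control
  \<open>strip_fun\<close> up to and including the lines Im z = pi/2 and Im z = - pi/2.\<close>

lemma
  assumes "\<bar>Im z\<bar> \<le> pi/2"
  shows cmod_cosh_half_ge: "sqrt (2 * cosh (Re z)) \<le> cmod (2 * cosh (z/2))"
    and cmod_tanh_half_le: "cmod (tanh (z/2)) \<le> 2"
proof -
  have c: "0 \<le> cos (Im z)" using assms by (intro cos_ge_zero) auto
  have "2 * cosh (Re z) \<le> (cmod (2 * cosh (z/2)))\<^sup>2"
    using c by (simp add: norm_mult power_mult_distrib cmod_cosh_half)
  then show "sqrt (2 * cosh (Re z)) \<le> cmod (2 * cosh (z/2))" by (intro real_le_lsqrt) auto
  have "(cmod (sinh (z/2)))\<^sup>2 \<le> (2 * cmod (cosh (z/2)))\<^sup>2"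
    using c cosh_real_ge_1[of "Re z"]
    by (simp add: power_mult_distrib cmod_cosh_half cmod_sinh_half)
  then have "cmod (sinh (z/2)) \<le> 2 * cmod (cosh (z/2))" by (rule power2_le_imp_le) simp
  then show "cmod (tanh (z/2)) \<le> 2"
    by (simp add: tanh_def norm_divide divide_le_eq)
qed

section \<open>From rectangular contours to integrals over horizontal lines\<close>

lemma has_contour_integral_linepath_same_Im:
  assumes "a < b" "(f has_contour_integral I) (linepath (Complex a c) (Complex b c))"
  shows "((\<lambda>x. f (Complex x c)) has_integral I) {a..b}"
proof -
  have "((\<lambda>x. f (linepath (Complex a c) (Complex b c) x) * (Complex b c - Complex a c)) has_integral I) {0..1}"
    using assms(2) by (simp add: has_contour_integral_linepath)
  then have "((\<lambda>x. f (Complex (x * (b - a) + a) c) * of_real (b - a)) has_integral I) {0..1}"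
  proof (rule has_integral_cong[THEN iffD1, rotated])
    fix x :: real
    have "linepath (Complex a c) (Complex b c) x = Complex (x * (b - a) + a) c"
      by (simp add: linepath_def complex_eq_iff algebra_simps)
    moreover have "Complex b c - Complex a c = of_real (b - a)" by (simp add: complex_eq_iff)
    ultimately show "f (linepath (Complex a c) (Complex b c) x) * (Complex b c - Complex a c) =
        f (Complex (x * (b - a) + a) c) * of_real (b - a)" by simp
  qed
  from has_integral_affinity'[OF this[unfolded cbox_interval[symmetric]], of "1/(b-a)" "-a/(b-a)"] assms(1)
  have "((\<lambda>x. f (Complex ((x / (b - a) - a/(b - a)) * (b - a) + a) c) * of_real (b - a)) has_integral (b - a) *\<^sub>R I) (cbox a b)"
    by (simp add: divide_simps)
  then have "((\<lambda>x. f (Complex x c) * of_real (b - a)) has_integral (b - a) *\<^sub>R I) {a..b}"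
    using assms(1) by (simp add: diff_divide_distrib[symmetric])
  from has_integral_mult_left[OF this, of "1 / of_real (b - a)"] assms(1)
  show ?thesis by (simp add: scaleR_conv_of_real)
qed

lemma rectangle_contour_limit:
  fixes F :: "complex \<Rightarrow> complex"
  assumes ab: "a < b"
    and contour: "\<And>R. R \<ge> r \<Longrightarrow> (F has_contour_integral I) (rectpath (Complex (-R) a) (Complex R b))"
    and cont: "continuous_on {z. Im z = a \<or> Im z = b \<or> (a \<le> Im z \<and> Im z \<le> b \<and> r \<le> \<bar>Re z\<bar>)} F"
    and bound: "\<And>z. a \<le> Im z \<Longrightarrow> Im z \<le> b \<Longrightarrow> r \<le> \<bar>Re z\<bar> \<Longrightarrow> cmod (F z) \<le> g \<bar>Re z\<bar>"
    and g: "(g \<longlongrightarrow> 0) at_top"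
    and int_a: "integrable lborel (\<lambda>w. F (Complex w a))"
    and int_b: "integrable lborel (\<lambda>w. F (Complex w b))"
  shows "I = (LBINT w. F (Complex w a)) - (LBINT w. F (Complex w b))"
proof -
  define J where "J = (\<lambda>c (n::nat). (LBINT w. indicator {- real n..real n} w *\<^sub>R F (Complex w c)))"
  have J_lim: "J c \<longlonglongrightarrow> (LBINT w. F (Complex w c))" if "integrable lborel (\<lambda>w. F (Complex w c))" for c
    unfolding J_def
  proof (rule integral_dominated_convergence)
    show "integrable lborel (\<lambda>w. norm (F (Complex w c)))" using that by simp
    show "AE w in lborel. (\<lambda>n. indicator {- real n..real n} w *\<^sub>R F (Complex w c)) \<longlonglongrightarrow> F (Complex w c)"
    proof (intro AE_I2 tendsto_eventually)
      fix w :: real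
      obtain n0 where "\<bar>w\<bar> \<le> real n0" using real_arch_simple by blast
      then show "\<forall>\<^sub>F n in sequentially. indicator {- real n..real n} w *\<^sub>R F (Complex w c) = F (Complex w c)"
        by (intro eventually_sequentiallyI[of n0]) (auto simp: indicator_def)
    qed
  qed (use that in \<open>auto simp: indicator_def\<close>)
  have "\<forall>\<^sub>F n in sequentially. cmod (J a n - J b n - I) \<le> 2 * (b - a) * g (real n)"
    \<comment> \<open>The 1 inside the maximum makes R positive, so that the rectangle does not
      degenerate.\<close>
    using eventually_ge_at_top[of "nat \<lceil>max r 1\<rceil>"]
  proof eventually_elim
    case (elim n)
    define R where "R = real n"
    have R: "R \<ge> r" "R > 0" using elim by (auto simp: R_def le_nat_iff ceiling_le_iff)
    define a1 a2 a3 a4 where "a1 = Complex (-R) a" and "a2 = Complex R a" and "a3 = Complex R b" and "a4 = Complex (-R) b"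
    have rp: "rectpath (Complex (-R) a) (Complex R b) = linepath a1 a2 +++ linepath a2 a3 +++ linepath a3 a4 +++ linepath a4 a1"
      by (simp add: rectpath_def Let_def a1_def a2_def a3_def a4_def)
    have "\<And>z. z \<in> closed_segment a1 a2 \<Longrightarrow> Im z = a" "\<And>z. z \<in> closed_segment a3 a4 \<Longrightarrow> Im z = b"
      using R by (auto simp: closed_segment_same_Im a1_def a2_def a3_def a4_def)
    moreover have v1: "Re z = R \<and> a \<le> Im z \<and> Im z \<le> b" if "z \<in> closed_segment a2 a3" for z
      using that ab R by (auto simp: closed_segment_same_Re a2_def a3_def closed_segment_eq_real_ivl)
    moreover have v2: "Re z = -R \<and> a \<le> Im z \<and> Im z \<le> b" if "z \<in> closed_segment a4 a1" for z
      using that ab R by (auto simp: closed_segment_same_Re a4_def a1_def closed_segment_eq_real_ivl)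
    ultimately have ci: "F contour_integrable_on linepath a1 a2" "F contour_integrable_on linepath a2 a3"
      "F contour_integrable_on linepath a3 a4" "F contour_integrable_on linepath a4 a1"
      using R by (auto intro!: contour_integrable_continuous_linepath continuous_on_subset[OF cont])
    have "I = contour_integral (linepath a1 a2 +++ linepath a2 a3 +++ linepath a3 a4 +++ linepath a4 a1) F"
      using contour[OF R(1)] by (simp add: rp contour_integral_unique)
    also have "\<dots> = contour_integral (linepath a1 a2) F + (contour_integral (linepath a2 a3) F
        + (contour_integral (linepath a3 a4) F + contour_integral (linepath a4 a1) F))"
      using ci by (simp add: contour_integral_join valid_path_join)
    finally have I: "I = \<dots>" .
    have J: "contour_integral (linepath (Complex (-R) c) (Complex R c)) F = J c n"
      if "F contour_integrable_on linepath (Complex (-R) c) (Complex R c)" "integrable lborel (\<lambda>w. F (Complex w c))" for c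
    proof -
      have "((\<lambda>x. F (Complex x c)) has_integral contour_integral (linepath (Complex (-R) c) (Complex R c)) F) {-R..R}"
        using R that(1) by (intro has_contour_integral_linepath_same_Im) (auto simp: has_contour_integral_integral)
      moreover have "set_integrable lborel {-R..R} (\<lambda>x. F (Complex x c))"
        unfolding set_integrable_def using that(2) by (intro integrable_mult_indicator) auto
      from has_integral_set_lebesgue[OF absolutely_integrable_on_def[THEN iffD2]]
        set_borel_integral_eq_integral(2)[OF this]
      have "J c n = integral {-R..R} (\<lambda>x. F (Complex x c))"
        by (simp add: J_def set_lebesgue_integral_def R_def)
      ultimately show ?thesis by (simp add: integral_unique)
    qed
    have "contour_integral (linepath a3 a4) F = - contour_integral (linepath a4 a3) F"
      using ci(3) contour_integral_reversepath[of "linepath a4 a3" F] by simp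
    moreover have "F contour_integrable_on linepath a4 a3"
      using ci(3) contour_integrable_reversepath_eq[of "linepath a4 a3" F] by simp
    ultimately have I2: "J a n - J b n - I = - (contour_integral (linepath a2 a3) F + contour_integral (linepath a4 a1) F)"
      using J[of a] J[of b] ci(1) int_a int_b I by (simp add: a1_def a2_def a3_def a4_def)
    have g0: "0 \<le> g R" using bound[of "Complex R a"] R ab order_trans[OF norm_ge_zero] by auto
    have "cmod (contour_integral (linepath a2 a3) F) \<le> g R * cmod (a3 - a2)"
      using g0 ci(2) v1 R bound by (intro contour_integral_bound_linepath) fastforce+
    moreover have "cmod (a3 - a2) = b - a" using ab by (simp add: a2_def a3_def cmod_def)
    moreover have "cmod (contour_integral (linepath a4 a1) F) \<le> g R * cmod (a1 - a4)"
      using g0 ci(4) v2 R bound by (intro contour_integral_bound_linepath) fastforce+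
    moreover have "cmod (a1 - a4) = b - a" using ab by (simp add: a1_def a4_def cmod_def)
    ultimately show ?case unfolding I2 norm_minus_cancel R_def
      using norm_triangle_ineq[of "contour_integral (linepath a2 a3) F" "contour_integral (linepath a4 a1) F"]
      by (simp add: algebra_simps)
  qed
  moreover have "(\<lambda>n. 2 * (b - a) * g (real n)) \<longlonglongrightarrow> 0"
    by (intro tendsto_mult_right_zero filterlim_compose[OF g] filterlim_real_sequentially)
  ultimately have "(\<lambda>n. J a n - J b n - I) \<longlonglongrightarrow> 0" by (rule Lim_null_comparison)
  moreover have "(\<lambda>n. J a n - J b n - I) \<longlonglongrightarrow> (LBINT w. F (Complex w a)) - (LBINT w. F (Complex w b)) - I"
    by (intro tendsto_intros J_lim int_a int_b)
  ultimately show ?thesis using LIMSEQ_unique by fastforce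
qed

section \<open>The Fourier transform of 1 / cosh (w/2)\<close>

lemma cosh_half_add_i_pi: "cosh (z/2 + \<i> * of_real pi) = - cosh (z/2 :: complex)"
  by (simp add: cosh_add cosh_i_times sinh_i_times cos_of_real sin_of_real)

lemma tendsto_inverse_sinh: "((\<lambda>r. C / sinh (r/2)) \<longlongrightarrow> 0) at_top" for C :: real
proof (rule tendsto_divide_0[OF tendsto_const filterlim_at_top_imp_at_infinity])
  have "filterlim (\<lambda>r::real. r/2) at_top at_top"
    using filterlim_tendsto_pos_mult_at_top[OF tendsto_const _ filterlim_ident, of "1/2::real"] by simp
  then show "filterlim (\<lambda>r::real. sinh (r/2)) at_top at_top"
    by (rule filterlim_compose[OF sinh_real_at_top])
qed

lemma integrable_sech_half:
  "integrable lborel (\<lambda>w. exp (\<i> * of_real (y * w)) / of_real (cosh (w/2)))"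
proof (rule integrable_exp_neg_abs_bound[where c="1/2" and C=2])
  show "(\<lambda>w. exp (\<i> * of_real (y * w)) / of_real (cosh (w/2))) \<in> borel_measurable borel"
    by (intro borel_measurable_continuous_onI continuous_intros) auto
  show "norm (exp (\<i> * of_real (y * w)) / of_real (cosh (w/2))) \<le> 2 * exp (- (1/2) * \<bar>w\<bar>)" for w
    using inverse_cosh_le[of "w/2"] by (simp add: norm_divide)
qed simp

text \<open>Residue calculus on 0 <= Im z <= 2 pi, where i pi is the only pole. The contour value 4
  pi exp (- pi y) equals (1 + exp (- 2 pi y)) times the wanted integral.\<close>

lemma fourier_sech:
  fixes y :: real
  shows "(LBINT w. exp (\<i> * of_real (y * w)) / of_real (cosh (w/2))) = of_real (2 * pi / cosh (pi * y))"
proof -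
  define f g where "f = (\<lambda>z. exp (\<i> * of_real y * z))" and "g = (\<lambda>z::complex. cosh (z/2))"
  define F where "F = (\<lambda>z. f z / g z)"
  \<comment> \<open>The bounds -1 and 8 leave room around 0 <= Im z <= 2 pi, but exclude the
    neighbouring zeros - i pi and 3 i pi of cosh (z/2).\<close>
  define S where "S = {z. -1 < Im z \<and> Im z < 8}"
  define p where "p = Complex 0 pi"
  have pib: "3 < pi" "pi < 4" using pi_gt3 pi_less_4 by auto
  have S: "open S" "connected S" "convex S"
  proof -
    have "S = {z. -1 < Im z} \<inter> {z. Im z < 8}" by (auto simp: S_def)
    then show "open S" "convex S"
      by (auto intro!: open_Int convex_Int convex_halfspace_Im_gt convex_halfspace_Im_lt
        simp: open_halfspace_Im_gt open_halfspace_Im_lt)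
    then show "connected S" by (simp add: convex_connected)
  qed
  \<comment> \<open>The strip |Im z| < pi and its translate by 2 pi i are free of zeros and cover
    \<open>S\<close> except for Im z = pi. On that line a zero forces cosh (Re z) = 1, hence Re z =
    0.\<close>
  have zero: "z = p" if "z \<in> S" "g z = 0" for z
  proof -
    have "\<not> \<bar>Im z\<bar> < pi" using cosh_half_nonzero[of z] that by (auto simp: g_def)
    moreover have "\<not> \<bar>Im (z - 2 * \<i> * of_real pi)\<bar> < pi"
    proof
      assume "\<bar>Im (z - 2 * \<i> * of_real pi)\<bar> < pi"
      from cosh_half_nonzero[OF this] have "cosh ((z - 2 * \<i> * of_real pi)/2) \<noteq> 0" .
      moreover have "g z = - cosh ((z - 2 * \<i> * of_real pi)/2)"
        using cosh_half_add_i_pi[of "z - 2 * \<i> * of_real pi"] by (simp add: g_def diff_divide_distrib)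
      ultimately show False using that by simp
    qed
    ultimately have "Im z = pi" using that pib by (auto simp: S_def)
    then have "cosh (Re z) = 1" using cmod_cosh_half[of z] that by (simp add: g_def)
    then show ?thesis using \<open>Im z = pi\<close> by (simp add: p_def complex_eq_iff)
  qed
  have gp: "g p = 0"
  proof -
    have "(cmod (g p))\<^sup>2 = 0" unfolding g_def cmod_cosh_half by (simp add: p_def)
    then show ?thesis by simp
  qed
  have fh: "f holomorphic_on A" for A unfolding f_def by (intro holomorphic_intros)
  have gh: "g holomorphic_on A" for A unfolding g_def cosh_field_def by (intro holomorphic_intros) auto
  have Fh: "F holomorphic_on S - {p}" unfolding F_def using zero by (intro holomorphic_on_divide fh gh) auto
  \<comment> \<open>The simple pole has residue f(p) / g'(p), with g'(p) = sinh (i pi/2) / 2 =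
    i/2.\<close>
  have res: "residue F p = - 2 * \<i> * of_real (exp (- pi * y))"
  proof -
    have p2: "p / 2 = \<i> * of_real (pi/2)" by (simp add: p_def complex_eq_iff)
    have "residue F p = f p / (sinh (p/2) / 2)"
      unfolding F_def
    proof (rule residue_simple_pole_deriv[OF fh[of S] gh[of S] S(1,2)])
      show "p \<in> S" using pib by (simp add: S_def p_def)
      show "(g has_field_derivative sinh (p/2) / 2) (at p)"
        unfolding g_def by (auto intro!: derivative_eq_intros)
      show "f p \<noteq> 0" by (simp add: f_def)
      show "sinh (p/2) / 2 \<noteq> 0" unfolding p2 sinh_i_times by (simp add: sin_of_real del: of_real_divide)
    qed (rule gp)
    also have "sinh (p/2) = \<i>" unfolding p2 sinh_i_times by (simp add: sin_of_real del: of_real_divide)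
    also have "f p = of_real (exp (- pi * y))"
    proof -
      have "\<i> * of_real y * p = of_real (- pi * y)" by (simp add: p_def complex_eq_iff)
      then show ?thesis by (simp only: f_def exp_of_real)
    qed
    finally show ?thesis by (simp add: field_simps)
  qed
  have contour: "(F has_contour_integral (4 * pi * exp (- pi * y))) (rectpath (Complex (-R) 0) (Complex R (2*pi)))"
    if "R \<ge> 1" for R
  proof -
    let ?r = "rectpath (Complex (-R) 0) (Complex R (2*pi))"
    have pin: "p \<in> box (Complex (-R) 0) (Complex R (2*pi))"
      using that by (simp add: p_def in_box_complex_iff)
    have "path_image ?r = cbox (Complex (-R) 0) (Complex R (2*pi)) - box (Complex (-R) 0) (Complex R (2*pi))"
      using that by (intro path_image_rectpath_cbox_minus_box) auto
    moreover have cS: "cbox (Complex (-R) 0) (Complex R (2*pi)) \<subseteq> S"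
      using pib by (auto simp: S_def in_cbox_complex_iff)
    ultimately have pi_sub: "path_image ?r \<subseteq> S - {p}" using pin by auto
    have "contour_integral ?r F = 2 * pi * \<i> * (\<Sum>q\<in>{p}. winding_number ?r q * residue F q)"
    proof (rule Residue_theorem[OF S(1,2) _ Fh _ _ pi_sub])
      show "\<forall>z. z \<notin> S \<longrightarrow> winding_number ?r z = 0"
        using cS that by (auto intro!: winding_number_rectpath_outside)
    qed auto
    also have "\<dots> = of_real (4 * pi * exp (- pi * y))"
      using winding_number_rectpath[OF pin] by (simp add: res)
    finally have ci: "contour_integral ?r F = of_real (4 * pi * exp (- pi * y))" .
    moreover have "F contour_integrable_on ?r"
      by (rule contour_integrable_holomorphic_simple[OF Fh _ _ pi_sub]) (auto simp: S(1) open_Diff)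
    ultimately show ?thesis using has_contour_integral_integral[of F ?r] by simp
  qed
  \<comment> \<open>Since \<open>cosh (z/2)\<close> changes sign under \<open>z \<mapsto> z + 2\<pi>i\<close>, the integrals over the two horizontal
    sides are proportional.\<close>
  have F0: "F (Complex w 0) = exp (\<i> * of_real (y * w)) / of_real (cosh (w/2))" for w
    by (simp add: F_def f_def g_def Complex_eq cosh_of_real_complex[symmetric] algebra_simps)
  have F1: "F (Complex w (2*pi)) = - of_real (exp (- 2 * pi * y)) * F (Complex w 0)" for w
  proof -
    have "g (Complex w (2*pi)) = - g (Complex w 0)"
      using cosh_half_add_i_pi[of "of_real w"] by (simp add: g_def Complex_eq add_divide_distrib)
    moreover have "f (Complex w (2*pi)) = of_real (exp (- 2 * pi * y)) * f (Complex w 0)"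
    proof -
      have "\<i> * of_real y * Complex w (2*pi) = of_real (- 2 * pi * y) + \<i> * of_real y * Complex w 0"
        by (simp add: complex_eq_iff)
      then show ?thesis by (simp only: f_def exp_add exp_of_real)
    qed
    ultimately show ?thesis by (simp add: F_def)
  qed
  let ?I = "(LBINT w. F (Complex w 0))"
  have i0: "integrable lborel (\<lambda>w. F (Complex w 0))"
    unfolding F0 by (rule integrable_sech_half)
  have "complex_of_real (4 * pi * exp (- pi * y)) = ?I - (LBINT w. F (Complex w (2*pi)))"
  proof (rule rectangle_contour_limit[where r=1 and g="\<lambda>r. exp (8 * \<bar>y\<bar>) / sinh (r/2)"])
    show "continuous_on {z. Im z = 0 \<or> Im z = 2*pi \<or> (0 \<le> Im z \<and> Im z \<le> 2*pi \<and> 1 \<le> \<bar>Re z\<bar>)} F"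
      using pib by (intro continuous_on_subset[OF holomorphic_on_imp_continuous_on[OF Fh]]) (auto simp: S_def p_def)
    fix z assume z: "0 \<le> Im z" "Im z \<le> 2*pi" "1 \<le> \<bar>Re z\<bar>"
    have "cmod (f z) = exp (- y * Im z)" by (simp add: f_def)
    also have "\<dots> \<le> exp (8 * \<bar>y\<bar>)"
    proof -
      have "- y * Im z \<le> \<bar>y\<bar> * Im z" using z by (intro mult_right_mono) auto
      also have "\<dots> \<le> \<bar>y\<bar> * 8" using z pib by (intro mult_left_mono) auto
      finally show ?thesis by simp
    qed
    finally have 1: "cmod (f z) \<le> exp (8 * \<bar>y\<bar>)" .
    \<comment> \<open>The worst case cos (Im z) = -1 of \<open>cmod_cosh_half\<close> still leaves
      the square of sinh (Re z / 2).\<close>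
    have "(sinh (\<bar>Re z\<bar>/2))\<^sup>2 \<le> (cmod (g z))\<^sup>2"
    proof -
      have "cosh (2 * (\<bar>Re z\<bar>/2)) = 2 * (cosh (\<bar>Re z\<bar>/2))\<^sup>2 - 1" by (rule cosh_double_cosh)
      then have "2 * (sinh (\<bar>Re z\<bar>/2))\<^sup>2 = cosh (Re z) - 1" by (simp add: sinh_square_eq)
      moreover have "2 * (cmod (g z))\<^sup>2 = cosh (Re z) + cos (Im z)" by (simp add: g_def cmod_cosh_half)
      moreover have "- 1 \<le> cos (Im z)" by simp
      ultimately show ?thesis by linarith
    qed
    then have "sinh (\<bar>Re z\<bar>/2) \<le> cmod (g z)" by (rule power2_le_imp_le) simp
    moreover have "0 < sinh (\<bar>Re z\<bar>/2)" using z by simp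
    ultimately show "cmod (F z) \<le> exp (8 * \<bar>y\<bar>) / sinh (\<bar>Re z\<bar>/2)"
      using 1 by (simp add: F_def norm_divide frac_le)
  next
    show "integrable lborel (\<lambda>w. F (Complex w (2*pi)))"
      unfolding F1 by (rule integrable_mult_right[OF i0])
  qed (simp, erule contour, rule tendsto_inverse_sinh, rule i0)
  also have "\<dots> = of_real (1 + exp (- 2 * pi * y)) * ?I" by (simp add: F1 distrib_right)
  finally have *: "complex_of_real (4 * pi * exp (- pi * y)) = of_real (1 + exp (- 2 * pi * y)) * ?I" .
  have pos: "0 < 1 + exp (- 2 * pi * y)" by (simp add: add_pos_pos)
  have "?I = of_real (4 * pi * exp (- pi * y) / (1 + exp (- 2 * pi * y)))"
    unfolding of_real_divide * using pos
    by (intro nonzero_mult_div_cancel_left[symmetric]) (metis less_numeral_extra(3) of_real_eq_0_iff)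
  also have "4 * pi * exp (- pi * y) / (1 + exp (- 2 * pi * y)) = 2 * pi / cosh (pi * y)"
  proof -
    have "exp (- pi * y) * (2 * cosh (pi * y)) = 1 + exp (- 2 * pi * y)"
      by (simp add: cosh_field_def algebra_simps flip: exp_add)
    from arg_cong[OF this, of "\<lambda>t. 2 * pi * t"]
    have "4 * pi * exp (- pi * y) * cosh (pi * y) = 2 * pi * (1 + exp (- 2 * pi * y))" by simp
    then show ?thesis using pos by (subst frac_eq_eq) auto
  qed
  finally show ?thesis unfolding F0 .
qed

section \<open>The kernel on the line Im z = pi/2\<close>

text \<open>
  For \<open>z = w + i\<pi>/2\<close>, these are the explicit forms of \<open>tanh (z/2)\<close> and \<open>2 cosh (z/2)\<close>.
\<close>

definition arc :: "real \<Rightarrow> complex" where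
  "arc w = Complex (tanh w) (1 / cosh w)"

definition arc_denom :: "real \<Rightarrow> complex" where
  "arc_denom w = of_real (sqrt 2) * Complex (cosh (w/2)) (sinh (w/2))"

text \<open>The function E(x,w) of the overview.\<close>

definition arc_kernel :: "real \<Rightarrow> real \<Rightarrow> complex" where
  "arc_kernel x w = exp (\<i> * of_real x * arc w) / arc_denom w"

lemma arc_denom_nonzero [simp]: "arc_denom w \<noteq> 0"
  by (auto simp: arc_denom_def complex_eq_iff)

lemma cosh_half_conv_arc_denom: "2 * cosh (Complex w (pi/2) / 2) = arc_denom w"
proof -
  have "Complex w (pi/2) / 2 = of_real (w/2) + \<i> * of_real (pi/4)" by (simp add: complex_eq_iff)
  then have "2 * cosh (Complex w (pi/2) / 2) = 2 * (of_real (cosh (w/2) * cos (pi/4)) + \<i> * of_real (sinh (w/2) * sin (pi/4)))"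
    by (simp only: cosh_complex_add)
  then show ?thesis by (simp add: arc_denom_def cos_45 sin_45 complex_eq_iff)
qed

lemma sinh_half_conv_arc_denom: "2 * sinh (Complex w (pi/2) / 2) = of_real (sqrt 2) * Complex (sinh (w/2)) (cosh (w/2))"
proof -
  have "Complex w (pi/2) / 2 = of_real (w/2) + \<i> * of_real (pi/4)" by (simp add: complex_eq_iff)
  then have "2 * sinh (Complex w (pi/2) / 2) = 2 * (of_real (sinh (w/2) * cos (pi/4)) + \<i> * of_real (cosh (w/2) * sin (pi/4)))"
    by (simp only: sinh_complex_add)
  then show ?thesis by (simp add: cos_45 sin_45 complex_eq_iff)
qed

text \<open>Both sides are 2 sinh (z/2) at z = w + i pi/2. In this form without division the
  identity clears denominators in \<open>arc_arc_denom_identity\<close>.\<close>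

lemma arc_mult_arc_denom: "arc w * arc_denom w = of_real (sqrt 2) * Complex (sinh (w/2)) (cosh (w/2))"
proof -
  have c: "cosh w = (cosh (w/2))\<^sup>2 + (sinh (w/2))\<^sup>2" and s: "sinh w = 2 * sinh (w/2) * cosh (w/2)"
    using cosh_double[of "w/2"] sinh_double[of "w/2"] by simp_all
  have h: "(cosh (w/2))\<^sup>2 = (sinh (w/2))\<^sup>2 + 1" by (rule cosh_square_eq)
  have "of_real (cosh w) * arc w = Complex (sinh w) 1" by (simp add: arc_def complex_eq_iff tanh_def)
  then have "of_real (cosh w) * (arc w * arc_denom w) = Complex (sinh w) 1 * arc_denom w" by (simp flip: mult.assoc)
  also have "\<dots> = of_real (cosh w) * (of_real (sqrt 2) * Complex (sinh (w/2)) (cosh (w/2)))"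
    unfolding c s using h by (simp add: arc_denom_def complex_eq_iff power2_eq_square) algebra
  finally show ?thesis by simp
qed

lemma tanh_half_conv_arc: "tanh (Complex w (pi/2) / 2) = arc w"
proof -
  have "tanh (Complex w (pi/2) / 2) = (2 * sinh (Complex w (pi/2) / 2)) / (2 * cosh (Complex w (pi/2) / 2))"
    by (simp add: tanh_def)
  also have "\<dots> = arc w"
    unfolding cosh_half_conv_arc_denom sinh_half_conv_arc_denom arc_mult_arc_denom[symmetric] by simp
  finally show ?thesis .
qed

lemma cmod_arc_denom: "cmod (arc_denom w) = sqrt (2 * cosh w)"
proof -
  have "cosh w = (cosh (w/2))\<^sup>2 + (sinh (w/2))\<^sup>2" using cosh_double[of "w/2"] by simp
  then have "(cmod (arc_denom w))\<^sup>2 = 2 * cosh w" by (simp add: arc_denom_def norm_mult cmod_power2 power_mult_distrib algebra_simps)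
  then show ?thesis by (metis norm_ge_zero real_sqrt_unique)
qed

lemma cmod_arc_kernel: "cmod (arc_kernel x w) = exp (- x / cosh w) / sqrt (2 * cosh w)"
  by (simp add: arc_kernel_def norm_divide cmod_arc_denom arc_def)

lemma continuous_on_arc [continuous_intros]: "continuous_on S f \<Longrightarrow> continuous_on S (\<lambda>w. arc (f w))"
  unfolding arc_def Complex_eq by (auto intro!: continuous_intros)

lemma continuous_on_arc_denom [continuous_intros]: "continuous_on S f \<Longrightarrow> continuous_on S (\<lambda>w. arc_denom (f w))"
  unfolding arc_denom_def Complex_eq by (auto intro!: continuous_intros)

lemma continuous_on_arc_kernel [continuous_intros]:
  "continuous_on S f \<Longrightarrow> continuous_on S g \<Longrightarrow> continuous_on S (\<lambda>w. arc_kernel (f w) (g w))"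
  unfolding arc_kernel_def by (auto intro!: continuous_intros)

lemma arc_kernel_measurable [measurable]: "arc_kernel x \<in> borel_measurable borel"
  by (intro borel_measurable_continuous_onI continuous_intros)

text \<open>Covers both signs of x, because \<open>arc_kernel (- x)\<close> with x > 0 enters
  through the sinc kernel; its growth is limited by cosh w >= 1.\<close>

lemma cmod_arc_kernel_le: "cmod (arc_kernel x w) \<le> exp \<bar>x\<bar> * exp (- (1/2) * \<bar>w\<bar>)"
proof -
  have "- x / cosh w \<le> \<bar>x\<bar> / cosh w" by (intro divide_right_mono) auto
  also have "\<dots> \<le> \<bar>x\<bar>" using cosh_real_ge_1[of w] mult_left_mono[of 1 "cosh w" "\<bar>x\<bar>"] by (simp add: divide_le_eq)
  finally have "exp (- x / cosh w) * (1 / sqrt (2 * cosh w)) \<le> exp \<bar>x\<bar> * exp (- (1/2) * \<bar>w\<bar>)"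
    by (intro mult_mono inverse_sqrt_cosh_le) auto
  then show ?thesis by (simp add: cmod_arc_kernel)
qed

lemma arc_kernel_integrable: "integrable lborel (arc_kernel x)"
  by (rule integrable_exp_neg_abs_bound[of _ "1/2" "exp \<bar>x\<bar>"]) (auto intro: cmod_arc_kernel_le[simplified])

section \<open>Contour shift in the strip\<close>

abbreviation wave :: "real \<Rightarrow> real \<Rightarrow> complex" where
  "wave \<xi> w \<equiv> exp (\<i> * of_real (\<xi> / (2*pi) * w))"

text \<open>The integrand of \<open>q_plus\<close> after the substitution u = - tanh (w/2),
  continued from real w to complex z.\<close>

definition strip_fun :: "real \<Rightarrow> real \<Rightarrow> complex \<Rightarrow> complex" where
  "strip_fun x \<xi> z = exp (\<i> * of_real x * tanh (z/2)) * exp (\<i> * of_real (\<xi> / (2*pi)) * z) / (2 * cosh (z/2))"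

lemma strip_fun_holomorphic: "strip_fun x \<xi> holomorphic_on {z. \<bar>Im z\<bar> < pi}"
proof -
  have "(\<lambda>z::complex. cosh (z/2)) holomorphic_on A" "(\<lambda>z::complex. sinh (z/2)) holomorphic_on A" for A
    unfolding cosh_field_def sinh_field_def by (intro holomorphic_intros; simp)+
  then show ?thesis
    unfolding strip_fun_def tanh_def by (intro holomorphic_intros) (auto simp: cosh_half_nonzero)
qed

lemma cmod_strip_fun_le:
  assumes "\<bar>Im z\<bar> \<le> pi/2"
  shows "cmod (strip_fun x \<xi> z) \<le> exp (2 * \<bar>x\<bar> + \<bar>\<xi>\<bar>) * exp (- (1/2) * \<bar>Re z\<bar>)"
proof -
  have "cmod (exp (\<i> * of_real x * tanh (z/2))) \<le> exp (2 * \<bar>x\<bar>)"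
  proof -
    have "cmod (exp (\<i> * of_real x * tanh (z/2))) \<le> exp (cmod (\<i> * of_real x * tanh (z/2)))"
      by (rule norm_exp)
    also have "\<dots> \<le> exp (2 * \<bar>x\<bar>)"
      using mult_left_mono[OF cmod_tanh_half_le[OF assms], of "\<bar>x\<bar>"] by (simp add: norm_mult mult.commute)
    finally show ?thesis .
  qed
  moreover have "cmod (exp (\<i> * of_real (\<xi> / (2*pi)) * z)) \<le> exp \<bar>\<xi>\<bar>"
  proof -
    have "- (\<xi> / (2*pi)) * Im z \<le> \<bar>\<xi> / (2*pi)\<bar> * \<bar>Im z\<bar>"
      using abs_ge_self[of "- (\<xi> / (2*pi)) * Im z"] by (simp add: abs_mult)
    also have "\<dots> \<le> \<bar>\<xi> / (2*pi)\<bar> * (2 * pi)" using assms pi_gt_zero by (intro mult_left_mono) linarith+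
    also have "\<dots> = \<bar>\<xi>\<bar>" by (simp add: abs_mult)
    finally show ?thesis by simp
  qed
  moreover have "1 / cmod (2 * cosh (z/2)) \<le> exp (- (1/2) * \<bar>Re z\<bar>)"
  proof -
    have "1 / cmod (2 * cosh (z/2)) \<le> 1 / sqrt (2 * cosh (Re z))"
      by (rule frac_le[OF _ _ _ cmod_cosh_half_ge[OF assms]]) auto
    then show ?thesis using inverse_sqrt_cosh_le[of "Re z"] by linarith
  qed
  ultimately have "cmod (exp (\<i> * of_real x * tanh (z/2))) * cmod (exp (\<i> * of_real (\<xi> / (2*pi)) * z)) * (1 / cmod (2 * cosh (z/2)))
    \<le> exp (2 * \<bar>x\<bar>) * exp \<bar>\<xi>\<bar> * exp (- (1/2) * \<bar>Re z\<bar>)"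
    by (intro mult_mono) auto
  then show ?thesis by (simp add: strip_fun_def norm_mult norm_divide exp_add)
qed

lemma strip_fun_measurable_line: "\<bar>a\<bar> < pi \<Longrightarrow> (\<lambda>w. strip_fun x \<xi> (Complex w a)) \<in> borel_measurable borel"
  by (intro borel_measurable_continuous_onI continuous_on_compose2[OF holomorphic_on_imp_continuous_on[OF strip_fun_holomorphic]])
     (auto simp: Complex_eq intro!: continuous_intros)

lemma strip_fun_integrable_line:
  assumes "\<bar>a\<bar> \<le> pi/2"
  shows "integrable lborel (\<lambda>w. strip_fun x \<xi> (Complex w a))"
proof -
  have "\<bar>a\<bar> < pi" using assms pi_gt_zero by linarith
  then show ?thesis
  proof (intro integrable_exp_neg_abs_bound[of _ "1/2" "exp (2 * \<bar>x\<bar> + \<bar>\<xi>\<bar>)"] strip_fun_measurable_line)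
    show "norm (strip_fun x \<xi> (Complex w a)) \<le> exp (2 * \<bar>x\<bar> + \<bar>\<xi>\<bar>) * exp (- (1/2) * \<bar>w\<bar>)" for w
      using cmod_strip_fun_le[of "Complex w a" x \<xi>] assms by simp
  qed auto
qed

text \<open>No pole lies between the two lines, so Cauchy's theorem gives contour value 0, and the
  integrand decays like exp (- |Re z| / 2).\<close>

lemma strip_fun_integral_shift:
  assumes "- (pi/2) \<le> a" "a < b" "b \<le> pi/2"
  shows "(LBINT w. strip_fun x \<xi> (Complex w a)) = (LBINT w. strip_fun x \<xi> (Complex w b))"
proof -
  have pi2: "pi / 2 < pi" by simp
  have "0 = (LBINT w. strip_fun x \<xi> (Complex w a)) - (LBINT w. strip_fun x \<xi> (Complex w b))"
  proof (rule rectangle_contour_limit[OF assms(2), where r=1])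
    have "{z. \<bar>Im z\<bar> < pi} = {z. Im z < pi} \<inter> {z. - pi < Im z}" by auto
    then have conv: "convex {z. \<bar>Im z\<bar> < pi}" by (simp add: convex_Int convex_halfspace_Im_gt convex_halfspace_Im_lt)
    fix R :: real assume "1 \<le> R"
    then have "path_image (rectpath (Complex (-R) a) (Complex R b)) \<subseteq> cbox (Complex (-R) a) (Complex R b)"
      using assms by (intro path_image_rectpath_subset_cbox) auto
    also have "\<dots> \<subseteq> {z. \<bar>Im z\<bar> < pi}"
      using assms pi2 by (auto simp: in_cbox_complex_iff abs_less_iff)
    finally show "(strip_fun x \<xi> has_contour_integral 0) (rectpath (Complex (-R) a) (Complex R b))"
      by (intro Cauchy_theorem_convex_simple[OF strip_fun_holomorphic conv]) auto
  next
    show "continuous_on {z. Im z = a \<or> Im z = b \<or> a \<le> Im z \<and> Im z \<le> b \<and> 1 \<le> \<bar>Re z\<bar>} (strip_fun x \<xi>)"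
      using assms pi2 by (intro continuous_on_subset[OF holomorphic_on_imp_continuous_on[OF strip_fun_holomorphic]])
        (auto simp: abs_less_iff)
  next
    fix z assume "a \<le> Im z" "Im z \<le> b"
    then show "cmod (strip_fun x \<xi> z) \<le> exp (2 * \<bar>x\<bar> + \<bar>\<xi>\<bar>) * exp (- (1/2) * \<bar>Re z\<bar>)"
      using assms by (intro cmod_strip_fun_le) auto
  next
    show "((\<lambda>r. exp (2 * \<bar>x\<bar> + \<bar>\<xi>\<bar>) * exp (- (1/2) * r)) \<longlongrightarrow> 0) at_top"
      by real_asymp
  qed (use assms in \<open>auto intro!: strip_fun_integrable_line\<close>)
  then show ?thesis by simp
qed

text \<open>The integral factor of \<open>q_plus\<close> in the coordinate xi = ln (1/s - 1),
  without the elementary prefactor.\<close>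

definition q_int :: "real \<Rightarrow> real \<Rightarrow> complex" where
  "q_int x \<xi> = (LBINT w. strip_fun x \<xi> (of_real w))"

text \<open>The imaginary part pi/2 splits the factor exp (- xi/4) off the wave, since i (xi / (2
  pi)) (i pi/2) = - xi/4.\<close>

lemma strip_fun_upper: "strip_fun x \<xi> (Complex w (pi/2)) = of_real (exp (- \<xi> / 4)) * (arc_kernel x w * wave \<xi> w)"
proof -
  have "\<i> * of_real (\<xi> / (2*pi)) * Complex w (pi/2) = of_real (- \<xi> / 4) + \<i> * of_real (\<xi> / (2*pi) * w)"
    by (simp add: complex_eq_iff)
  then have "exp (\<i> * of_real (\<xi> / (2*pi)) * Complex w (pi/2)) = of_real (exp (- \<xi> / 4)) * wave \<xi> w"
    by (simp only: exp_add exp_of_real)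
  then show ?thesis
    by (simp add: strip_fun_def tanh_half_conv_arc cosh_half_conv_arc_denom arc_kernel_def)
qed

text \<open>Conjugation of z exchanges the two lines. Conjugating exp (i x tanh (z/2)) also reverses
  the sign of x, hence \<open>arc_kernel (- x)\<close>.\<close>

lemma strip_fun_lower:
  "strip_fun x \<xi> (Complex w (- (pi/2))) = of_real (exp (\<xi> / 4)) * (cnj (arc_kernel (- x) w) * wave \<xi> w)"
proof -
  have "\<i> * of_real (\<xi> / (2*pi)) * Complex w (- (pi/2)) = of_real (\<xi> / 4) + \<i> * of_real (\<xi> / (2*pi) * w)"
    by (simp add: complex_eq_iff)
  then have 1: "exp (\<i> * of_real (\<xi> / (2*pi)) * Complex w (- (pi/2))) = of_real (exp (\<xi> / 4)) * wave \<xi> w"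
    by (simp only: exp_add exp_of_real)
  have c: "Complex w (- (pi/2)) / 2 = cnj (Complex w (pi/2) / 2)" by (simp add: complex_eq_iff)
  have "2 * cosh (Complex w (- (pi/2)) / 2) = cnj (2 * cosh (Complex w (pi/2) / 2))"
    unfolding c by (simp add: cosh_field_def exp_cnj)
  moreover have "tanh (Complex w (- (pi/2)) / 2) = cnj (tanh (Complex w (pi/2) / 2))"
    unfolding c by (simp add: tanh_def cosh_field_def sinh_field_def exp_cnj)
  moreover have "exp (\<i> * of_real x * cnj (arc w)) = cnj (exp (\<i> * of_real (- x) * arc w))"
    unfolding exp_cnj by simp
  ultimately show ?thesis
    unfolding strip_fun_def 1 by (simp add: tanh_half_conv_arc cosh_half_conv_arc_denom arc_kernel_def)
qed

lemma integral_arc_kernel_exp: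
  "(LBINT w. arc_kernel x w * wave \<xi> w) = of_real (exp (\<xi> / 4)) * q_int x \<xi>"
proof -
  have "q_int x \<xi> = (LBINT w. strip_fun x \<xi> (Complex w (pi/2)))"
    using strip_fun_integral_shift[of 0 "pi/2" x \<xi>] by (simp add: q_int_def complex_of_real_def)
  also have "\<dots> = of_real (exp (- \<xi> / 4)) * (LBINT w. arc_kernel x w * wave \<xi> w)"
    unfolding strip_fun_upper by (rule integral_mult_right_zero)
  finally show ?thesis by (simp flip: of_real_mult exp_add mult.assoc)
qed

text \<open>Shifting downwards instead of upwards changes the sign of the exponent. The quotient exp
  (- xi/2) of the two factors, times 1 / (2 cosh (xi/2)), will be the eigenvalue s of K.\<close>

lemma integral_cnj_arc_kernel_exp:
  "(LBINT w. cnj (arc_kernel (- x) w) * wave \<xi> w) = of_real (exp (- \<xi> / 4)) * q_int x \<xi>"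
proof -
  have "q_int x \<xi> = (LBINT w. strip_fun x \<xi> (Complex w (- (pi/2))))"
    using strip_fun_integral_shift[of "- (pi/2)" 0 x \<xi>] by (simp add: q_int_def complex_of_real_def)
  also have "\<dots> = of_real (exp (\<xi> / 4)) * (LBINT w. cnj (arc_kernel (- x) w) * wave \<xi> w)"
    unfolding strip_fun_lower by (rule integral_mult_right_zero)
  finally show ?thesis by (simp flip: of_real_mult exp_add mult.assoc)
qed

section \<open>Inner products of the kernel over the half line\<close>

lemma
  fixes c :: complex assumes "0 < Re c"
  shows set_integrable_cexp: "set_integrable lborel {0<..} (\<lambda>x. exp (- c * of_real x))"
    and set_integral_cexp: "(LBINT x:{0<..}. exp (- c * of_real x)) = 1 / c"
proof -
  have q_const: "c \<noteq> 0" using assms by auto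
  show si: "set_integrable lborel {0<..} (\<lambda>x. exp (- c * of_real x))"
    unfolding set_integrable_def
  proof (rule integrable_exp_neg_abs_bound[of _ "Re c" 1])
    show "(\<lambda>x. indicator {0<..} x *\<^sub>R exp (- c * of_real x)) \<in> borel_measurable borel"
      by (intro borel_measurable_scaleR borel_measurable_indicator borel_measurable_continuous_onI continuous_intros) auto
  qed (use assms in \<open>auto simp: indicator_def\<close>)
  have "(LBINT x=0..\<infinity>. exp (- c * of_real x)) = 0 - (- 1 / c)"
  proof (rule interval_integral_FTC_integrable[where F="\<lambda>x. - exp (- c * of_real x) / c"])
    fix x :: real
    show "((\<lambda>x. - exp (- c * of_real x) / c) has_vector_derivative exp (- c * of_real x)) (at x)"
      using q_const by (auto intro!: derivative_eq_intros has_vector_derivative_real_field)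
    show "isCont (\<lambda>x. exp (- c * of_real x)) x" by (intro continuous_intros)
  next
    show "set_integrable lborel (einterval 0 \<infinity>) (\<lambda>x. exp (- c * of_real x))"
      using si by (simp add: zero_ereal_def)
    show "(((\<lambda>x. - exp (- c * of_real x) / c) \<circ> real_of_ereal) \<longlongrightarrow> - 1 / c) (at_right 0)"
      unfolding zero_ereal_def ereal_tendsto_simps1
      using q_const by (auto intro!: tendsto_eq_intros simp: ereal_tendsto_simps)
    have "((\<lambda>x. exp (- Re c * x)) \<longlongrightarrow> 0) at_top"
      using assms by real_asymp
    then have "((\<lambda>x. exp (- c * of_real x)) \<longlongrightarrow> 0) at_top"
      by (intro tendsto_norm_zero_cancel[where f="\<lambda>x. exp (- c * of_real x)"]) simp
    then have "((\<lambda>x. - exp (- c * of_real x) / c) \<longlongrightarrow> - 0 / c) at_top"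
      using q_const by (intro tendsto_intros) auto
    then show "(((\<lambda>x. - exp (- c * of_real x) / c) \<circ> real_of_ereal) \<longlongrightarrow> 0) (at_left \<infinity>)"
      unfolding ereal_tendsto_simps1 by (simp add: ereal_tendsto_simps)
  qed simp
  then show "(LBINT x:{0<..}. exp (- c * of_real x)) = 1 / c"
    by (simp add: interval_integral_to_infinity_eq zero_ereal_def)
qed

lemma arc_kernel_mult_cnj:
  "arc_kernel x w * cnj (arc_kernel x v) = exp (- (- \<i> * (arc w - cnj (arc v))) * of_real x) / (arc_denom w * cnj (arc_denom v))"
proof -
  have "cnj (exp (\<i> * of_real x * arc v)) = exp (- \<i> * of_real x * cnj (arc v))"
    by (simp add: exp_cnj)
  then show ?thesis by (simp add: arc_kernel_def exp_add[symmetric] algebra_simps)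
qed

text \<open>For z and zeta on the line Im = pi/2 above w and v this is an addition theorem: sinh
  (z/2) cnj (cosh (zeta/2)) - cosh (z/2) cnj (sinh (zeta/2)) = sinh ((w - v + i pi)/2) = i cosh ((w
  - v)/2), multiplied by -4 i.\<close>

lemma arc_arc_denom_identity:
  "(- \<i> * (arc w - cnj (arc v))) * (arc_denom w * cnj (arc_denom v)) = of_real (4 * cosh ((w - v)/2))"
proof -
  have "(arc w - cnj (arc v)) * (arc_denom w * cnj (arc_denom v)) = (arc w * arc_denom w) * cnj (arc_denom v) - arc_denom w * cnj (arc v * arc_denom v)"
    by (simp add: algebra_simps)
  also have "\<dots> = of_real 2 * (Complex (sinh (w/2)) (cosh (w/2)) * cnj (Complex (cosh (v/2)) (sinh (v/2)))
     - Complex (cosh (w/2)) (sinh (w/2)) * cnj (Complex (sinh (v/2)) (cosh (v/2))))"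
  proof -
    have "(r * A) * (r * B) - (r * C) * (r * D) = 2 * (A * B - C * D)" if "r * r = 2" for A B C D r :: complex
    proof -
      have "(r * A) * (r * B) - (r * C) * (r * D) = (r * r) * (A * B - C * D)" by (simp add: algebra_simps)
      then show ?thesis using that by simp
    qed
    moreover have "of_real (sqrt 2) * of_real (sqrt 2) = (2::complex)" by (simp flip: of_real_mult)
    ultimately show ?thesis
      unfolding arc_mult_arc_denom unfolding arc_denom_def complex_cnj_mult complex_cnj_complex_of_real by simp
  qed
  finally show ?thesis
    by (simp only: mult.assoc) (simp add: complex_eq_iff diff_divide_distrib cosh_diff algebra_simps)
qed

lemma Re_arc: "Re (- \<i> * (arc w - cnj (arc v))) = 1 / cosh w + 1 / cosh v"
  by (simp add: arc_def)

text \<open>\<open>arc\<close> stays in the upper half plane, so the exponential in x has a rate c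
  with positive real part and integrates to 1 / c; \<open>arc_arc_denom_identity\<close> evaluates
  the remaining quotient.\<close>

lemma
  shows set_integrable_arc_kernel_mult: "set_integrable lborel {0<..} (\<lambda>x. arc_kernel x w * cnj (arc_kernel x v))"
    and set_integral_arc_kernel_mult: "(LBINT x:{0<..}. arc_kernel x w * cnj (arc_kernel x v)) = 1 / of_real (4 * cosh ((w - v)/2))"
proof -
  define c where "c = - \<i> * (arc w - cnj (arc v))"
  have c: "0 < Re c" unfolding c_def Re_arc by (simp add: add_pos_pos)
  show "set_integrable lborel {0<..} (\<lambda>x. arc_kernel x w * cnj (arc_kernel x v))"
    unfolding arc_kernel_mult_cnj c_def[symmetric] divide_inverse using set_integrable_cexp[OF c] by (intro set_integrable_mult_left) auto
  have "(LBINT x:{0<..}. arc_kernel x w * cnj (arc_kernel x v)) = 1 / (c * (arc_denom w * cnj (arc_denom v)))"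
    unfolding arc_kernel_mult_cnj c_def[symmetric] divide_inverse using set_integral_cexp[OF c] by (simp add: divide_inverse)
  then show "(LBINT x:{0<..}. arc_kernel x w * cnj (arc_kernel x v)) = 1 / of_real (4 * cosh ((w - v)/2))"
    unfolding c_def arc_arc_denom_identity .
qed

text \<open>The modulus integrates to p q / c with c = 2 p^2 + 2 q^2, and 4 p q <= c is the
  inequality of arithmetic and geometric mean. A bound independent of w and v permits Fubini for
  arbitrary integrable densities.\<close>

lemma set_integral_norm_arc_kernel_mult:
  "(LBINT x:{0<..}. cmod (arc_kernel x w * cnj (arc_kernel x v))) \<le> 1/4"
proof -
  define c where "c = 1 / cosh w + 1 / cosh v"
  define p where "p = 1 / sqrt (2 * cosh w)"
  define q where "q = 1 / sqrt (2 * cosh v)"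
  have c: "0 < c" unfolding c_def by (simp add: add_pos_pos)
  have pq: "c = 2 * p\<^sup>2 + 2 * q\<^sup>2" by (simp add: p_def q_def c_def power_divide real_sqrt_pow2)
  have n: "cmod (arc_kernel x w * cnj (arc_kernel x v)) = Re (exp (- of_real c * of_real x)) * (p * q)" for x
  proof -
    have "exp (- of_real c * of_real x) = complex_of_real (exp (- c * x))" by (simp flip: exp_of_real)
    then have "Re (exp (- of_real c * of_real x)) = exp (- x / cosh w) * exp (- x / cosh v)"
      by (simp add: c_def algebra_simps flip: exp_add)
    then show ?thesis by (simp add: norm_mult cmod_arc_kernel p_def q_def)
  qed
  have si: "set_integrable lborel {0<..} (\<lambda>x. exp (- of_real c * complex_of_real x))"
    using c by (intro set_integrable_cexp) simp
  have "(LBINT x:{0<..}. cmod (arc_kernel x w * cnj (arc_kernel x v))) = Re (1 / of_real c) * (p * q)"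
    unfolding n
    using integral_Re[OF si[unfolded set_integrable_def]] set_integral_cexp[of "of_real c"] c
    by (simp add: set_lebesgue_integral_def)
  also have "\<dots> = p * q / c" by (simp add: Re_divide_of_real)
  also have "\<dots> \<le> 1/4"
  proof -
    have "0 \<le> 2 * (p - q)\<^sup>2" by simp
    then have "4 * (p * q) \<le> c" unfolding pq by (simp add: power2_diff)
    then show ?thesis using c by (simp add: divide_le_eq)
  qed
  finally show ?thesis .
qed

lemma arc_denom_power2: "(arc_denom w)\<^sup>2 = 2 * Complex 1 (sinh w)"
proof -
  have "sinh w = 2 * sinh (w/2) * cosh (w/2)" using sinh_double[of "w/2"] by simp
  moreover have "(cosh (w/2))\<^sup>2 = (sinh (w/2))\<^sup>2 + 1" by (rule cosh_square_eq)
  ultimately have "(Complex (cosh (w/2)) (sinh (w/2)))\<^sup>2 = Complex 1 (sinh w)"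
    by (simp add: complex_eq_iff power2_eq_square)
  moreover have "(of_real (sqrt 2))\<^sup>2 = (2::complex)" by (simp flip: of_real_power)
  then have "(arc_denom w)\<^sup>2 = 2 * (Complex (cosh (w/2)) (sinh (w/2)))\<^sup>2" by (simp add: arc_denom_def power_mult_distrib)
  ultimately show ?thesis by simp
qed

text \<open>The derivative 1 / (2 (cosh (z/2))^2) of tanh (z/2), expressed by
  \<open>arc_denom\<close>, that is by 2 cosh (z/2).\<close>

lemma arc_has_vector_derivative: "(arc has_vector_derivative 2 / (arc_denom w)\<^sup>2) (at w)"
proof -
  have *: "arc = (\<lambda>w. of_real (tanh w) + \<i> * of_real (1 / cosh w))"
    by (simp add: arc_def Complex_eq fun_eq_iff)
  have "(arc has_vector_derivative (of_real (1 - (tanh w)\<^sup>2) + \<i> * of_real (- sinh w / (cosh w)\<^sup>2))) (at w)"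
    unfolding *
  proof (intro has_vector_derivative_add has_vector_derivative_mult_right has_vector_derivative_of_real)
    show "(tanh has_field_derivative 1 - (tanh w)\<^sup>2) (at w)"
      by (auto intro!: derivative_eq_intros)
    show "((\<lambda>w. 1 / cosh w) has_field_derivative - sinh w / (cosh w)\<^sup>2) (at w)"
      by (auto intro!: derivative_eq_intros simp: power2_eq_square)
  qed
  moreover have "of_real (1 - (tanh w)\<^sup>2) + \<i> * of_real (- sinh w / (cosh w)\<^sup>2) = 2 / (arc_denom w)\<^sup>2"
  proof -
    have h: "(cosh w)\<^sup>2 = (sinh w)\<^sup>2 + 1" by (rule cosh_square_eq)
    have "1 - (tanh w)\<^sup>2 = 1 / (cosh w)\<^sup>2"
    proof -
      have "1 - (tanh w)\<^sup>2 = ((cosh w)\<^sup>2 - (sinh w)\<^sup>2) / (cosh w)\<^sup>2"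
        by (simp add: tanh_def power_divide diff_divide_distrib)
      then show ?thesis by (simp add: h)
    qed
    then have "(of_real (1 - (tanh w)\<^sup>2) + \<i> * of_real (- sinh w / (cosh w)\<^sup>2)) = Complex 1 (- sinh w) / of_real ((cosh w)\<^sup>2)"
      by (simp add: complex_eq_iff)
    also have "Complex 1 (- sinh w) * Complex 1 (sinh w) = of_real ((cosh w)\<^sup>2)"
      unfolding h by (simp add: complex_eq_iff power2_eq_square)
    then have "Complex 1 (- sinh w) / of_real ((cosh w)\<^sup>2) = 1 / Complex 1 (sinh w)"
      by (subst frac_eq_eq) (auto simp: complex_eq_iff)
    also have "\<dots> = 2 / (arc_denom w)\<^sup>2" by (simp add: arc_denom_power2)
    finally show ?thesis .
  qed
  ultimately show ?thesis by simp
qed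

text \<open>With t = y - x the integrand is exp (i t arc) / 2 times the derivative of
  \<open>arc\<close>. The integral is therefore half of the integral of exp (i t zeta) along the
  half circle from -1 to 1, which is sin t / t. The antiderivative divides by t, hence
  \<open>x \<noteq> y\<close>.\<close>

lemma integral_arc_kernel_sinc:
  assumes "x \<noteq> y"
  shows "(LBINT w. arc_kernel y w * arc_kernel (- x) w) = of_real (sinc (x - y))"
proof -
  define t where "t = y - x"
  have t: "t \<noteq> 0" using assms by (simp add: t_def)
  have arc_kernel: "arc_kernel y w * arc_kernel (- x) w = exp (\<i> * of_real t * arc w) / (arc_denom w)\<^sup>2" for w
    by (simp add: arc_kernel_def t_def power2_eq_square algebra_simps flip: exp_add)
  let ?A = "\<lambda>w. exp (\<i> * of_real t * arc w) / (2 * \<i> * of_real t)"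
  have int: "integrable lborel (\<lambda>w. arc_kernel y w * arc_kernel (- x) w)"
  proof (rule integrable_exp_neg_abs_bound[of _ 1 "exp \<bar>y\<bar> * exp \<bar>x\<bar>"])
    fix w
    have "cmod (arc_kernel y w) * cmod (arc_kernel (- x) w) \<le> (exp \<bar>y\<bar> * exp (- (1/2) * \<bar>w\<bar>)) * (exp \<bar>- x\<bar> * exp (- (1/2) * \<bar>w\<bar>))"
      by (intro mult_mono cmod_arc_kernel_le) auto
    also have "\<dots> = exp \<bar>y\<bar> * exp \<bar>x\<bar> * exp (- 1 * \<bar>w\<bar>)"
      by (simp add: algebra_simps flip: exp_add)
    finally show "norm (arc_kernel y w * arc_kernel (- x) w) \<le> exp \<bar>y\<bar> * exp \<bar>x\<bar> * exp (- 1 * \<bar>w\<bar>)" by (simp add: norm_mult)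
  qed auto
  have "(LBINT w=-\<infinity>..\<infinity>. arc_kernel y w * arc_kernel (- x) w) = exp (\<i> * of_real t) / (2 * \<i> * of_real t) - exp (- \<i> * of_real t) / (2 * \<i> * of_real t)"
  proof (rule interval_integral_FTC_integrable[where F="?A"])
    fix w :: real
    have "(?A has_vector_derivative
        ((2 / (arc_denom w)\<^sup>2) * (exp (\<i> * of_real t * arc w) / 2))) (at w)"
    proof (rule field_vector_diff_chain_at[OF arc_has_vector_derivative, unfolded o_def])
      show "((\<lambda>z. exp (\<i> * of_real t * z) / (2 * \<i> * of_real t)) has_field_derivative exp (\<i> * of_real t * arc w) / 2) (at (arc w))"
        using t by (auto intro!: derivative_eq_intros)
    qed
    then show "(?A has_vector_derivative arc_kernel y w * arc_kernel (- x) w) (at w)"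
      by (simp add: arc_kernel)
    have "continuous_on UNIV (\<lambda>w. arc_kernel y w * arc_kernel (- x) w)" by (intro continuous_intros)
    then show "isCont (\<lambda>w. arc_kernel y w * arc_kernel (- x) w) w" by (simp add: continuous_on_eq_continuous_at)
  next
    show "set_integrable lborel (einterval (- \<infinity>) \<infinity>) (\<lambda>w. arc_kernel y w * arc_kernel (- x) w)"
      using int by (simp add: set_integrable_def)
    have tb: "(arc \<longlongrightarrow> - 1) at_bot" and tt: "(arc \<longlongrightarrow> 1) at_top"
    proof -
      have *: "arc = (\<lambda>w. of_real (tanh w) + \<i> * of_real (1 / cosh w))"
        by (simp add: arc_def Complex_eq fun_eq_iff)
      have "((\<lambda>w::real. 1 / cosh w) \<longlongrightarrow> 0) at_bot" "((\<lambda>w::real. 1 / cosh w) \<longlongrightarrow> 0) at_top"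
        by (auto intro!: tendsto_divide_0[OF tendsto_const filterlim_at_top_imp_at_infinity] cosh_real_at_bot cosh_real_at_top)
      then have "(arc \<longlongrightarrow> of_real (- 1) + \<i> * of_real 0) at_bot" "(arc \<longlongrightarrow> of_real 1 + \<i> * of_real 0) at_top"
        unfolding * by (safe intro!: tendsto_intros tanh_real_at_bot tanh_real_at_top)
      then show "(arc \<longlongrightarrow> - 1) at_bot" "(arc \<longlongrightarrow> 1) at_top" by simp_all
    qed
    have "(?A \<longlongrightarrow> exp (\<i> * of_real t * (- 1)) / (2 * \<i> * of_real t)) at_bot"
      using t by (intro tendsto_intros tb) auto
    then show "((?A \<circ> real_of_ereal) \<longlongrightarrow> exp (- \<i> * of_real t) / (2 * \<i> * of_real t)) (at_right (- \<infinity>))"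
      unfolding ereal_tendsto_simps1 by simp
    have "(?A \<longlongrightarrow> exp (\<i> * of_real t * 1) / (2 * \<i> * of_real t)) at_top"
      using t by (intro tendsto_intros tt) auto
    then show "((?A \<circ> real_of_ereal) \<longlongrightarrow> exp (\<i> * of_real t) / (2 * \<i> * of_real t)) (at_left \<infinity>)"
      unfolding ereal_tendsto_simps1 by simp
  qed simp
  also have "\<dots> = of_real (sin t / t)"
    using t by (simp add: sin_of_real[symmetric] sin_exp_eq field_simps)
  also have "sin t / t = sinc (x - y)"
    using t sin_minus[of t] by (simp add: t_def field_simps)
  finally show ?thesis
    by (simp add: interval_lebesgue_integral_def set_lebesgue_integral_def)
qed

section \<open>A Parseval identity on the half line\<close>

lemma (in pair_sigma_finite)
  fixes f :: "'a \<Rightarrow> 'c::{real_normed_field, banach, second_countable_topology}"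
  assumes "integrable M1 f" "integrable M2 g"
  shows integrable_mult_pair: "integrable (M1 \<Otimes>\<^sub>M M2) (\<lambda>p. f (fst p) * g (snd p))"
    and integral_mult_pair: "integral\<^sup>L (M1 \<Otimes>\<^sub>M M2) (\<lambda>p. f (fst p) * g (snd p)) = integral\<^sup>L M1 f * integral\<^sup>L M2 g"
proof -
  have [measurable]: "f \<in> borel_measurable M1" "g \<in> borel_measurable M2" using assms by auto
  show int: "integrable (M1 \<Otimes>\<^sub>M M2) (\<lambda>p. f (fst p) * g (snd p))"
    by (rule Fubini_integrable) (use assms in \<open>auto simp: norm_mult\<close>)
  show "integral\<^sup>L (M1 \<Otimes>\<^sub>M M2) (\<lambda>p. f (fst p) * g (snd p)) = integral\<^sup>L M1 f * integral\<^sup>L M2 g"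
    by (subst integral_fst'[OF int, symmetric]) simp
qed

lemma arc_kernel_measurable2 [measurable (raw)]:
  "f \<in> borel_measurable M \<Longrightarrow> g \<in> borel_measurable M \<Longrightarrow> (\<lambda>p. arc_kernel (f p) (g p)) \<in> borel_measurable M"
  by (rule borel_measurable_continuous_Pair) (auto intro!: continuous_intros)

lemma cnj_measurable [measurable (raw)]:
  "f \<in> borel_measurable M \<Longrightarrow> (\<lambda>p. cnj (f p)) \<in> borel_measurable M"
  by (rule measurable_compose[OF _ borel_measurable_continuous_onI]) (auto intro!: continuous_intros)

definition arc_op :: "(real \<Rightarrow> complex) \<Rightarrow> real \<Rightarrow> complex" where
  "arc_op a x = (LBINT w. arc_kernel x w * a w)"

text \<open>The frequency eta / (2 pi) is that of \<open>q_plus\<close>. As there is no prefactor,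
  inversion produces the factor 4 pi^2.\<close>

definition fourier :: "(real \<Rightarrow> complex) \<Rightarrow> real \<Rightarrow> complex" where
  "fourier a \<eta> = (LBINT w. a w * exp (- \<i> * of_real (\<eta> / (2*pi) * w)))"

lemma arc_kernel_mult_integrable:
  assumes "integrable lborel a"
  shows "integrable lborel (\<lambda>w. arc_kernel x w * a w)"
proof (rule Bochner_Integration.integrable_bound)
  show "integrable lborel (\<lambda>w. of_real (exp \<bar>x\<bar>) * a w)" using assms by simp
  show "AE w in lborel. norm (arc_kernel x w * a w) \<le> norm (of_real (exp \<bar>x\<bar>) * a w)"
  proof (rule AE_I2)
    fix w
    have "cmod (arc_kernel x w) \<le> exp \<bar>x\<bar> * 1"
      by (rule order_trans[OF cmod_arc_kernel_le]) (intro mult_left_mono, auto)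
    then show "norm (arc_kernel x w * a w) \<le> norm (of_real (exp \<bar>x\<bar>) * a w)"
      by (simp add: norm_mult mult_right_mono)
  qed
qed (use assms in measurable)

lemma exp_mult_integrable:
  assumes "integrable lborel (a :: real \<Rightarrow> complex)"
  shows "integrable lborel (\<lambda>w. a w * exp (\<i> * of_real (\<xi> * w)))"
  by (rule Bochner_Integration.integrable_bound[OF assms]) (use assms in \<open>auto simp: norm_mult\<close>)

text \<open>1 / (4 cosh ((w - v)/2)) is the inner product over x and, by
  \<open>fourier_sech\<close>, also 1 / (8 pi) times the integral of exp (- i (w - v) eta / (2 pi))
  / cosh (eta/2). Both are integrated against a(w) cnj (b(v)), and the order of integration is
  exchanged on each side.\<close>

lemma
  assumes a: "integrable lborel a" and b: "integrable lborel b"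
  shows arc_op_mult_integrable: "set_integrable lborel {0<..} (\<lambda>x. arc_op a x * cnj (arc_op b x))"
    and arc_op_mult_integral: "(LBINT x:{0<..}. arc_op a x * cnj (arc_op b x)) =
      1 / (8 * pi) * (LBINT \<eta>. fourier a \<eta> * cnj (fourier b \<eta>) / of_real (cosh (\<eta>/2)))"
proof -
  let ?P = "lborel \<Otimes>\<^sub>M lborel :: (real \<times> real) measure"
  have am [measurable]: "a \<in> borel_measurable borel" and bm [measurable]: "b \<in> borel_measurable borel"
    using a b by (auto simp: borel_measurable_integrable)
  have cb: "integrable lborel (\<lambda>v. cnj (b v))" using b by simp
  interpret P: sigma_finite_measure ?P by (simp add: lborel_prod sigma_finite_lborel)
  interpret PX: pair_sigma_finite ?P "lborel :: real measure" ..
  have ab: "integrable ?P (\<lambda>p. a (fst p) * cnj (b (snd p)))"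
    by (rule lborel_pair.integrable_mult_pair[OF a cb])
  define f where "f = (\<lambda>(p::real\<times>real) (x::real). indicator {0<..} x *\<^sub>R
      ((arc_kernel x (fst p) * a (fst p)) * cnj (arc_kernel x (snd p) * b (snd p))))"
  have fm: "(\<lambda>(p,x). f p x) \<in> borel_measurable (?P \<Otimes>\<^sub>M lborel)" unfolding f_def by measurable
  have f_alt: "f p x = (indicator {0<..} x *\<^sub>R (arc_kernel x (fst p) * cnj (arc_kernel x (snd p)))) * (a (fst p) * cnj (b (snd p)))" for p x
    by (simp add: f_def)
  have f_int: "integrable lborel (f p)" for p
    unfolding f_alt by (intro integrable_mult_left set_integrable_arc_kernel_mult[unfolded set_integrable_def])
  have f_int_x: "integral\<^sup>L lborel (f p) = 1 / of_real (4 * cosh ((fst p - snd p)/2)) * (a (fst p) * cnj (b (snd p)))" for p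
    unfolding f_alt integral_mult_left_zero
    using set_integral_arc_kernel_mult[of "fst p" "snd p"] by (simp add: set_lebesgue_integral_def)
  have fi: "integrable (?P \<Otimes>\<^sub>M lborel) (\<lambda>(p,x). f p x)"
  proof (rule PX.Fubini_integrable[OF fm])
    show "AE p in ?P. integrable lborel (\<lambda>x. case (p, x) of (p, x) \<Rightarrow> f p x)" using f_int by simp
    show "integrable ?P (\<lambda>p. \<integral>x. norm (case (p, x) of (p, x) \<Rightarrow> f p x) \<partial>lborel)"
    proof (rule Bochner_Integration.integrable_bound[OF ab])
      show "(\<lambda>p. \<integral>x. norm (case (p, x) of (p, x) \<Rightarrow> f p x) \<partial>lborel) \<in> borel_measurable ?P"
        using fm by measurable
      show "AE p in ?P. norm (\<integral>x. norm (case (p, x) of (p, x) \<Rightarrow> f p x) \<partial>lborel) \<le> norm (a (fst p) * cnj (b (snd p)))"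
      proof (rule AE_I2)
        fix p :: "real \<times> real"
        have nf: "norm (f p x) = (indicator {0<..} x *\<^sub>R cmod (arc_kernel x (fst p) * cnj (arc_kernel x (snd p)))) * cmod (a (fst p) * cnj (b (snd p)))" for x
          unfolding f_alt by (simp add: norm_mult)
        have "(\<integral>x. norm (f p x) \<partial>lborel) \<le> 1/4 * cmod (a (fst p) * cnj (b (snd p)))"
          unfolding nf integral_mult_left_zero
          using set_integral_norm_arc_kernel_mult[of "fst p" "snd p"]
          by (intro mult_right_mono) (simp_all add: set_lebesgue_integral_def)
        also have "\<dots> \<le> 1 * cmod (a (fst p) * cnj (b (snd p)))" by (intro mult_right_mono) auto
        finally show "norm (\<integral>x. norm (case (p, x) of (p, x) \<Rightarrow> f p x) \<partial>lborel) \<le> norm (a (fst p) * cnj (b (snd p)))"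
          by (simp add: integral_nonneg_AE)
      qed
    qed
  qed
  have TT2: "indicator {0<..} x *\<^sub>R (arc_op a x * cnj (arc_op b x)) = (\<integral>p. f p x \<partial>?P)" for x
  proof (cases "0 < x")
    case True
    have "arc_op a x * cnj (arc_op b x) = (LBINT w. arc_kernel x w * a w) * (LBINT v. cnj (arc_kernel x v * b v))"
      by (simp only: arc_op_def Bochner_Integration.integral_cnj)
    also have "\<dots> = (\<integral>p. (arc_kernel x (fst p) * a (fst p)) * cnj (arc_kernel x (snd p) * b (snd p)) \<partial>?P)"
      by (intro lborel_pair.integral_mult_pair[symmetric] arc_kernel_mult_integrable a b integrable_cnj)
    finally show ?thesis using True by (simp add: f_def)
  qed (simp add: f_def)
  show "set_integrable lborel {0<..} (\<lambda>x. arc_op a x * cnj (arc_op b x))"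
    unfolding set_integrable_def TT2 by (rule PX.integrable_snd[OF fi])
  define g where "g = (\<lambda>(p::real\<times>real) (\<eta>::real). (a (fst p) * cnj (b (snd p))) *
     (exp (\<i> * of_real (- (fst p - snd p) / (2*pi) * \<eta>)) / of_real (cosh (\<eta>/2))))"
  have gi: "integrable (?P \<Otimes>\<^sub>M lborel) (\<lambda>(p,\<eta>). g p \<eta>)"
  proof (rule Bochner_Integration.integrable_bound)
    \<comment> \<open>Frequency 0 gives a product with exactly the modulus of
      \<open>g\<close>.\<close>
    have "integrable lborel (\<lambda>\<eta>. exp (\<i> * of_real (0 * \<eta>)) / of_real (cosh (\<eta>/2)) :: complex)" by (rule integrable_sech_half)
    from PX.integrable_mult_pair[OF ab this]
    show "integrable (?P \<Otimes>\<^sub>M lborel) (\<lambda>p. a (fst (fst p)) * cnj (b (snd (fst p))) * (exp (\<i> * of_real (0 * snd p)) / of_real (cosh (snd p/2))))" .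
    have [measurable]: "(cosh :: real \<Rightarrow> real) \<in> borel_measurable borel"
      by (intro borel_measurable_continuous_onI continuous_intros)
    show "(\<lambda>(p,\<eta>). g p \<eta>) \<in> borel_measurable (?P \<Otimes>\<^sub>M lborel)" unfolding g_def by measurable
  qed (auto simp: g_def norm_mult norm_divide)
  \<comment> \<open>\<open>fourier_sech\<close> at y = - (w - v) / (2 pi); the ratio of 2 pi / cosh
    to 1 / (4 cosh) is 8 pi.\<close>
  have g1: "(\<integral>\<eta>. g p \<eta> \<partial>lborel) = (8 * pi) * integral\<^sup>L lborel (f p)" for p
  proof -
    have "(\<integral>\<eta>. g p \<eta> \<partial>lborel) = (a (fst p) * cnj (b (snd p))) * of_real (2 * pi / cosh (pi * (- (fst p - snd p) / (2*pi))))"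
      unfolding g_def integral_mult_right_zero fourier_sech ..
    also have "pi * (- (fst p - snd p) / (2*pi)) = - ((fst p - snd p) / 2)" by (simp add: field_simps)
    finally show ?thesis unfolding f_int_x by simp
  qed
  have g2: "(\<integral>p. g p \<eta> \<partial>?P) = fourier a \<eta> * cnj (fourier b \<eta>) / of_real (cosh (\<eta>/2))" for \<eta>
  proof -
    let ?e = "\<lambda>w. exp (- \<i> * of_real (\<eta> / (2*pi) * w))"
    have g_eq: "g p \<eta> = (a (fst p) * ?e (fst p)) * cnj (b (snd p) * ?e (snd p)) * (1 / of_real (cosh (\<eta>/2)))" for p
    proof -
      have "exp (\<i> * of_real (- (fst p - snd p) / (2*pi) * \<eta>)) = ?e (fst p) * cnj (?e (snd p))"
        by (simp add: exp_cnj field_simps flip: exp_add)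
      then show ?thesis by (simp add: g_def)
    qed
    have "(\<integral>p. g p \<eta> \<partial>?P) = (\<integral>p. (a (fst p) * ?e (fst p)) * cnj (b (snd p) * ?e (snd p)) \<partial>?P) * (1 / of_real (cosh (\<eta>/2)))"
      unfolding g_eq by (rule integral_mult_left_zero)
    also have "(\<integral>p. (a (fst p) * ?e (fst p)) * cnj (b (snd p) * ?e (snd p)) \<partial>?P)
        = (LBINT w. a w * ?e w) * (LBINT v. cnj (b v * ?e v))"
      using exp_mult_integrable[OF a, of "- \<eta> / (2*pi)"] exp_mult_integrable[OF b, of "- \<eta> / (2*pi)"]
      by (intro lborel_pair.integral_mult_pair integrable_cnj) auto
    also have "\<dots> = fourier a \<eta> * cnj (fourier b \<eta>)" by (simp only: fourier_def Bochner_Integration.integral_cnj)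
    finally show ?thesis by simp
  qed
  have "(LBINT x:{0<..}. arc_op a x * cnj (arc_op b x)) = (\<integral>x. (\<integral>p. f p x \<partial>?P) \<partial>lborel)"
    by (simp only: set_lebesgue_integral_def TT2)
  also have "\<dots> = (\<integral>p. (\<integral>x. f p x \<partial>lborel) \<partial>?P)" by (rule PX.Fubini_integral[OF fi])
  also have "\<dots> = (\<integral>p. 1 / (8*pi) * (\<integral>\<eta>. g p \<eta> \<partial>lborel) \<partial>?P)" unfolding g1 by simp
  also have "\<dots> = 1 / (8*pi) * (\<integral>p. (\<integral>\<eta>. g p \<eta> \<partial>lborel) \<partial>?P)" by (rule integral_mult_right_zero)
  also have "(\<integral>p. (\<integral>\<eta>. g p \<eta> \<partial>lborel) \<partial>?P) = (\<integral>\<eta>. (\<integral>p. g p \<eta> \<partial>?P) \<partial>lborel)" by (rule PX.Fubini_integral[OF gi, symmetric])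
  finally show "(LBINT x:{0<..}. arc_op a x * cnj (arc_op b x)) =
      1 / (8 * pi) * (LBINT \<eta>. fourier a \<eta> * cnj (fourier b \<eta>) / of_real (cosh (\<eta>/2)))"
    unfolding g2 by simp
qed

section \<open>Gaussian regularisation\<close>

text \<open>The characteristic function of the standard normal distribution, rescaled by \<delta>.
  The result is written as a normal density, so that the regularisation below appears as an
  average.\<close>

lemma gaussian_fourier:
  fixes \<delta> t :: real assumes "0 < \<delta>"
  shows "integrable lborel (\<lambda>w. complex_of_real (exp (- (\<delta> * w)\<^sup>2 / 2)))"
    and "(LBINT w. of_real (exp (- (\<delta> * w)\<^sup>2 / 2)) * exp (\<i> * of_real (t * w))) =
      of_real (2 * pi / \<delta> * std_normal_density (t / \<delta>))"
proof -
  have e: "exp (- w\<^sup>2 / 2) = sqrt (2 * pi) * std_normal_density w" for w :: real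
    by (simp add: std_normal_density_def)
  have "integrable lborel (\<lambda>w::real. complex_of_real (exp (- w\<^sup>2 / 2)))"
    unfolding e by (simp del: of_real_mult)
  from lborel_integrable_real_affine[OF this, of \<delta> 0] assms
  show "integrable lborel (\<lambda>w. complex_of_real (exp (- (\<delta> * w)\<^sup>2 / 2)))" by simp
  have "(LBINT w. of_real (exp (- (\<delta> * w)\<^sup>2 / 2)) * exp (\<i> * of_real (t * w)))
     = \<bar>1/\<delta>\<bar> *\<^sub>R (LBINT w. of_real (exp (- (\<delta> * (0 + (1/\<delta>) * w))\<^sup>2 / 2)) * exp (\<i> * of_real (t * (0 + (1/\<delta>) * w))))"
    using assms by (intro lborel_integral_real_affine) simp
  also have "(LBINT w. of_real (exp (- (\<delta> * (0 + (1/\<delta>) * w))\<^sup>2 / 2)) * exp (\<i> * of_real (t * (0 + (1/\<delta>) * w))))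
    = (LBINT w. of_real (sqrt (2 * pi)) * (std_normal_density w *\<^sub>R exp (\<i> * of_real (t / \<delta> * w))))"
    using assms by (intro Bochner_Integration.integral_cong) (auto simp: std_normal_density_def scaleR_conv_of_real)
  also have "\<dots> = of_real (sqrt (2 * pi)) * char std_normal_distribution (t / \<delta>)"
    unfolding integral_mult_right_zero by (simp add: char_def integral_density)
  also have "\<dots> = of_real (2 * pi * std_normal_density (t / \<delta>))"
  proof -
    have "sqrt (2*pi) * exp (- (t / \<delta>)\<^sup>2 / 2) = (sqrt (2*pi) * sqrt (2*pi)) * std_normal_density (t / \<delta>)"
      unfolding std_normal_density_def by (simp add: field_simps)
    then show ?thesis unfolding char_std_normal_distribution by (simp flip: of_real_mult)
  qed
  finally show "(LBINT w. of_real (exp (- (\<delta> * w)\<^sup>2 / 2)) * exp (\<i> * of_real (t * w))) =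
      of_real (2 * pi / \<delta> * std_normal_density (t / \<delta>))"
    using assms by (simp add: scaleR_conv_of_real)
qed

definition inv_fourier :: "(real \<Rightarrow> complex) \<Rightarrow> real \<Rightarrow> complex" where
  "inv_fourier \<psi> w = (LBINT \<xi>. \<psi> \<xi> * wave \<xi> w)"

definition gauss :: "nat \<Rightarrow> real \<Rightarrow> complex" where
  "gauss n w = of_real (exp (- (1 / real (Suc n) * w)\<^sup>2 / 2))"

text \<open>The properties that \<open>log_density h\<close> has for continuous h with compact
  support in ]0,1[. The bound \<open>B\<close> supplies the dominating functions.\<close>

locale test_function =
  fixes \<psi> :: "real \<Rightarrow> complex" and R B :: real
  assumes cont: "continuous_on UNIV \<psi>"
    and supp: "\<And>\<xi>. R < \<bar>\<xi>\<bar> \<Longrightarrow> \<psi> \<xi> = 0"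
    and bound: "\<And>\<xi>. cmod (\<psi> \<xi>) \<le> B"
begin

lemma psi_measurable [measurable]: "\<psi> \<in> borel_measurable borel"
  using cont by (rule borel_measurable_continuous_onI)

lemma psi_integrable: "integrable lborel \<psi>"
proof -
  have "set_integrable lborel {-R..R} \<psi>"
    by (intro borel_integrable_atLeastAtMost' continuous_on_subset[OF cont]) auto
  moreover have "indicator {-R..R} \<xi> *\<^sub>R \<psi> \<xi> = \<psi> \<xi>" for \<xi>
    using supp[of \<xi>] by (auto simp: indicator_def)
  ultimately show ?thesis by (simp add: set_integrable_def)
qed

lemma inv_fourier_measurable [measurable]: "inv_fourier \<psi> \<in> borel_measurable borel"
  unfolding inv_fourier_def by measurable

lemma inv_fourier_bound: "cmod (inv_fourier \<psi> w) \<le> (LBINT \<xi>. cmod (\<psi> \<xi>))"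
proof -
  have "cmod (inv_fourier \<psi> w) \<le> (LBINT \<xi>. cmod (\<psi> \<xi> * wave \<xi> w))"
    unfolding inv_fourier_def by (rule integral_norm_bound)
  then show ?thesis by (simp add: norm_mult)
qed

text \<open>\<open>inv_fourier \<psi>\<close> is bounded but need not be integrable; the Gaussian
  factor brings it into the scope of \<open>arc_op_mult_integral\<close>.\<close>

definition approx :: "nat \<Rightarrow> real \<Rightarrow> complex" where
  "approx n w = gauss n w * inv_fourier \<psi> w"

lemma gauss_integrable: "integrable lborel (gauss n)"
  unfolding gauss_def using gaussian_fourier(1)[of "1 / real (Suc n)"] by simp

lemma approx_integrable: "integrable lborel (approx n)"
proof (rule Bochner_Integration.integrable_bound)
  show "integrable lborel (\<lambda>w. gauss n w * of_real ((LBINT \<xi>. cmod (\<psi> \<xi>))))"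
    using gauss_integrable by simp
  show "approx n \<in> borel_measurable lborel" unfolding approx_def gauss_def by measurable
  show "AE w in lborel. norm (approx n w) \<le> norm (gauss n w * of_real ((LBINT \<xi>. cmod (\<psi> \<xi>))))"
    using inv_fourier_bound by (auto simp: approx_def norm_mult intro!: mult_left_mono order_trans[OF _ abs_ge_self])
qed

abbreviation smeared :: "nat \<Rightarrow> real \<Rightarrow> real \<Rightarrow> complex" where
  "smeared n \<eta> y \<equiv> std_normal_density y *\<^sub>R \<psi> (\<eta> + 2 * pi / real (Suc n) * y)"

text \<open>Damping in w is averaging in frequency, against a normal density of standard deviation 2
  pi / (n + 1). The factor 4 pi^2 is 2 pi / \<delta> from the Gaussian transform times 2 pi \<delta>
  from the rescaling.\<close>

lemma fourier_approx:
  "fourier (approx n) \<eta> = 4 * pi\<^sup>2 * (LBINT y. smeared n \<eta> y)"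
proof -
  define \<delta> where "\<delta> = 1 / real (Suc n)"
  have d: "0 < \<delta>" by (simp add: \<delta>_def)
  define f where "f = (\<lambda>w \<xi>. gauss n w * \<psi> \<xi> * exp (\<i> * of_real ((\<xi> - \<eta>) / (2*pi) * w)))"
  have fi: "integrable (lborel \<Otimes>\<^sub>M lborel) (\<lambda>(w,\<xi>). f w \<xi>)"
  proof (rule Bochner_Integration.integrable_bound[OF lborel_pair.integrable_mult_pair[OF gauss_integrable psi_integrable]])
    show "(\<lambda>(w,\<xi>). f w \<xi>) \<in> borel_measurable (lborel \<Otimes>\<^sub>M lborel)" unfolding f_def gauss_def by measurable
  qed (auto simp: f_def norm_mult)
  have "fourier (approx n) \<eta> = (\<integral>w. (\<integral>\<xi>. f w \<xi> \<partial>lborel) \<partial>lborel)"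
    unfolding fourier_def
  proof (rule Bochner_Integration.integral_cong[OF refl])
    fix w
    have "approx n w * exp (- \<i> * of_real (\<eta> / (2*pi) * w)) = (gauss n w * exp (- \<i> * of_real (\<eta> / (2*pi) * w))) * inv_fourier \<psi> w"
      by (simp add: approx_def)
    also have "\<dots> = (\<integral>\<xi>. f w \<xi> \<partial>lborel)"
      unfolding inv_fourier_def integral_mult_right_zero[symmetric]
      by (intro Bochner_Integration.integral_cong) (auto simp: f_def diff_divide_distrib algebra_simps simp flip: exp_add)
    finally show "approx n w * exp (- \<i> * of_real (\<eta> / (2*pi) * w)) = (\<integral>\<xi>. f w \<xi> \<partial>lborel)" .
  qed
  also have "\<dots> = (\<integral>\<xi>. (\<integral>w. f w \<xi> \<partial>lborel) \<partial>lborel)"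
    by (rule lborel_pair.Fubini_integral[OF fi, symmetric])
  also have "\<dots> = (\<integral>\<xi>. \<psi> \<xi> * of_real (2 * pi / \<delta> * std_normal_density ((\<xi> - \<eta>) / (2*pi) / \<delta>)) \<partial>lborel)"
  proof (rule Bochner_Integration.integral_cong[OF refl])
    fix \<xi>
    have "(\<integral>w. f w \<xi> \<partial>lborel) = (\<integral>w. \<psi> \<xi> * (of_real (exp (- (\<delta> * w)\<^sup>2 / 2)) * exp (\<i> * of_real ((\<xi> - \<eta>) / (2*pi) * w))) \<partial>lborel)"
      by (intro Bochner_Integration.integral_cong) (auto simp: f_def gauss_def \<delta>_def)
    also have "\<dots> = \<psi> \<xi> * of_real (2 * pi / \<delta> * std_normal_density ((\<xi> - \<eta>) / (2*pi) / \<delta>))"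
      unfolding integral_mult_right_zero gaussian_fourier(2)[OF d] ..
    finally show "(\<integral>w. f w \<xi> \<partial>lborel) = \<psi> \<xi> * of_real (2 * pi / \<delta> * std_normal_density ((\<xi> - \<eta>) / (2*pi) / \<delta>))" .
  qed
  \<comment> \<open>Substitution \<xi> = \<eta> + 2 pi \<delta> y, which turns the argument of the
    density into y.\<close>
  also have "\<dots> = \<bar>2 * pi * \<delta>\<bar> *\<^sub>R (\<integral>y. \<psi> (\<eta> + 2 * pi * \<delta> * y) * of_real (2 * pi / \<delta> * std_normal_density ((\<eta> + 2 * pi * \<delta> * y - \<eta>) / (2*pi) / \<delta>)) \<partial>lborel)"
    using d by (intro lborel_integral_real_affine) simp
  also have "\<dots> = (2 * pi * \<delta>) *\<^sub>R (\<integral>y. of_real (2 * pi / \<delta>) * (std_normal_density y *\<^sub>R \<psi> (\<eta> + 2 * pi * \<delta> * y)) \<partial>lborel)"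
    using d by (intro arg_cong2[where f="(*\<^sub>R)"] Bochner_Integration.integral_cong) (auto simp: scaleR_conv_of_real)
  also have "\<dots> = 4 * pi\<^sup>2 * (\<integral>y. std_normal_density y *\<^sub>R \<psi> (\<eta> + 2 * pi * \<delta> * y) \<partial>lborel)"
    using d unfolding integral_mult_right_zero by (simp add: scaleR_conv_of_real power2_eq_square)
  finally show ?thesis by (simp add: \<delta>_def)
qed

lemma fourier_approx_bound: "cmod (fourier (approx n) \<eta>) \<le> 4 * pi\<^sup>2 * B"
proof -
  have "cmod ((LBINT y. smeared n \<eta> y))
    \<le> (LBINT y. std_normal_density y * B)"
  proof (rule order_trans[OF integral_norm_bound integral_mono])
    have m: "(\<lambda>y. smeared n \<eta> y) \<in> borel_measurable lborel" by measurable
    show 1: "integrable lborel (\<lambda>y. std_normal_density y * B)" by simp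
    show 2: "norm (smeared n \<eta> y) \<le> std_normal_density y * B" for y
      using bound by (auto intro!: mult_left_mono)
    have "integrable lborel (\<lambda>y. smeared n \<eta> y)"
      by (rule Bochner_Integration.integrable_bound[OF 1 m]) (use 2 in \<open>auto intro: order_trans[OF _ abs_ge_self]\<close>)
    then show "integrable lborel (\<lambda>y. norm (smeared n \<eta> y))"
      by (rule integrable_norm)
  qed
  also have "\<dots> = B" by simp
  finally show ?thesis by (simp add: fourier_approx norm_mult norm_power)
qed

lemma fourier_approx_tendsto: "(\<lambda>n. fourier (approx n) \<eta>) \<longlonglongrightarrow> 4 * pi\<^sup>2 * \<psi> \<eta>"
proof -
  have "(\<lambda>n. (LBINT y. smeared n \<eta> y))
     \<longlonglongrightarrow> (LBINT y. std_normal_density y *\<^sub>R \<psi> \<eta>)"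
  proof (rule integral_dominated_convergence)
    show "integrable lborel (\<lambda>y. std_normal_density y * B)" by simp
    show "AE y in lborel. (\<lambda>n. smeared n \<eta> y) \<longlonglongrightarrow> std_normal_density y *\<^sub>R \<psi> \<eta>"
    proof (rule AE_I2)
      fix y
      have "(\<lambda>n. \<eta> + 2 * pi / real (Suc n) * y) \<longlonglongrightarrow> \<eta>" by real_asymp
      moreover have "isCont \<psi> \<eta>" using cont by (simp add: continuous_on_eq_continuous_at)
      ultimately have "(\<lambda>n. \<psi> (\<eta> + 2 * pi / real (Suc n) * y)) \<longlonglongrightarrow> \<psi> \<eta>" by (rule isCont_tendsto_compose[rotated])
      then show "(\<lambda>n. smeared n \<eta> y) \<longlonglongrightarrow> std_normal_density y *\<^sub>R \<psi> \<eta>"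
        by (intro tendsto_intros)
    qed
    show "AE y in lborel. norm (smeared n \<eta> y) \<le> std_normal_density y * B" for n
      using bound by (auto intro!: mult_left_mono)
  qed measurable
  also have "(LBINT y. std_normal_density y *\<^sub>R \<psi> \<eta>) = \<psi> \<eta>" by simp
  finally show ?thesis unfolding fourier_approx by (intro tendsto_intros)
qed

end

section \<open>Borel functions as elements of L2\<close>

lemma
  fixes f :: "real \<Rightarrow> 'a::{banach, second_countable_topology}"
  assumes "S \<in> sets borel" "f \<in> borel_measurable borel"
  shows integral_lebesgue_on_borel: "integral\<^sup>L (lebesgue_on S) f = set_lebesgue_integral lborel S f"
    and integrable_lebesgue_on_borel: "integrable (lebesgue_on S) f \<longleftrightarrow> set_integrable lborel S f"
proof -
  have m: "(\<lambda>x. indicator S x *\<^sub>R f x) \<in> borel_measurable lborel" using assms by measurable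
  show "integral\<^sup>L (lebesgue_on S) f = set_lebesgue_integral lborel S f"
    using assms by (subst integral_restrict_space) (auto simp: integral_completion[OF m] set_lebesgue_integral_def)
  show "integrable (lebesgue_on S) f \<longleftrightarrow> set_integrable lborel S f"
    using assms by (subst integrable_restrict_space) (auto simp: integrable_completion[OF m] set_integrable_def)
qed

lemma borel_measurable_lebesgue_on: "f \<in> borel_measurable borel \<Longrightarrow> f \<in> borel_measurable (lebesgue_on S)"
  by (intro measurable_restrict_space1 measurable_completion) simp

lemma cmod_power2_mult_cnj: "complex_of_real ((cmod z)\<^sup>2) = z * cnj z"
  by (simp add: complex_norm_square del: of_real_power)

lemma
  assumes "S \<in> sets borel" "f \<in> borel_measurable borel" "set_integrable lborel S (\<lambda>x. f x * cnj (f x))"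
  shows L2_borelI: "f \<in> L2 S"
    and L2_norm_borel: "complex_of_real ((L2_norm S f)\<^sup>2) = (LBINT x:S. f x * cnj (f x))"
proof -
  have m: "(\<lambda>x. (cmod (f x))\<^sup>2) \<in> borel_measurable borel" using assms(2) by measurable
  have si: "set_integrable lborel S (\<lambda>x. complex_of_real ((cmod (f x))\<^sup>2))"
    unfolding cmod_power2_mult_cnj by (rule assms(3))
  then have "set_integrable lborel S (\<lambda>x. (cmod (f x))\<^sup>2)"
    using integrable_Re[OF si[unfolded set_integrable_def]] by (simp add: set_integrable_def)
  then show "f \<in> L2 S"
    using borel_measurable_lebesgue_on[OF assms(2)] integrable_lebesgue_on_borel[OF assms(1) m] by (simp add: L2_def)
  have "complex_of_real ((L2_norm S f)\<^sup>2) = of_real ((LBINT x:S. (cmod (f x))\<^sup>2))"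
    unfolding L2_norm_power2 integral_lebesgue_on_borel[OF assms(1) m] ..
  also have "\<dots> = (LBINT x:S. complex_of_real ((cmod (f x))\<^sup>2))"
    by (rule set_integral_complex_of_real[symmetric])
  finally show "complex_of_real ((L2_norm S f)\<^sup>2) = (LBINT x:S. f x * cnj (f x))"
    unfolding cmod_power2_mult_cnj .
qed

lemma arc_op_measurable [measurable (raw)]:
  assumes [measurable]: "a \<in> borel_measurable borel"
  shows "arc_op a \<in> borel_measurable borel"
  unfolding arc_op_def by measurable

lemma fourier_measurable [measurable (raw)]:
  assumes [measurable]: "a \<in> borel_measurable borel"
  shows "fourier a \<in> borel_measurable borel"
  unfolding fourier_def by measurable

lemma arc_op_diff:
  assumes "integrable lborel a" "integrable lborel b"
  shows "arc_op (\<lambda>w. a w - b w) x = arc_op a x - arc_op b x"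
  unfolding arc_op_def right_diff_distrib
  by (intro Bochner_Integration.integral_diff arc_kernel_mult_integrable assms)

lemma fourier_diff:
  assumes "integrable lborel a" "integrable lborel b"
  shows "fourier (\<lambda>w. a w - b w) \<eta> = fourier a \<eta> - fourier b \<eta>"
  unfolding fourier_def left_diff_distrib
  using exp_mult_integrable[OF assms(1), of "- \<eta> / (2*pi)"] exp_mult_integrable[OF assms(2), of "- \<eta> / (2*pi)"]
  by (intro Bochner_Integration.integral_diff) auto

lemma fourier_bound: "cmod (fourier a \<eta>) \<le> (LBINT w. cmod (a w))"
proof -
  have "cmod (fourier a \<eta>) \<le> (LBINT w. cmod (a w * exp (- \<i> * of_real (\<eta> / (2*pi) * w))))"
    unfolding fourier_def by (rule integral_norm_bound)
  then show ?thesis by (simp add: norm_mult)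
qed

lemma arc_op_L2:
  assumes "integrable lborel a"
  shows "arc_op a \<in> L2 {0<..}"
    and "complex_of_real ((L2_norm {0<..} (arc_op a))\<^sup>2) =
      1 / (8 * pi) * (LBINT \<eta>. fourier a \<eta> * cnj (fourier a \<eta>) / of_real (cosh (\<eta>/2)))"
proof -
  have m: "arc_op a \<in> borel_measurable borel" using assms by (intro arc_op_measurable) auto
  note * = L2_borelI[OF _ m arc_op_mult_integrable[OF assms assms]] L2_norm_borel[OF _ m arc_op_mult_integrable[OF assms assms]]
  show "arc_op a \<in> L2 {0<..}" by (rule *) simp
  show "complex_of_real ((L2_norm {0<..} (arc_op a))\<^sup>2) =
      1 / (8 * pi) * (LBINT \<eta>. fourier a \<eta> * cnj (fourier a \<eta>) / of_real (cosh (\<eta>/2)))"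
    unfolding arc_op_mult_integral[OF assms assms, symmetric] by (rule *) simp
qed

lemma integrable_inverse_cosh: "integrable lborel (\<lambda>\<eta>::real. C / cosh (\<eta>/2))"
proof -
  have "integrable lborel (\<lambda>\<eta>. complex_of_real (1 / cosh (\<eta>/2)))" using integrable_sech_half[of 0] by simp
  from integrable_mult_right[OF integrable_Re[OF this], of C] show ?thesis by (simp only: Re_complex_of_real) simp
qed

lemma cosh_measurable [measurable]: "(cosh :: real \<Rightarrow> real) \<in> borel_measurable borel"
  by (intro borel_measurable_continuous_onI continuous_intros)

section \<open>The Parseval identity without damping\<close>

definition log_op :: "(real \<Rightarrow> complex) \<Rightarrow> real \<Rightarrow> complex" where
  "log_op \<psi> x = (LBINT \<xi>. \<psi> \<xi> * (of_real (exp (\<xi>/4)) * q_int x \<xi>))"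

context test_function
begin

text \<open>The weight exp (\<xi>/4) in \<open>log_op\<close> is the one of
  \<open>integral_arc_kernel_exp\<close>, so the kernel is itself an integral over w. Fubini applies
  because \<open>arc_kernel x\<close> and \<psi> are integrable.\<close>

lemma log_op_eq: "log_op \<psi> x = arc_op (inv_fourier \<psi>) x"
proof -
  define f where "f = (\<lambda>w \<xi>. arc_kernel x w * \<psi> \<xi> * wave \<xi> w)"
  have fi: "integrable (lborel \<Otimes>\<^sub>M lborel) (\<lambda>(w,\<xi>). f w \<xi>)"
  proof (rule Bochner_Integration.integrable_bound[OF lborel_pair.integrable_mult_pair[OF arc_kernel_integrable[of x] psi_integrable]])
    show "(\<lambda>(w,\<xi>). f w \<xi>) \<in> borel_measurable (lborel \<Otimes>\<^sub>M lborel)" unfolding f_def by measurable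
  qed (auto simp: f_def norm_mult)
  have "arc_op (inv_fourier \<psi>) x = (\<integral>w. (\<integral>\<xi>. f w \<xi> \<partial>lborel) \<partial>lborel)"
    unfolding arc_op_def inv_fourier_def f_def integral_mult_right_zero[symmetric] by (simp add: mult.assoc)
  also have "\<dots> = (\<integral>\<xi>. (\<integral>w. f w \<xi> \<partial>lborel) \<partial>lborel)"
    by (rule lborel_pair.Fubini_integral[OF fi, symmetric])
  also have "\<dots> = log_op \<psi> x"
    unfolding log_op_def integral_arc_kernel_exp[symmetric] f_def integral_mult_right_zero[symmetric]
    by (intro Bochner_Integration.integral_cong refl) (simp add: mult_ac)
  finally show ?thesis ..
qed

lemma log_op_measurable [measurable]: "log_op \<psi> \<in> borel_measurable borel"
proof -
  have "log_op \<psi> = arc_op (inv_fourier \<psi>)" using log_op_eq by auto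
  then show ?thesis by simp
qed

lemma approx_measurable [measurable]: "approx n \<in> borel_measurable borel"
  using approx_integrable[of n] by auto

lemma arc_op_approx_tendsto: "(\<lambda>n. arc_op (approx n) x) \<longlonglongrightarrow> log_op \<psi> x"
  unfolding log_op_eq arc_op_def
proof (rule integral_dominated_convergence)
  let ?I = "(LBINT \<xi>. cmod (\<psi> \<xi>))"
  show "integrable lborel (\<lambda>w. cmod (arc_kernel x w) * ?I)" using arc_kernel_integrable[of x] by simp
  show "AE w in lborel. (\<lambda>n. arc_kernel x w * approx n w) \<longlonglongrightarrow> arc_kernel x w * inv_fourier \<psi> w"
  proof (rule AE_I2)
    fix w
    have "(\<lambda>n. 1 / real (Suc n)) \<longlonglongrightarrow> 0" by real_asymp
    then have "(\<lambda>n. exp (- (1 / real (Suc n) * w)\<^sup>2 / 2)) \<longlonglongrightarrow> exp (- (0 * w)\<^sup>2 / 2)"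
      by (intro tendsto_intros) auto
    then have "(\<lambda>n. exp (- (1 / real (Suc n) * w)\<^sup>2 / 2)) \<longlonglongrightarrow> 1" by simp
    then have "(\<lambda>n. of_real (exp (- (1 / real (Suc n) * w)\<^sup>2 / 2)) * inv_fourier \<psi> w) \<longlonglongrightarrow> of_real 1 * inv_fourier \<psi> w"
      by (intro tendsto_intros)
    then show "(\<lambda>n. arc_kernel x w * approx n w) \<longlonglongrightarrow> arc_kernel x w * inv_fourier \<psi> w"
      by (intro tendsto_intros) (simp add: approx_def gauss_def)
  qed
  show "AE w in lborel. norm (arc_kernel x w * approx n w) \<le> cmod (arc_kernel x w) * ?I" for n
  proof (rule AE_I2)
    fix w
    have "cmod (gauss n w) * cmod (inv_fourier \<psi> w) \<le> 1 * ?I"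
      using inv_fourier_bound by (intro mult_mono) (auto simp: gauss_def)
    then show "norm (arc_kernel x w * approx n w) \<le> cmod (arc_kernel x w) * ?I"
      by (auto simp: approx_def norm_mult intro!: mult_left_mono)
  qed
qed measurable

lemma arc_op_approx_L2: "arc_op (approx n) \<in> L2 {0<..}"
  by (rule arc_op_L2(1)[OF approx_integrable])

abbreviation err_density :: "nat \<Rightarrow> real \<Rightarrow> real" where
  "err_density n \<eta> \<equiv> (cmod (fourier (approx n) \<eta> - 4 * pi\<^sup>2 * \<psi> \<eta>))\<^sup>2 / cosh (\<eta>/2)"

text \<open>Taken in the weight of \<open>arc_op_mult_integral\<close>, in which
  \<open>arc_op\<close> is isometric up to a constant, so that it controls distances in L2.\<close>

definition err :: "nat \<Rightarrow> real" where
  "err n = (LBINT \<eta>. err_density n \<eta>)"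

lemma dist_bound: "cmod (fourier (approx n) \<eta> - 4 * pi\<^sup>2 * \<psi> \<eta>) \<le> 8 * pi\<^sup>2 * B"
proof -
  have "cmod (fourier (approx n) \<eta> - 4 * pi\<^sup>2 * \<psi> \<eta>) \<le> cmod (fourier (approx n) \<eta>) + cmod (4 * pi\<^sup>2 * \<psi> \<eta>)"
    by (rule norm_triangle_ineq4)
  also have "\<dots> \<le> 4 * pi\<^sup>2 * B + 4 * pi\<^sup>2 * B"
    using fourier_approx_bound[of n \<eta>] bound[of \<eta>] by (intro add_mono) (auto simp: norm_mult norm_power)
  finally show ?thesis by (simp add: algebra_simps)
qed

lemma err_bound: "err_density n \<eta> \<le> (8 * pi\<^sup>2 * B)\<^sup>2 / cosh (\<eta>/2)"
  using dist_bound[of n \<eta>] by (intro divide_right_mono power_mono) auto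

lemma err_integrable: "integrable lborel (\<lambda>\<eta>. err_density n \<eta>)"
  by (rule Bochner_Integration.integrable_bound[OF integrable_inverse_cosh[of "(8 * pi\<^sup>2 * B)\<^sup>2"]])
     (use err_bound in \<open>auto\<close>)

lemma err_tendsto: "err \<longlonglongrightarrow> 0"
proof -
  have "(\<lambda>n. err n) \<longlonglongrightarrow> (LBINT \<eta>::real. 0 / cosh (\<eta>/2))"
    unfolding err_def
  proof (rule integral_dominated_convergence)
    show "integrable lborel (\<lambda>\<eta>::real. (8 * pi\<^sup>2 * B)\<^sup>2 / cosh (\<eta>/2))" by (rule integrable_inverse_cosh)
    show "AE \<eta> in lborel. (\<lambda>n. err_density n \<eta>) \<longlonglongrightarrow> 0 / cosh (\<eta>/2)"
    proof (rule AE_I2)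
      fix \<eta>
      have "(\<lambda>n. err_density n \<eta>) \<longlonglongrightarrow>
        (cmod (4 * pi\<^sup>2 * \<psi> \<eta> - 4 * pi\<^sup>2 * \<psi> \<eta>))\<^sup>2 / cosh (\<eta>/2)"
        by (intro tendsto_intros fourier_approx_tendsto) auto
      then show "(\<lambda>n. err_density n \<eta>) \<longlonglongrightarrow> 0 / cosh (\<eta>/2)" by simp
    qed
    show "AE \<eta> in lborel. norm (err_density n \<eta>) \<le> (8 * pi\<^sup>2 * B)\<^sup>2 / cosh (\<eta>/2)" for n
      using err_bound by auto
  qed measurable
  then show ?thesis by simp
qed

text \<open>Parseval for the difference of two damped densities, combined with |u - v|^2 <= 2 (|u|^2
  + |v|^2) and 2 / (8 pi) <= 1.\<close>

lemma arc_op_approx_dist: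
  "(L2_dist {0<..} (arc_op (approx n)) (arc_op (approx m)))\<^sup>2 \<le> err n + err m"
proof -
  let ?a = "\<lambda>w. approx n w - approx m w"
  have i: "integrable lborel ?a" using approx_integrable by auto
  let ?d = "\<lambda>k \<eta>. fourier (approx k) \<eta> - 4 * pi\<^sup>2 * \<psi> \<eta>"
  have sq: "(cmod (fourier ?a \<eta>))\<^sup>2 / cosh (\<eta>/2) \<le> 2 * ((cmod (?d n \<eta>))\<^sup>2 / cosh (\<eta>/2) + (cmod (?d m \<eta>))\<^sup>2 / cosh (\<eta>/2))" for \<eta>
  proof -
    have "fourier ?a \<eta> = ?d n \<eta> - ?d m \<eta>" by (simp add: fourier_diff approx_integrable)
    then have "cmod (fourier ?a \<eta>) \<le> cmod (?d n \<eta>) + cmod (?d m \<eta>)" by (simp only: norm_triangle_ineq4)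
    then have "(cmod (fourier ?a \<eta>))\<^sup>2 \<le> (cmod (?d n \<eta>) + cmod (?d m \<eta>))\<^sup>2" by (rule power_mono) simp
    also have "\<dots> \<le> 2 * ((cmod (?d n \<eta>))\<^sup>2 + (cmod (?d m \<eta>))\<^sup>2)"
      using sum_squares_bound[of "cmod (?d n \<eta>)" "cmod (?d m \<eta>)"] by (simp add: power2_sum)
    finally have "(cmod (fourier ?a \<eta>))\<^sup>2 / cosh (\<eta>/2) \<le> 2 * ((cmod (?d n \<eta>))\<^sup>2 + (cmod (?d m \<eta>))\<^sup>2) / cosh (\<eta>/2)"
      by (rule divide_right_mono) simp
    then show ?thesis by (simp add: add_divide_distrib)
  qed
  have int: "integrable lborel (\<lambda>\<eta>. 2 * ((cmod (?d n \<eta>))\<^sup>2 / cosh (\<eta>/2) + (cmod (?d m \<eta>))\<^sup>2 / cosh (\<eta>/2)))"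
    by (intro integrable_mult_right Bochner_Integration.integrable_add err_integrable)
  have int': "integrable lborel (\<lambda>\<eta>. (cmod (fourier ?a \<eta>))\<^sup>2 / cosh (\<eta>/2))"
    by (rule Bochner_Integration.integrable_bound[OF int]) (use sq i in \<open>auto intro: order_trans[OF _ abs_ge_self]\<close>)
  have "complex_of_real ((L2_norm {0<..} (arc_op ?a))\<^sup>2) = 1 / (8 * pi) * (LBINT \<eta>. complex_of_real ((cmod (fourier ?a \<eta>))\<^sup>2 / cosh (\<eta>/2)))"
    unfolding arc_op_L2(2)[OF i] of_real_divide cmod_power2_mult_cnj ..
  also have "\<dots> = of_real (1 / (8 * pi) * (LBINT \<eta>. (cmod (fourier ?a \<eta>))\<^sup>2 / cosh (\<eta>/2)))"
    by (simp only: integral_complex_of_real of_real_mult)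
  finally have "(L2_norm {0<..} (arc_op ?a))\<^sup>2 = 1 / (8 * pi) * (LBINT \<eta>. (cmod (fourier ?a \<eta>))\<^sup>2 / cosh (\<eta>/2))"
    by (simp only: of_real_eq_iff)
  also have "\<dots> \<le> 1 / (8 * pi) * (2 * (err n + err m))"
  proof (intro mult_left_mono)
    have "(LBINT \<eta>. (cmod (fourier ?a \<eta>))\<^sup>2 / cosh (\<eta>/2)) \<le>
      (LBINT \<eta>. 2 * ((cmod (?d n \<eta>))\<^sup>2 / cosh (\<eta>/2) + (cmod (?d m \<eta>))\<^sup>2 / cosh (\<eta>/2)))"
      using sq by (intro integral_mono int int') auto
    also have "\<dots> = 2 * (err n + err m)"
      unfolding err_def integral_mult_right_zero
      using Bochner_Integration.integral_add[OF err_integrable[of n] err_integrable[of m]] by simp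
    finally show "(LBINT \<eta>. (cmod (fourier ?a \<eta>))\<^sup>2 / cosh (\<eta>/2)) \<le> 2 * (err n + err m)" .
  qed simp
  also have "\<dots> \<le> 1 * (err n + err m)"
  proof -
    have "0 \<le> err n + err m" by (auto simp: err_def intro!: add_nonneg_nonneg integral_nonneg_AE)
    moreover have "1 / (8 * pi) * 2 \<le> 1" using pi_gt3 by (simp add: field_simps)
    ultimately show ?thesis by (subst mult.assoc[symmetric]) (rule mult_right_mono)
  qed
  also have "arc_op ?a = (\<lambda>x. arc_op (approx n) x - arc_op (approx m) x)"
    by (rule ext) (simp add: arc_op_diff approx_integrable)
  finally show ?thesis by simp
qed

lemma arc_op_approx_Cauchy: "L2_Cauchy {0<..} (\<lambda>n. arc_op (approx n))"
  unfolding L2_Cauchy_def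
proof (intro conjI allI impI)
  fix e :: real assume e: "0 < e"
  then obtain N where N: "\<And>n. n \<ge> N \<Longrightarrow> \<bar>err n\<bar> < e\<^sup>2 / 2"
    using LIMSEQ_D[OF err_tendsto, of "e\<^sup>2/2"] by auto
  have "L2_dist {0<..} (arc_op (approx m)) (arc_op (approx n)) \<le> e" if "m \<ge> N" "n \<ge> N" for m n
  proof (rule power2_le_imp_le)
    show "(L2_dist {0<..} (arc_op (approx m)) (arc_op (approx n)))\<^sup>2 \<le> e\<^sup>2"
      using arc_op_approx_dist[of m n] N[OF that(1)] N[OF that(2)] by linarith
  qed (use e in simp)
  then show "\<exists>N. \<forall>m\<ge>N. \<forall>n\<ge>N. L2_dist {0<..} (arc_op (approx m)) (arc_op (approx n)) \<le> e" by blast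
qed (rule arc_op_approx_L2)

text \<open>The images of the damped densities are Cauchy in L2 and converge to
  \<open>log_op \<psi>\<close> at every x, so the two limits agree.\<close>

lemma log_op_L2: "log_op \<psi> \<in> L2 {0<..}"
  and arc_op_approx_L2_tendsto: "(\<lambda>n. L2_dist {0<..} (arc_op (approx n)) (log_op \<psi>)) \<longlonglongrightarrow> 0"
  using L2_Cauchy_pointwise_limit[OF arc_op_approx_Cauchy borel_measurable_lebesgue_on[OF log_op_measurable]]
    arc_op_approx_tendsto by auto

text \<open>Serves the norm, where \<open>f n\<close> is the conjugate of the same transform, and
  the inner product, where \<open>f n\<close> is \<open>cnj (fourier b)\<close> for all n.\<close>

lemma integral_fourier_approx_tendsto:
  assumes "\<And>\<eta> n. cmod (f n \<eta>) \<le> C" "\<And>\<eta>. (\<lambda>n. f n \<eta>) \<longlonglongrightarrow> g \<eta>"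
    and [measurable]: "\<And>n. f n \<in> borel_measurable borel" "g \<in> borel_measurable borel"
  shows "(\<lambda>n. (LBINT \<eta>. fourier (approx n) \<eta> * f n \<eta> / of_real (cosh (\<eta>/2)))) \<longlonglongrightarrow>
    (LBINT \<eta>. (4 * pi\<^sup>2 * \<psi> \<eta>) * g \<eta> / of_real (cosh (\<eta>/2)))"
proof (rule integral_dominated_convergence)
  show "integrable lborel (\<lambda>\<eta>::real. (4 * pi\<^sup>2 * B) * C / cosh (\<eta>/2))" by (rule integrable_inverse_cosh)
  show "AE \<eta> in lborel. (\<lambda>n. fourier (approx n) \<eta> * f n \<eta> / of_real (cosh (\<eta>/2))) \<longlonglongrightarrow> (4 * pi\<^sup>2 * \<psi> \<eta>) * g \<eta> / of_real (cosh (\<eta>/2))"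
    by (intro AE_I2 tendsto_intros fourier_approx_tendsto assms(2)) auto
  show "AE \<eta> in lborel. norm (fourier (approx n) \<eta> * f n \<eta> / of_real (cosh (\<eta>/2))) \<le> (4 * pi\<^sup>2 * B) * C / cosh (\<eta>/2)" for n
    using fourier_approx_bound assms(1) order_trans[OF norm_ge_zero bound]
    by (auto simp: norm_mult norm_divide intro!: divide_right_mono mult_mono)
qed measurable

text \<open>The constant is (4 pi^2)^2 / (8 pi).\<close>

lemma log_op_norm: "complex_of_real ((L2_norm {0<..} (log_op \<psi>))\<^sup>2) =
   2 * pi^3 * (LBINT \<eta>. \<psi> \<eta> * cnj (\<psi> \<eta>) / of_real (cosh (\<eta>/2)))"
proof -
  have "(\<lambda>n. complex_of_real ((L2_norm {0<..} (arc_op (approx n)))\<^sup>2)) \<longlonglongrightarrow> complex_of_real ((L2_norm {0<..} (log_op \<psi>))\<^sup>2)"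
    by (intro tendsto_intros L2_norm_tendsto[OF arc_op_approx_L2 log_op_L2 arc_op_approx_L2_tendsto])
  moreover have "(\<lambda>n. complex_of_real ((L2_norm {0<..} (arc_op (approx n)))\<^sup>2)) \<longlonglongrightarrow>
      1 / (8 * pi) * (LBINT \<eta>. (4 * pi\<^sup>2 * \<psi> \<eta>) * cnj (4 * pi\<^sup>2 * \<psi> \<eta>) / of_real (cosh (\<eta>/2)))"
    unfolding arc_op_L2(2)[OF approx_integrable]
    by (intro tendsto_mult_left integral_fourier_approx_tendsto[where C="4 * pi\<^sup>2 * B"] tendsto_cnj fourier_approx_tendsto)
       (auto simp: complex_mod_cnj intro: fourier_approx_bound)
  ultimately have "complex_of_real ((L2_norm {0<..} (log_op \<psi>))\<^sup>2) =
      1 / (8 * pi) * (LBINT \<eta>. (4 * pi\<^sup>2 * \<psi> \<eta>) * cnj (4 * pi\<^sup>2 * \<psi> \<eta>) / of_real (cosh (\<eta>/2)))"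
    by (rule LIMSEQ_unique)
  also have "(\<lambda>\<eta>. (4 * pi\<^sup>2 * \<psi> \<eta>) * cnj (4 * pi\<^sup>2 * \<psi> \<eta>) / of_real (cosh (\<eta>/2)))
     = (\<lambda>\<eta>. (16 * pi^4) * (\<psi> \<eta> * cnj (\<psi> \<eta>) / of_real (cosh (\<eta>/2))))"
    by (simp add: fun_eq_iff power2_eq_square power4_eq_xxxx)
  finally show ?thesis unfolding integral_mult_right_zero by (simp add: power4_eq_xxxx power3_eq_cube)
qed

text \<open>The limit is taken in one factor, so the constant is 4 pi^2 / (8 pi). It is meant for
  the b with \<open>cnj (arc_op b)\<close> equal to the sinc kernel.\<close>

lemma log_op_inner:
  assumes b: "integrable lborel b"
  shows "integral\<^sup>L (lebesgue_on {0<..}) (\<lambda>x. log_op \<psi> x * cnj (arc_op b x)) =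
    pi / 2 * (LBINT \<eta>. \<psi> \<eta> * cnj (fourier b \<eta>) / of_real (cosh (\<eta>/2)))"
proof -
  let ?M = "lebesgue_on {0<..} :: real measure"
  have bm [measurable]: "b \<in> borel_measurable borel" using b by auto
  have bL: "(\<lambda>x. cnj (arc_op b x)) \<in> L2 {0<..}" by (intro L2_cnj arc_op_L2 b)
  have "(\<lambda>n. integral\<^sup>L ?M (\<lambda>x. arc_op (approx n) x * cnj (arc_op b x))) \<longlonglongrightarrow> integral\<^sup>L ?M (\<lambda>x. log_op \<psi> x * cnj (arc_op b x))"
  proof (rule LIM_zero_cancel, rule Lim_null_comparison)
    show "\<forall>\<^sub>F n in sequentially. norm (integral\<^sup>L ?M (\<lambda>x. arc_op (approx n) x * cnj (arc_op b x)) - integral\<^sup>L ?M (\<lambda>x. log_op \<psi> x * cnj (arc_op b x)))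
      \<le> L2_dist {0<..} (arc_op (approx n)) (log_op \<psi>) * L2_norm {0<..} (\<lambda>x. cnj (arc_op b x))"
    proof (rule always_eventually, rule allI)
      fix n
      have "integral\<^sup>L ?M (\<lambda>x. arc_op (approx n) x * cnj (arc_op b x)) - integral\<^sup>L ?M (\<lambda>x. log_op \<psi> x * cnj (arc_op b x)) =
        integral\<^sup>L ?M (\<lambda>x. (arc_op (approx n) x - log_op \<psi> x) * cnj (arc_op b x))"
        unfolding left_diff_distrib
        by (intro Bochner_Integration.integral_diff[symmetric] L2_mult_integrable bL arc_op_approx_L2 log_op_L2)
      then show "norm (integral\<^sup>L ?M (\<lambda>x. arc_op (approx n) x * cnj (arc_op b x)) - integral\<^sup>L ?M (\<lambda>x. log_op \<psi> x * cnj (arc_op b x)))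
      \<le> L2_dist {0<..} (arc_op (approx n)) (log_op \<psi>) * L2_norm {0<..} (\<lambda>x. cnj (arc_op b x))"
        by (simp only: L2_Cauchy_Schwarz[OF L2_diff[OF arc_op_approx_L2 log_op_L2] bL])
    qed
    show "(\<lambda>n. L2_dist {0<..} (arc_op (approx n)) (log_op \<psi>) * L2_norm {0<..} (\<lambda>x. cnj (arc_op b x))) \<longlonglongrightarrow> 0"
      by (rule tendsto_mult_left_zero[OF arc_op_approx_L2_tendsto])
  qed
  moreover have "(\<lambda>n. integral\<^sup>L ?M (\<lambda>x. arc_op (approx n) x * cnj (arc_op b x))) \<longlonglongrightarrow>
     1 / (8 * pi) * (LBINT \<eta>. (4 * pi\<^sup>2 * \<psi> \<eta>) * cnj (fourier b \<eta>) / of_real (cosh (\<eta>/2)))"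
  proof -
    have "integral\<^sup>L ?M (\<lambda>x. arc_op (approx n) x * cnj (arc_op b x)) =
      1 / (8 * pi) * (LBINT \<eta>. fourier (approx n) \<eta> * cnj (fourier b \<eta>) / of_real (cosh (\<eta>/2)))" for n
      unfolding arc_op_mult_integral[OF approx_integrable b, symmetric]
      by (rule integral_lebesgue_on_borel) auto
    then show ?thesis
      by (simp only:) (intro tendsto_mult_left integral_fourier_approx_tendsto[where C="(LBINT w. cmod (b w))"],
        auto intro: fourier_bound)
  qed
  ultimately have "integral\<^sup>L ?M (\<lambda>x. log_op \<psi> x * cnj (arc_op b x)) =
     1 / (8 * pi) * (LBINT \<eta>. (4 * pi\<^sup>2 * \<psi> \<eta>) * cnj (fourier b \<eta>) / of_real (cosh (\<eta>/2)))"
    by (rule LIMSEQ_unique)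
  also have "(\<lambda>\<eta>. (4 * pi\<^sup>2 * \<psi> \<eta>) * cnj (fourier b \<eta>) / of_real (cosh (\<eta>/2)))
     = (\<lambda>\<eta>. (4 * pi\<^sup>2) * (\<psi> \<eta> * cnj (fourier b \<eta>) / of_real (cosh (\<eta>/2))))"
    by (simp add: fun_eq_iff)
  finally show ?thesis unfolding integral_mult_right_zero by (simp add: power2_eq_square)
qed

end

section \<open>The kernel in the logarithmic coordinate\<close>

text \<open>The real theorem is applied to real and imaginary parts. Integrability is asked for in
  the variable w, where explicit bounds are at hand, and transferred to \<open>f\<close>.\<close>

lemma integral_change_of_variables:
  fixes f :: "real \<Rightarrow> complex" and g g' :: "real \<Rightarrow> real"
  assumes der: "\<And>w. (g has_field_derivative g' w) (at w)" and inj: "inj g"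
    and meas: "range g \<in> sets lebesgue"
    and int: "integrable lborel (\<lambda>w. \<bar>g' w\<bar> *\<^sub>R f (g w))"
  shows "integral\<^sup>L (lebesgue_on (range g)) f = (LBINT w. \<bar>g' w\<bar> *\<^sub>R f (g w))"
proof -
  let ?F = "\<lambda>w. \<bar>g' w\<bar> *\<^sub>R f (g w)"
  have iF: "integrable lebesgue ?F"
    using int by (subst integrable_completion) auto
  have aF: "?F absolutely_integrable_on UNIV"
    using iF by (simp add: set_integrable_def)
  then have af: "f absolutely_integrable_on range g"
    using der inj by (subst absolutely_integrable_change_of_variables_real[where h=g']) auto
  have i: "integrable (lebesgue_on (range g)) f"
    using af meas by (rule absolutely_integrable_imp_integrable)
  have Re: "integral (range g) (\<lambda>x. Re (f x)) = integral UNIV (\<lambda>w. Re (?F w))"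
  proof -
    have "(\<lambda>w. \<bar>g' w\<bar> * Re (f (g w))) absolutely_integrable_on UNIV"
      using integrable_Re[OF iF] by (simp add: set_integrable_def)
    then show ?thesis
      using has_absolute_integral_change_of_variables_1'[of UNIV g g' "\<lambda>x. Re (f x)" "integral UNIV (\<lambda>w. \<bar>g' w\<bar> * Re (f (g w)))"] der inj
      by auto
  qed
  have Im: "integral (range g) (\<lambda>x. Im (f x)) = integral UNIV (\<lambda>w. Im (?F w))"
  proof -
    have "(\<lambda>w. \<bar>g' w\<bar> * Im (f (g w))) absolutely_integrable_on UNIV"
      using integrable_Im[OF iF] by (simp add: set_integrable_def)
    then show ?thesis
      using has_absolute_integral_change_of_variables_1'[of UNIV g g' "\<lambda>x. Im (f x)" "integral UNIV (\<lambda>w. \<bar>g' w\<bar> * Im (f (g w)))"] der inj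
      by auto
  qed
  have iU: "integrable (lebesgue_on UNIV) ?F" using iF by (simp add: integrable_restrict_space)
  have L: "integral\<^sup>L lborel ?F = integral\<^sup>L (lebesgue_on UNIV) ?F"
    using int by (simp add: integral_restrict_space integral_completion)
  show "integral\<^sup>L (lebesgue_on (range g)) f = integral\<^sup>L lborel ?F"
    unfolding L
  proof (rule complex_eqI)
    show "Re (integral\<^sup>L (lebesgue_on (range g)) f) = Re (integral\<^sup>L (lebesgue_on UNIV) ?F)"
      unfolding integral_Re[OF i, symmetric] integral_Re[OF iU, symmetric]
      using lebesgue_integral_eq_integral[OF integrable_Re[OF i] meas] lebesgue_integral_eq_integral[OF integrable_Re[OF iU]] Re by simp
    show "Im (integral\<^sup>L (lebesgue_on (range g)) f) = Im (integral\<^sup>L (lebesgue_on UNIV) ?F)"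
      unfolding integral_Im[OF i, symmetric] integral_Im[OF iU, symmetric]
      using lebesgue_integral_eq_integral[OF integrable_Im[OF i] meas] lebesgue_integral_eq_integral[OF integrable_Im[OF iU]] Im by simp
  qed
qed

text \<open>Under u = - tanh (w/2) the Jacobian 1 / (2 (cosh (w/2))^2) and (1 - u^2)^(-1/2) = cosh
  (w/2) combine to 1 / (2 cosh (w/2)), and ln ((1 - u)/(1 + u)) becomes w.\<close>

lemma q_plus_q_int:
  "q_plus s x = of_real (1 / 2 * pi powr (- 3 / 2) * inverse s * (1 - s) powr (- 1 / 2)) * q_int x (ln (1 / s - 1))"
proof -
  define \<xi> where "\<xi> = ln (1 / s - 1)"
  define G where "G = (\<lambda>u. exp (- \<i> * of_real (x * u)) * of_real ((1 - u\<^sup>2) powr (- 1 / 2)) *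
            exp (\<i> / of_real (2 * pi) * of_real (\<xi> * ln ((1 - u) / (1 + u)))))"
  define g where "g = (\<lambda>w::real. - tanh (w/2))"
  define g' where "g' = (\<lambda>w::real. - (1 - (tanh (w/2))\<^sup>2) / 2)"
  have der: "(g has_field_derivative g' w) (at w)" for w
    unfolding g_def g'_def by (auto intro!: derivative_eq_intros simp: diff_divide_distrib)
  have inj: "inj g" by (auto simp: inj_on_def g_def)
  have rng: "range g = {-1<..<1}"
  proof (intro equalityI subsetI)
    fix u :: real assume "u \<in> {-1<..<1}"
    then have u: "0 < (1 - u) / (1 + u)" "1 - u \<noteq> 0" by auto
    have e: "exp (- 2 * (ln ((1 - u) / (1 + u)) / 2)) = (1 + u) / (1 - u)"
      using u(1) by (simp add: exp_minus)
    have "g (ln ((1 - u) / (1 + u))) = u"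
      unfolding g_def tanh_real_altdef e using u(2) by (simp add: divide_simps)
    then have "u = g (ln ((1 - u) / (1 + u)))" ..
    then show "u \<in> range g" by blast
  qed (use tanh_real_bounds in \<open>auto simp: g_def\<close>)
  have GF: "\<bar>g' w\<bar> *\<^sub>R G (g w) = strip_fun x \<xi> (of_real w)" for w
  proof -
    define c t where "c = cosh (w/2)" and "t = tanh (w/2)"
    have t1: "1 - t\<^sup>2 = 1 / c\<^sup>2"
    proof -
      have "1 - t\<^sup>2 = ((cosh (w/2))\<^sup>2 - (sinh (w/2))\<^sup>2) / (cosh (w/2))\<^sup>2"
        by (simp add: t_def tanh_def power_divide diff_divide_distrib)
      then show ?thesis by (simp add: cosh_square_eq[of "w/2"] c_def)
    qed
    have c: "0 < c" by (simp add: c_def)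
    have p: "(1 - t\<^sup>2) powr (- (1 / 2)) = c"
    proof -
      have "(1 / c\<^sup>2) powr (- (1 / 2)) = inverse (sqrt (1 / c\<^sup>2))"
        using c by (subst powr_minus) (simp add: powr_half_sqrt)
      also have "sqrt (1 / c\<^sup>2) = 1 / c" using c by (simp add: real_sqrt_divide)
      also have "inverse (1 / c) = c" by simp
      finally show ?thesis by (simp add: t1)
    qed
    have l: "ln ((1 + t) / (1 - t)) = w"
    proof -
      have "(1 + t) / (1 - t) = (c + sinh (w/2)) / (c - sinh (w/2))"
        using c by (simp add: t_def tanh_def c_def divide_simps)
      also have "\<dots> = exp (w/2) / exp (- (w/2))"
        by (simp add: c_def cosh_plus_sinh cosh_minus_sinh)
      also have "\<dots> = exp w" by (simp flip: exp_diff)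
      finally show ?thesis by simp
    qed
    have "\<bar>g' w\<bar> = 1 / (2 * c\<^sup>2)" unfolding g'_def t_def[symmetric] t1 by simp
    then have "\<bar>g' w\<bar> *\<^sub>R G (g w) = of_real (1 / (2 * c\<^sup>2) * c) * exp (\<i> * of_real (x * t)) * exp (\<i> / of_real (2 * pi) * of_real (\<xi> * w))"
      by (simp add: G_def g_def p l scaleR_conv_of_real flip: t_def)
    also have "1 / (2 * c\<^sup>2) * c = 1 / (2 * c)" using c by (simp add: power2_eq_square)
    also have "of_real (1 / (2 * c)) * exp (\<i> * of_real (x * t)) * exp (\<i> / of_real (2 * pi) * of_real (\<xi> * w)) = strip_fun x \<xi> (of_real w)"
    proof -
      have "cosh (complex_of_real w / 2) = of_real c" "tanh (complex_of_real w / 2) = of_real t"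
        using cosh_of_real_complex[of "w/2"] sinh_of_real_complex[of "w/2"] by (simp_all add: c_def t_def tanh_def)
      then show ?thesis by (simp add: strip_fun_def mult_ac)
    qed
    finally show ?thesis .
  qed
  have Fi: "integrable lborel (\<lambda>w. strip_fun x \<xi> (of_real w))"
    using strip_fun_integrable_line[of 0 x \<xi>] by (simp add: complex_of_real_def)
  have Gm: "G \<in> borel_measurable borel" unfolding G_def by measurable
  have "integral\<^sup>L (lebesgue_on {-1..1}) G = set_lebesgue_integral lborel {-1..1} G"
    by (rule integral_lebesgue_on_borel[OF _ Gm]) simp
  \<comment> \<open>The substitution misses the endpoints. They form a null set, so the values of
    powr and ln there are irrelevant.\<close>
  also have "\<dots> = set_lebesgue_integral lborel {-1<..<1} G"
  proof -
    have "set_lebesgue_integral lborel {a..b} G = set_lebesgue_integral lborel {a<..<b} G" if "a \<le> b" for a b :: real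
      using interval_integral_Icc[OF that, of G] interval_integral_Ioo[of "ereal a" "ereal b" G] that by simp
    then show ?thesis by simp
  qed
  also have "\<dots> = integral\<^sup>L (lebesgue_on {-1<..<1}) G"
    by (rule integral_lebesgue_on_borel[OF _ Gm, symmetric]) simp
  also have "\<dots> = q_int x \<xi>"
    using integral_change_of_variables[OF der inj, of G] Fi unfolding GF rng q_int_def by simp
  finally show ?thesis unfolding q_plus_def G_def \<xi>_def by simp
qed

text \<open>The inverse of s -> ln (1/s - 1). It is decreasing with Jacobian s (1 - s).\<close>

definition logistic :: "real \<Rightarrow> real" where
  "logistic \<xi> = 1 / (1 + exp \<xi>)"

lemma logistic_bounds: "0 < logistic \<xi>" "logistic \<xi> < 1"
  by (auto simp: logistic_def add_pos_pos divide_less_eq)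

lemma one_minus_logistic: "1 - logistic \<xi> = exp \<xi> * logistic \<xi>"
proof -
  have "1 + exp \<xi> \<noteq> 0" using exp_gt_zero[of \<xi>] by linarith
  then show ?thesis by (simp add: logistic_def divide_simps)
qed

lemma ln_logistic: "ln (1 / logistic \<xi> - 1) = \<xi>"
  by (simp add: logistic_def)

lemma DERIV_logistic: "(logistic has_field_derivative - (logistic \<xi> * (1 - logistic \<xi>))) (at \<xi>)"
proof -
  have "1 + exp \<xi> \<noteq> 0" using exp_gt_zero[of \<xi>] by linarith
  then show ?thesis
    unfolding one_minus_logistic unfolding logistic_def [abs_def]
    by (auto intro!: derivative_eq_intros simp: power2_eq_square)
qed

lemma inj_logistic: "inj logistic"
  by (rule inj_on_inverseI[where g="\<lambda>s. ln (1 / s - 1)"]) (rule ln_logistic)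

lemma range_logistic: "range logistic = {0<..<1}"
proof (intro equalityI subsetI)
  fix s :: real assume "s \<in> {0<..<1}"
  then have "s = logistic (ln (1 / s - 1))" by (simp add: logistic_def)
  then show "s \<in> range logistic" by blast
qed (use logistic_bounds in auto)

lemma continuous_on_logistic [continuous_intros]: "continuous_on S f \<Longrightarrow> continuous_on S (\<lambda>w. logistic (f w))"
  unfolding logistic_def by (auto intro!: continuous_intros) (smt (verit) exp_gt_zero)

lemma logistic_measurable [measurable]: "logistic \<in> borel_measurable borel"
  by (intro borel_measurable_continuous_onI continuous_intros)

lemma logistic_cosh: "exp (- \<xi> / 2) / (2 * cosh (\<xi> / 2)) = logistic \<xi>"
proof -
  have "exp (\<xi> / 2) * (2 * cosh (\<xi> / 2)) = exp (\<xi> / 2) * exp (\<xi> / 2) + exp (\<xi> / 2) * exp (- (\<xi> / 2))"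
    by (simp add: cosh_field_def distrib_left)
  also have "\<dots> = 1 + exp \<xi>" by (simp flip: exp_add)
  finally have "exp (\<xi> / 2) * (2 * cosh (\<xi> / 2)) = 1 + exp \<xi>" .
  moreover have "exp (- \<xi> / 2) / (2 * cosh (\<xi> / 2)) = 1 / (exp (\<xi> / 2) * (2 * cosh (\<xi> / 2)))"
    by (simp add: exp_minus inverse_eq_divide)
  ultimately show ?thesis by (simp only: logistic_def)
qed

lemma integral_logistic:
  fixes f :: "real \<Rightarrow> complex"
  assumes "integrable lborel (\<lambda>\<xi>. of_real (logistic \<xi> * (1 - logistic \<xi>)) * f (logistic \<xi>))"
  shows "integral\<^sup>L (lebesgue_on {0<..<1}) f = (LBINT \<xi>. of_real (logistic \<xi> * (1 - logistic \<xi>)) * f (logistic \<xi>))"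
proof -
  have e: "\<bar>- (logistic \<xi> * (1 - logistic \<xi>))\<bar> *\<^sub>R f (logistic \<xi>) = of_real (logistic \<xi> * (1 - logistic \<xi>)) * f (logistic \<xi>)" for \<xi>
    using logistic_bounds[of \<xi>] by (simp add: scaleR_conv_of_real abs_mult)
  have i: "integrable lborel (\<lambda>\<xi>. \<bar>- (logistic \<xi> * (1 - logistic \<xi>))\<bar> *\<^sub>R f (logistic \<xi>))" unfolding e by (rule assms)
  show "integral\<^sup>L (lebesgue_on {0<..<1}) f = (LBINT \<xi>. of_real (logistic \<xi> * (1 - logistic \<xi>)) * f (logistic \<xi>))"
    using integral_change_of_variables[OF DERIV_logistic inj_logistic _ i] unfolding e by (simp add: range_logistic)
qed

definition q_const :: real where "q_const = 1 / 2 * pi powr (- 3 / 2)"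

lemma q_const_power2: "q_const\<^sup>2 = 1 / (4 * pi^3)"
proof -
  have "(pi powr (- 3 / 2))\<^sup>2 = pi powr (- 3)"
    by (simp add: power2_eq_square flip: powr_add)
  also have "\<dots> = 1 / pi^3" by (simp add: powr_minus divide_inverse flip: powr_numeral)
  finally show ?thesis by (simp add: q_const_def power_mult_distrib power_divide)
qed

text \<open>Jacobian and prefactor of \<open>q_plus\<close>, s (1 - s) times s^-1 (1 - s)^(-1/2),
  leave sqrt (1 - s); the factor exp (- \<xi>/4) compensates the weight inside
  \<open>log_op\<close>.\<close>

definition log_density :: "(real \<Rightarrow> complex) \<Rightarrow> real \<Rightarrow> complex" where
  "log_density h \<xi> = of_real (q_const * sqrt (1 - logistic \<xi>) * exp (- \<xi> / 4)) * h (logistic \<xi>)"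

lemma q_plus_logistic:
  "of_real (logistic \<xi> * (1 - logistic \<xi>)) * (q_plus (logistic \<xi>) x * h (logistic \<xi>)) = log_density h \<xi> * (of_real (exp (\<xi>/4)) * q_int x \<xi>)"
proof -
  define r where "r = 1 - logistic \<xi>"
  have r: "0 < r" using logistic_bounds[of \<xi>] by (simp add: r_def)
  have s: "logistic \<xi> \<noteq> 0" using logistic_bounds[of \<xi>] by simp
  have "r * r powr (- 1 / 2) = sqrt r"
  proof -
    have "r * r powr (- 1 / 2) = r powr 1 * r powr (- 1/2)" using r by simp
    also have "\<dots> = r powr (1/2)" unfolding powr_add[symmetric] by simp
    finally show ?thesis using r by (simp add: powr_half_sqrt)
  qed
  then have "logistic \<xi> * r * (q_const * inverse (logistic \<xi>) * r powr (- 1 / 2)) = q_const * sqrt r"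
    using s by (simp add: field_simps)
  also have "\<dots> = (q_const * sqrt r * exp (- \<xi> / 4)) * exp (\<xi>/4)" by (simp flip: exp_add)
  finally have *: "complex_of_real (logistic \<xi> * r * (q_const * inverse (logistic \<xi>) * r powr (- 1 / 2))) = of_real (q_const * sqrt r * exp (- \<xi> / 4)) * of_real (exp (\<xi>/4))"
    by (simp only: of_real_mult)
  have "of_real (logistic \<xi> * r) * (of_real (q_const * inverse (logistic \<xi>) * r powr (- 1 / 2)) * q_int x \<xi> * h (logistic \<xi>)) =
    of_real (logistic \<xi> * r * (q_const * inverse (logistic \<xi>) * r powr (- 1 / 2))) * (q_int x \<xi> * h (logistic \<xi>))"
    by (simp only: of_real_mult mult_ac)
  then show ?thesis
    unfolding q_plus_q_int ln_logistic log_density_def q_const_def[symmetric] r_def[symmetric] * by (simp only: mult_ac)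
qed

text \<open>The isometry at the level of integrands: 2 pi^3 times \<open>q_const\<close> squared is
  1/2, and exp (- \<xi>/2) / (2 cosh (\<xi>/2)) = s turns the weight of \<open>log_op_norm\<close>
  into the Jacobian s (1 - s).\<close>

lemma log_density_mult_cnj:
  "2 * of_real (pi^3) * (log_density h \<xi> * cnj (log_density h \<xi>) / of_real (cosh (\<xi>/2))) =
   of_real (logistic \<xi> * (1 - logistic \<xi>)) * (h (logistic \<xi>) * cnj (h (logistic \<xi>)))"
proof -
  have "2 * pi^3 * ((q_const * sqrt (1 - logistic \<xi>) * exp (- \<xi> / 4))\<^sup>2 / cosh (\<xi>/2)) =
      2 * pi^3 * (q_const\<^sup>2 * (1 - logistic \<xi>) * exp (- \<xi> / 2) / cosh (\<xi>/2))"
    using logistic_bounds[of \<xi>] by (simp add: power_mult_distrib power2_eq_square[of "exp _"] flip: exp_add)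
  also have "\<dots> = (1 - logistic \<xi>) * (exp (- \<xi> / 2) / (2 * cosh (\<xi>/2)))"
    unfolding q_const_power2 by (simp add: field_simps)
  finally have *: "2 * pi^3 * ((q_const * sqrt (1 - logistic \<xi>) * exp (- \<xi> / 4))\<^sup>2 / cosh (\<xi>/2)) = logistic \<xi> * (1 - logistic \<xi>)"
    unfolding logistic_cosh by simp
  have "2 * of_real (pi^3) * ((of_real K * z) * cnj (of_real K * z) / of_real C) = of_real (2 * pi^3 * (K\<^sup>2 / C)) * (z * cnj z)" for K C z
    by (simp add: power2_eq_square)
  then show ?thesis unfolding log_density_def *[symmetric] .
qed

lemma log_density_test_function:
  assumes "continuous_on UNIV h" "\<And>s. s \<notin> {a..b} \<Longrightarrow> h s = 0" "0 < a" "b < 1"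
  shows "\<exists>R B. test_function (log_density h) R B"
proof -
  \<comment> \<open>From a <= 1 / (1 + exp \<xi>) <= b it follows that 1/b - 1 <= exp \<xi> <= 1/a -
    1; the upper end is weakened to 1/a, whose positivity follows from a > 0 alone.\<close>
  define R where "R = max \<bar>ln (1/a)\<bar> \<bar>ln (1/b - 1)\<bar>"
  have cont: "continuous_on UNIV (log_density h)"
    unfolding log_density_def
    by (intro continuous_intros continuous_on_compose2[OF assms(1)]) auto
  have supp: "log_density h \<xi> = 0" if "R < \<bar>\<xi>\<bar>" for \<xi>
  proof (rule ccontr)
    assume "log_density h \<xi> \<noteq> 0"
    then have "logistic \<xi> \<in> {a..b}" using assms(2)[of "logistic \<xi>"] by (auto simp: log_density_def)
    then have ab: "a \<le> logistic \<xi>" "logistic \<xi> \<le> b" by auto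
    then have "0 < b" using assms(3) by linarith
    have p: "0 < 1 + exp \<xi>" by (simp add: add_pos_pos)
    have "exp \<xi> \<le> 1 / a" "1 / b - 1 \<le> exp \<xi>"
      using ab p assms(3) \<open>0 < b\<close> by (auto simp: logistic_def field_simps)
    moreover have "0 < 1 / a" "0 < 1 / b - 1" using assms(3,4) \<open>0 < b\<close> by auto
    ultimately have "\<xi> \<le> ln (1/a)" "ln (1/b - 1) \<le> \<xi>"
      using ln_mono[of "1 / b - 1" "exp \<xi>"] by (simp only: ln_ge_iff, simp)
    then show False using that by (auto simp: R_def)
  qed
  have "compact (log_density h ` {-R..R})" by (intro compact_continuous_image continuous_on_subset[OF cont]) auto
  then obtain B where B: "\<And>\<xi>. \<xi> \<in> {-R..R} \<Longrightarrow> cmod (log_density h \<xi>) \<le> B"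
    using compact_imp_bounded bounded_iff by (metis imageI)
  have "cmod (log_density h \<xi>) \<le> max B 0" for \<xi>
    using B[of \<xi>] supp[of \<xi>] by (cases "\<xi> \<in> {-R..R}") auto
  then show ?thesis using cont supp by (intro exI[of _ R] exI[of _ "max B 0"] test_function.intro) auto
qed

section \<open>Continuous functions with compact support in the open unit interval\<close>

text \<open>Meant for h that vanish near 0 and 1, where the integral involves no limit;
  \<open>V_op\<close> extends it in L2.\<close>

definition q_op :: "(real \<Rightarrow> complex) \<Rightarrow> real \<Rightarrow> complex" where
  "q_op h x = integral\<^sup>L (lebesgue_on {0<..<1}) (\<lambda>s. q_plus s x * h s)"

lemma exp_q_int_measurable [measurable]: "(\<lambda>\<xi>. of_real (exp (\<xi>/4)) * q_int x \<xi>) \<in> borel_measurable borel"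
  unfolding integral_arc_kernel_exp[symmetric] by measurable

text \<open>With exp (\<xi>/4) absorbed, this is the Fourier integral of an integrable function,
  hence bounded uniformly in \<xi>.\<close>

lemma exp_q_int_bound: "cmod (of_real (exp (\<xi>/4)) * q_int x \<xi>) \<le> (LBINT w. cmod (arc_kernel x w))"
proof -
  have "cmod (of_real (exp (\<xi>/4)) * q_int x \<xi>) \<le> (LBINT w. cmod (arc_kernel x w * wave \<xi> w))"
    unfolding integral_arc_kernel_exp[symmetric] by (rule integral_norm_bound)
  then show ?thesis by (simp add: norm_mult)
qed

lemma q_int_measurable [measurable]: "q_int x \<in> borel_measurable borel"
proof -
  have "(\<lambda>\<xi>. of_real (exp (- \<xi>/4)) * (of_real (exp (\<xi>/4)) * q_int x \<xi>)) \<in> borel_measurable borel" by measurable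
  moreover have "of_real (exp (- \<xi>/4)) * (of_real (exp (\<xi>/4)) * q_int x \<xi>) = q_int x \<xi>" for \<xi>
  proof -
    have "of_real (exp (- \<xi>/4)) * of_real (exp (\<xi>/4)) = (1::complex)" by (simp flip: of_real_mult exp_add)
    then show ?thesis by (simp only: mult.assoc[symmetric] mult_1)
  qed
  ultimately show ?thesis by (simp only:)
qed

lemma q_plus_measurable: "(\<lambda>s. q_plus s x) \<in> borel_measurable borel"
  unfolding q_plus_q_int by measurable

context test_function
begin

lemma psi_exp_q_int_integrable: "integrable lborel (\<lambda>\<xi>. \<psi> \<xi> * (of_real (exp (\<xi>/4)) * q_int x \<xi>))"
proof (rule Bochner_Integration.integrable_bound)
  show "integrable lborel (\<lambda>\<xi>. \<psi> \<xi> * of_real ((LBINT w. cmod (arc_kernel x w))))"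
    using psi_integrable by simp
  show "AE \<xi> in lborel. norm (\<psi> \<xi> * (of_real (exp (\<xi>/4)) * q_int x \<xi>)) \<le> norm (\<psi> \<xi> * of_real ((LBINT w. cmod (arc_kernel x w))))"
  proof (rule AE_I2)
    fix \<xi>
    have "cmod (\<psi> \<xi>) * cmod (of_real (exp (\<xi>/4)) * q_int x \<xi>) \<le> cmod (\<psi> \<xi>) * \<bar>(LBINT w. cmod (arc_kernel x w))\<bar>"
      using exp_q_int_bound[of \<xi> x] by (intro mult_left_mono) auto
    then show "norm (\<psi> \<xi> * (of_real (exp (\<xi>/4)) * q_int x \<xi>)) \<le> norm (\<psi> \<xi> * of_real ((LBINT w. cmod (arc_kernel x w))))"
      by (simp add: norm_mult)
  qed
qed measurable

lemma psi_mult_cnj_integrable: "integrable lborel (\<lambda>\<eta>. \<psi> \<eta> * cnj (\<psi> \<eta>) / of_real (cosh (\<eta>/2)))"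
proof (rule Bochner_Integration.integrable_bound[OF integrable_inverse_cosh[of "B * B"]])
  show "AE \<eta> in lborel. norm (\<psi> \<eta> * cnj (\<psi> \<eta>) / of_real (cosh (\<eta>/2))) \<le> norm (B * B / cosh (\<eta>/2))"
    using bound order_trans[OF norm_ge_zero bound]
    by (auto simp: norm_mult norm_divide abs_mult intro!: divide_right_mono mult_mono order_trans[OF _ abs_ge_self])
qed measurable

end

text \<open>Explicit endpoints allow a whole sequence to be confined to one common interval.\<close>

definition supported :: "real \<Rightarrow> real \<Rightarrow> (real \<Rightarrow> complex) \<Rightarrow> bool" where
  "supported a b h \<longleftrightarrow> 0 < a \<and> b < 1 \<and> (\<forall>s. s \<notin> {a..b} \<longrightarrow> h s = 0)"

lemma supported_test_function:
  "continuous_on UNIV h \<Longrightarrow> supported a b h \<Longrightarrow> \<exists>R B. test_function (log_density h) R B"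
  unfolding supported_def by (rule log_density_test_function) auto

lemma q_op_eq_log_op:
  assumes "continuous_on UNIV h" "supported a b h"
  shows "q_op h x = log_op (log_density h) x"
proof -
  obtain R B where "test_function (log_density h) R B" using supported_test_function[OF assms] by auto
  then interpret test_function "log_density h" R B .
  have "q_op h x = (LBINT \<xi>. of_real (logistic \<xi> * (1 - logistic \<xi>)) * (q_plus (logistic \<xi>) x * h (logistic \<xi>)))"
    unfolding q_op_def
    by (rule integral_logistic, unfold q_plus_logistic, rule psi_exp_q_int_integrable)
  then show ?thesis unfolding q_plus_logistic log_op_def .
qed

text \<open>In the logarithmic coordinate the two squared norms are integrals of the same function,
  by \<open>log_op_norm\<close> and \<open>log_density_mult_cnj\<close>.\<close>

lemma
  assumes h: "continuous_on UNIV h" "supported a b h"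
  shows q_op_continuous_L2: "q_op h \<in> L2 {0<..}"
    and q_op_continuous_arg_L2: "h \<in> L2 {0<..<1}"
    and q_op_continuous_norm: "L2_norm {0<..} (q_op h) = L2_norm {0<..<1} h"
proof -
  obtain R B where "test_function (log_density h) R B" using supported_test_function[OF assms] by auto
  then interpret test_function "log_density h" R B .
  have W: "q_op h = log_op (log_density h)" using q_op_eq_log_op[OF h] by auto
  show "q_op h \<in> L2 {0<..}" unfolding W by (rule log_op_L2)
  have hm [measurable]: "h \<in> borel_measurable borel" using h(1) by (rule borel_measurable_continuous_onI)
  have hc: "continuous_on UNIV (\<lambda>s. h s * cnj (h s))" using h(1) by (intro continuous_intros)
  have hi: "set_integrable lborel {0<..<1} (\<lambda>s. h s * cnj (h s))"
    by (rule set_integrable_subset[OF borel_integrable_atLeastAtMost'[OF continuous_on_subset[OF hc], of 0 1]]) auto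
  show "h \<in> L2 {0<..<1}" by (rule L2_borelI[OF _ hm hi]) simp
  have "complex_of_real ((L2_norm {0<..<1} h)\<^sup>2) = (LBINT s:{0<..<1}. h s * cnj (h s))"
    by (rule L2_norm_borel[OF _ hm hi]) simp
  also have "\<dots> = integral\<^sup>L (lebesgue_on {0<..<1}) (\<lambda>s. h s * cnj (h s))"
    by (intro integral_lebesgue_on_borel[symmetric]) measurable
  also have "\<dots> = (LBINT \<xi>. of_real (logistic \<xi> * (1 - logistic \<xi>)) * (h (logistic \<xi>) * cnj (h (logistic \<xi>))))"
    by (rule integral_logistic, unfold log_density_mult_cnj[symmetric], rule integrable_mult_right, rule psi_mult_cnj_integrable)
  also have "\<dots> = 2 * of_real (pi^3) * (LBINT \<eta>. log_density h \<eta> * cnj (log_density h \<eta>) / of_real (cosh (\<eta>/2)))"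
    unfolding log_density_mult_cnj[symmetric] by (rule integral_mult_right_zero)
  also have "\<dots> = complex_of_real ((L2_norm {0<..} (q_op h))\<^sup>2)"
    unfolding W log_op_norm by simp
  finally have "(L2_norm {0<..<1} h)\<^sup>2 = (L2_norm {0<..} (q_op h))\<^sup>2" by (simp only: of_real_eq_iff)
  then show "L2_norm {0<..} (q_op h) = L2_norm {0<..<1} h"
    by (simp add: L2_norm_nonneg)
qed

section \<open>The operator K on images of continuous functions\<close>

abbreviation sinc_kernel :: "real \<Rightarrow> real \<Rightarrow> complex" where
  "sinc_kernel x y \<equiv> of_real (1 / pi * sinc (x - y))"

text \<open>As a function of y the sinc kernel is an image under \<open>arc_op\<close>, which makes
  K accessible to Parseval. It is real, so the conjugate required there costs nothing; y = x is left
  out because of \<open>integral_arc_kernel_sinc\<close>.\<close>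

lemma sinc_kernel_AE:
  "AE y in lebesgue_on {0<..}. sinc_kernel x y = cnj (arc_op (\<lambda>w. arc_kernel (- x) w / of_real pi) y)"
proof -
  have "arc_op (\<lambda>w. arc_kernel (- x) w / of_real pi) y = sinc_kernel x y" if "y \<noteq> x" for y
  proof -
    have "arc_op (\<lambda>w. arc_kernel (- x) w / of_real pi) y = (LBINT w. arc_kernel y w * arc_kernel (- x) w) / of_real pi"
      by (simp add: arc_op_def)
    then show ?thesis using integral_arc_kernel_sinc[of x y] that by simp
  qed
  moreover have "AE y in lebesgue_on {0<..}. y \<noteq> x"
  proof -
    have "AE y in lebesgue. y \<noteq> x" by (rule AE_completion[OF AE_lborel_singleton])
    then show ?thesis by (subst AE_restrict_space_iff) auto
  qed
  ultimately show ?thesis by (auto elim!: eventually_mono)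
qed

lemma sinc_kernel_measurable: "sinc_kernel x \<in> borel_measurable (lebesgue_on {0<..})"
  by (intro borel_measurable_lebesgue_on) measurable

lemma arc_kernel_pi_integrable: "integrable lborel (\<lambda>w. arc_kernel (- x) w / of_real pi)"
  using arc_kernel_integrable[of "- x"] by simp

lemma sinc_kernel_L2: "sinc_kernel x \<in> L2 {0<..}"
  by (rule L2_cong_AE[OF L2_cnj[OF arc_op_L2(1)[OF arc_kernel_pi_integrable[of x]]] sinc_kernel_measurable])
     (use sinc_kernel_AE[of x] in \<open>auto elim!: eventually_mono\<close>)

text \<open>Every row of the kernel lies in L2, so \<open>K_op f x\<close> depends continuously on f
  at each single x.\<close>

lemma K_op_bounded:
  assumes "f \<in> L2 {0<..}" "g \<in> L2 {0<..}"
  shows "cmod (K_op f x - K_op g x) \<le>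
    L2_norm {0<..} (sinc_kernel x) * L2_dist {0<..} f g"
proof -
  have "K_op f x - K_op g x = integral\<^sup>L (lebesgue_on {0<..}) (\<lambda>y. sinc_kernel x y * (f y - g y))"
    unfolding K_op_def right_diff_distrib
    by (rule Bochner_Integration.integral_diff[symmetric]) (intro L2_mult_integrable sinc_kernel_L2 assms)+
  then show ?thesis using L2_Cauchy_Schwarz[OF sinc_kernel_L2 L2_diff[OF assms]] by simp
qed

lemma K_op_tendsto:
  assumes "\<And>n. F n \<in> L2 {0<..}" "f \<in> L2 {0<..}" "(\<lambda>n. L2_dist {0<..} (F n) f) \<longlonglongrightarrow> 0"
  shows "(\<lambda>n. K_op (F n) x) \<longlonglongrightarrow> K_op f x"
proof (rule LIM_zero_cancel, rule Lim_null_comparison)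
  show "\<forall>\<^sub>F n in sequentially. norm (K_op (F n) x - K_op f x) \<le>
    L2_norm {0<..} (sinc_kernel x) * L2_dist {0<..} (F n) f"
    by (intro always_eventually allI K_op_bounded assms)
  show "(\<lambda>n. L2_norm {0<..} (sinc_kernel x) * L2_dist {0<..} (F n) f) \<longlonglongrightarrow> 0"
    by (rule tendsto_mult_right_zero[OF assms(3)])
qed

text \<open>The constants pi/2 of \<open>log_op_inner\<close> and 1/pi of the sinc kernel leave the
  1/2 in 1 / (2 cosh (\<eta>/2)). Then exp (- \<eta>/4) / (2 cosh (\<eta>/2)) = exp (\<eta>/4) s
  restores the kernel of \<open>log_op\<close>, with the factor s passed on to h.\<close>

lemma K_op_q_op_continuous:
  assumes h: "continuous_on UNIV h" "supported a b h"
  shows "K_op (q_op h) x = q_op (\<lambda>s. of_real s * h s) x"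
proof -
  obtain R B where "test_function (log_density h) R B" using supported_test_function[OF assms] by auto
  then interpret test_function "log_density h" R B .
  let ?b = "\<lambda>w. arc_kernel (- x) w / of_real pi"
  have W: "q_op h = log_op (log_density h)" using q_op_eq_log_op[OF h] by auto
  have fourier: "cnj (fourier ?b \<eta>) = of_real (1 / pi) * (of_real (exp (- \<eta> / 4)) * q_int x \<eta>)" for \<eta>
  proof -
    have "cnj (fourier ?b \<eta>) = (LBINT w. of_real (1 / pi) * (cnj (arc_kernel (- x) w) * wave \<eta> w))"
      unfolding fourier_def Bochner_Integration.integral_cnj[symmetric]
      by (intro Bochner_Integration.integral_cong) (auto simp: exp_cnj)
    also have "\<dots> = of_real (1 / pi) * (of_real (exp (- \<eta> / 4)) * q_int x \<eta>)"
      unfolding integral_mult_right_zero integral_cnj_arc_kernel_exp ..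
    finally show ?thesis .
  qed
  have "K_op (q_op h) x = integral\<^sup>L (lebesgue_on {0<..}) (\<lambda>y. log_op (log_density h) y * cnj (arc_op ?b y))"
    unfolding K_op_def W
  proof (rule integral_cong_AE)
    show "(\<lambda>y. sinc_kernel x y * log_op (log_density h) y) \<in> borel_measurable (lebesgue_on {0<..})"
      by (intro borel_measurable_times sinc_kernel_measurable borel_measurable_lebesgue_on log_op_measurable)
    show "(\<lambda>y. log_op (log_density h) y * cnj (arc_op ?b y)) \<in> borel_measurable (lebesgue_on {0<..})"
      by (intro borel_measurable_lebesgue_on) measurable
    show "AE y in lebesgue_on {0<..}. sinc_kernel x y * log_op (log_density h) y = log_op (log_density h) y * cnj (arc_op ?b y)"
      using sinc_kernel_AE[of x] by eventually_elim (simp only: mult.commute)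
  qed
  also have "\<dots> = of_real (pi / 2) * (LBINT \<eta>. log_density h \<eta> * cnj (fourier ?b \<eta>) / of_real (cosh (\<eta>/2)))"
    using log_op_inner[OF arc_kernel_pi_integrable[of x]] by simp
  also have "\<dots> = (LBINT \<eta>. of_real (pi / 2) * (log_density h \<eta> * cnj (fourier ?b \<eta>) / of_real (cosh (\<eta>/2))))"
    by (rule integral_mult_right_zero[symmetric])
  also have "\<dots> = log_op (log_density (\<lambda>s. of_real s * h s)) x"
    unfolding log_op_def
  proof (rule Bochner_Integration.integral_cong[OF refl])
    fix \<eta> :: real
    have "exp (- \<eta> / 4) / (2 * cosh (\<eta> / 2)) = exp (\<eta> / 4) * (exp (- \<eta> / 2) / (2 * cosh (\<eta> / 2)))"
      by (simp flip: exp_add)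
    then have e: "exp (- \<eta> / 4) / (2 * cosh (\<eta> / 2)) = exp (\<eta> / 4) * logistic \<eta>" by (simp only: logistic_cosh)
    have "of_real (pi / 2) * (log_density h \<eta> * cnj (fourier ?b \<eta>) / of_real (cosh (\<eta>/2))) =
      log_density h \<eta> * (of_real (exp (- \<eta> / 4) / (2 * cosh (\<eta> / 2))) * q_int x \<eta>)"
      unfolding fourier by simp
    also have "\<dots> = log_density (\<lambda>s. of_real s * h s) \<eta> * (of_real (exp (\<eta>/4)) * q_int x \<eta>)"
      unfolding e by (simp add: log_density_def)
    finally show "of_real (pi / 2) * (log_density h \<eta> * cnj (fourier ?b \<eta>) / of_real (cosh (\<eta>/2))) =
      log_density (\<lambda>s. of_real s * h s) \<eta> * (of_real (exp (\<eta>/4)) * q_int x \<eta>)" .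
  qed
  also have "\<dots> = q_op (\<lambda>s. of_real s * h s) x"
  proof (rule q_op_eq_log_op[symmetric])
    show "continuous_on UNIV (\<lambda>s. of_real s * h s)" using h(1) by (intro continuous_intros)
    show "supported a b (\<lambda>s. of_real s * h s)" using h(2) by (simp add: supported_def)
  qed
  finally show ?thesis .
qed

section \<open>Extension by density\<close>

lemma L2_dominated_convergence:
  assumes "\<And>n. F n \<in> borel_measurable (lebesgue_on S)" "f \<in> borel_measurable (lebesgue_on S)"
    and "integrable (lebesgue_on S) w"
    and "AE x in lebesgue_on S. (\<lambda>n. F n x) \<longlonglongrightarrow> f x"
    and "\<And>n. AE x in lebesgue_on S. (cmod (F n x - f x))\<^sup>2 \<le> w x"
  shows "(\<lambda>n. L2_dist S (F n) f) \<longlonglongrightarrow> 0"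
proof -
  have "(\<lambda>n. integral\<^sup>L (lebesgue_on S) (\<lambda>x. (cmod (F n x - f x))\<^sup>2)) \<longlonglongrightarrow> integral\<^sup>L (lebesgue_on S) (\<lambda>x. 0)"
  proof (rule integral_dominated_convergence)
    show "AE x in lebesgue_on S. (\<lambda>n. (cmod (F n x - f x))\<^sup>2) \<longlonglongrightarrow> 0"
      using assms(4)
    proof eventually_elim
      case (elim x)
      then have "(\<lambda>n. (cmod (F n x - f x))\<^sup>2) \<longlonglongrightarrow> (cmod (f x - f x))\<^sup>2" by (intro tendsto_intros)
      then show ?case by simp
    qed
    show "AE x in lebesgue_on S. norm ((cmod (F n x - f x))\<^sup>2) \<le> w x" for n
      using assms(5)[of n] by simp
  qed (use assms(1-3) in auto)
  then have "(\<lambda>n. sqrt (integral\<^sup>L (lebesgue_on S) (\<lambda>x. (cmod (F n x - f x))\<^sup>2))) \<longlonglongrightarrow> sqrt 0"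
    by (intro tendsto_real_sqrt) simp
  then show ?thesis by (simp add: L2_norm_def)
qed

lemma bounded_L2:
  assumes "h \<in> borel_measurable (lebesgue_on {0<..<1})" "\<And>s. 0 < s \<Longrightarrow> s < 1 \<Longrightarrow> cmod (h s) \<le> k"
  shows "h \<in> L2 {0<..<1}"
proof -
  have fin: "finite_measure (lebesgue_on {0<..<1::real})"
    by (rule finite_measureI) (simp add: emeasure_restrict_space)
  have "integrable (lebesgue_on {0<..<1}) (\<lambda>s. (cmod (h s))\<^sup>2)"
  proof (rule finite_measure.integrable_const_bound[OF fin, of _ "k\<^sup>2"])
    show "AE s in lebesgue_on {0<..<1}. norm ((cmod (h s))\<^sup>2) \<le> k\<^sup>2"
      using assms(2) by (intro AE_I2) (auto intro!: power_mono)
  qed (use assms(1) in simp)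
  then show ?thesis using assms(1) by (simp add: L2_def)
qed

lemma clamp_bound: "0 < k \<Longrightarrow> cmod (of_real (k / max k (cmod z)) * z) \<le> k" for k :: real
proof -
  assume k: "0 < k"
  then have "cmod (of_real (k / max k (cmod z)) * z) = k * cmod z / max k (cmod z)"
    by (simp add: norm_mult norm_divide)
  also have "\<dots> \<le> k" using k by (simp add: divide_le_eq mult_left_mono)
  finally show ?thesis .
qed

text \<open>A Lebesgue measurable function is almost everywhere a limit of continuous ones. Cutting
  these down to modulus k and to a slightly larger support makes dominated convergence work with the
  constant (2 k)^2.\<close>

lemma bounded_approx:
  assumes h: "h \<in> L2 {0<..<1}" "supported a b h" and k: "0 < k" "\<And>s. cmod (h s) \<le> k" and e: "0 < e"
  shows "\<exists>g. continuous_on UNIV g \<and> supported (a/2) ((1 + b)/2) g \<and> L2_dist {0<..<1} g h < e"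
proof -
  let ?M = "lebesgue_on {0<..<1} :: real measure"
  have ab: "0 < a" "b < 1" and supp: "\<And>s. s \<notin> {a..b} \<Longrightarrow> h s = 0" using h(2) by (auto simp: supported_def)
  have "(\<lambda>s. indicator {0<..<1} s *\<^sub>R h s) \<in> borel_measurable lebesgue"
    using h(1) by (subst borel_measurable_restrict_space_iff[symmetric]) (auto simp: L2_def)
  moreover have "indicator {0<..<1} s *\<^sub>R h s = h s" for s
    using supp[of s] ab by (auto simp: indicator_def)
  ultimately have "h \<in> borel_measurable lebesgue" by simp
  then have "h measurable_on UNIV" by (rule lebesgue_measurable_imp_measurable_on) simp
  then obtain N g where N: "negligible N" and g: "\<And>n. continuous_on UNIV (g n)" "\<And>x. x \<notin> N \<Longrightarrow> (\<lambda>n. g n x) \<longlonglongrightarrow> h x"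
    by (auto simp: measurable_on_def)
  \<comment> \<open>A trapezoid: 1 on [a,b], linear down to 0 at a/2 and at (1 + b)/2.\<close>
  define cut where "cut = (\<lambda>s::real. max 0 (min 1 (min ((s - a/2) / (a/2)) (((1 + b)/2 - s) / ((1 - b)/2)))))"
  have cutc: "continuous_on UNIV cut" unfolding cut_def using ab by (intro continuous_intros) auto
  have cut1: "cut s = 1" if "s \<in> {a..b}" for s
    using that ab by (auto simp: cut_def max_def min_def divide_simps)
  have cut0: "cut s = 0" if "s \<notin> {a/2..(1+b)/2}" for s
  proof -
    have "(s - a/2) / (a/2) < 0 \<or> ((1 + b)/2 - s) / ((1 - b)/2) < 0"
      using that ab by (auto simp: divide_less_0_iff)
    then show ?thesis by (auto simp: cut_def)
  qed
  have cutb: "0 \<le> cut s" "cut s \<le> 1" for s by (auto simp: cut_def)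
  \<comment> \<open>The map z -> k z / max k |z| is the continuous radial projection onto the disc
    of radius k; it fixes the values of h.\<close>
  define G where "G = (\<lambda>n s. of_real (cut s) * (of_real (k / max k (cmod (g n s))) * g n s))"
  have Gc: "continuous_on UNIV (G n)" for n
    unfolding G_def using k(1) by (intro continuous_intros g(1) cutc) (auto simp: max_def)
  have Gs: "supported (a/2) ((1 + b)/2) (G n)" for n
    using ab cut0 by (auto simp: supported_def G_def)
  have Gb: "cmod (G n s) \<le> k" for n s
  proof -
    have "cmod (G n s) \<le> 1 * k"
      unfolding G_def norm_mult[of "of_real (cut s)"] using clamp_bound[OF k(1)] cutb k(1)
      by (intro mult_mono) auto
    then show ?thesis by simp
  qed
  have "(\<lambda>n. L2_dist {0<..<1} (G n) h) \<longlonglongrightarrow> 0"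
  proof (rule L2_dominated_convergence[where w="\<lambda>_. (2*k)\<^sup>2"])
    show "G n \<in> borel_measurable ?M" for n
      by (intro borel_measurable_lebesgue_on borel_measurable_continuous_onI Gc)
    show "h \<in> borel_measurable ?M" using h(1) by (simp add: L2_def)
    have "finite_measure ?M" by (rule finite_measureI) (simp add: emeasure_restrict_space)
    then show "integrable ?M (\<lambda>_. (2*k)\<^sup>2)" by (rule finite_measure.integrable_const)
    show "AE s in ?M. (cmod (G n s - h s))\<^sup>2 \<le> (2*k)\<^sup>2" for n
    proof (intro AE_I2 power_mono)
      fix s show "cmod (G n s - h s) \<le> 2 * k"
        using norm_triangle_ineq4[of "G n s" "h s"] Gb[of n s] k(2)[of s] by linarith
    qed simp
    have "AE s in lebesgue. s \<notin> N" using N by (simp add: negligible_iff_null_sets AE_not_in)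
    then have "AE s in ?M. s \<notin> N" by (subst AE_restrict_space_iff) (auto elim: eventually_mono)
    then show "AE s in ?M. (\<lambda>n. G n s) \<longlonglongrightarrow> h s"
    proof eventually_elim
      case (elim s)
      have "(\<lambda>n. G n s) \<longlonglongrightarrow> of_real (cut s) * (of_real (k / max k (cmod (h s))) * h s)"
        unfolding G_def using k(1) by (intro tendsto_intros g(2)[OF elim]) (auto simp: max_def)
      also have "of_real (cut s) * (of_real (k / max k (cmod (h s))) * h s) = h s"
        using k cut1[of s] supp[of s] by (cases "s \<in> {a..b}") (auto simp: max_absorb1)
      finally show ?case .
    qed
  qed
  from LIMSEQ_D[OF this e] obtain n where "L2_dist {0<..<1} (G n) h < e"
    by (auto simp: L2_norm_nonneg)
  then show ?thesis using Gc Gs by blast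
qed

text \<open>Truncation in modulus, at the positive level k + 1, reduces to the bounded case; each of
  the two steps uses half of \<open>e\<close>.\<close>

lemma supported_approx:
  assumes h: "h \<in> L2 {0<..<1}" "supported a b h" and e: "0 < e"
  shows "\<exists>g. continuous_on UNIV g \<and> supported (a/2) ((1 + b)/2) g \<and> L2_dist {0<..<1} g h < e"
proof -
  let ?M = "lebesgue_on {0<..<1} :: real measure"
  have hm [measurable]: "h \<in> borel_measurable ?M" using h(1) by (simp add: L2_def)
  define H where "H = (\<lambda>(k::nat) s. if cmod (h s) \<le> real (Suc k) then h s else 0)"
  have Hm [measurable]: "H k \<in> borel_measurable ?M" for k unfolding H_def by measurable
  have "(\<lambda>k. L2_dist {0<..<1} (H k) h) \<longlonglongrightarrow> 0"
  proof (rule L2_dominated_convergence[OF Hm hm])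
    show "integrable ?M (\<lambda>s. (cmod (h s))\<^sup>2)" using h(1) by (simp add: L2_def)
    show "AE s in ?M. (cmod (H k s - h s))\<^sup>2 \<le> (cmod (h s))\<^sup>2" for k by (auto simp: H_def)
    show "AE s in ?M. (\<lambda>k. H k s) \<longlonglongrightarrow> h s"
    proof (intro AE_I2 tendsto_eventually)
      fix s
      obtain k0 where "cmod (h s) \<le> real k0" using real_arch_simple by blast
      then show "\<forall>\<^sub>F k in sequentially. H k s = h s"
        by (intro eventually_sequentiallyI[of k0]) (auto simp: H_def)
    qed
  qed
  from LIMSEQ_D[OF this, of "e/2"] e obtain k where k: "L2_dist {0<..<1} (H k) h < e / 2"
    by (auto simp: L2_norm_nonneg)
  have Hb: "cmod (H k s) \<le> real (Suc k)" for s by (auto simp: H_def)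
  have HL: "H k \<in> L2 {0<..<1}" by (rule bounded_L2[OF Hm Hb])
  have "supported a b (H k)" using h(2) by (auto simp: supported_def H_def)
  from bounded_approx[OF HL this _ Hb, of "e/2"] e obtain g where
    g: "continuous_on UNIV g" "supported (a/2) ((1 + b)/2) g" "L2_dist {0<..<1} g (H k) < e / 2"
    by auto
  have "L2_dist {0<..<1} g h < e"
    using L2_norm_diff_triangle[OF q_op_continuous_arg_L2[OF g(1,2)] HL h(1)] g(3) k by simp
  then show ?thesis using g by blast
qed

text \<open>For s <= b the coordinate \<xi> is bounded below, which bounds exp (- \<xi>/4); the rest
  of \<open>q_int\<close> is covered by \<open>exp_q_int_bound\<close>.\<close>

lemma q_plus_bound:
  assumes "0 < a" "b < 1"
  shows "\<exists>Q. \<forall>s\<in>{a..b}. cmod (q_plus s x) \<le> Q"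
proof (cases "a \<le> b")
  case True
  let ?I = "(LBINT w. cmod (arc_kernel x w))"
  have I0: "0 \<le> ?I" by (intro integral_nonneg_AE) auto
  have "cmod (q_plus s x) \<le> (q_const * inverse a * (1 - b) powr (- 1 / 2)) * (exp (- ln (1/b - 1) / 4) * ?I)" if s: "s \<in> {a..b}" for s
  proof -
    define \<xi> where "\<xi> = ln (1 / s - 1)"
    have q_const: "0 < q_const" by (simp add: q_const_def)
    have "1 / b - 1 \<le> 1 / s - 1" using s assms by (auto simp: frac_le)
    moreover have "0 < 1 / b - 1" using s assms by auto
    ultimately have xi: "ln (1/b - 1) \<le> \<xi>" unfolding \<xi>_def by (intro ln_mono) auto
    have "cmod (q_int x \<xi>) = exp (- \<xi> / 4) * cmod (of_real (exp (\<xi>/4)) * q_int x \<xi>)"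
      by (simp add: norm_mult flip: mult.assoc exp_add)
    also have "\<dots> \<le> exp (- ln (1/b - 1) / 4) * ?I"
      using xi exp_q_int_bound[of \<xi> x] by (intro mult_mono) auto
    finally have P: "cmod (q_int x \<xi>) \<le> exp (- ln (1/b - 1) / 4) * ?I" .
    have "q_const * inverse s * (1 - s) powr (- 1 / 2) \<le> q_const * inverse a * (1 - b) powr (- 1 / 2)"
      using s assms q_const by (intro mult_mono powr_mono2') (auto simp: le_imp_inverse_le)
    from mult_mono[OF this P] s assms q_const
    have "(q_const * inverse s * (1 - s) powr (- 1 / 2)) * cmod (q_int x \<xi>) \<le> (q_const * inverse a * (1 - b) powr (- 1 / 2)) * (exp (- ln (1/b - 1) / 4) * ?I)"
      by simp
    moreover have "cmod (q_plus s x) = (q_const * inverse s * (1 - s) powr (- 1 / 2)) * cmod (q_int x \<xi>)"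
      unfolding q_plus_q_int \<xi>_def q_const_def[symmetric] norm_mult norm_of_real using s assms q_const by simp
    ultimately show ?thesis by simp
  qed
  then show ?thesis by blast
qed auto

text \<open>For h supported in [a,b] this makes \<open>q_op h x\<close> a pairing with one fixed
  element of L2, so that Cauchy-Schwarz applies at each x.\<close>

definition q_cut :: "real \<Rightarrow> real \<Rightarrow> real \<Rightarrow> real \<Rightarrow> complex" where
  "q_cut a b x s = (if s \<in> {a..b} then q_plus s x else 0)"

lemma q_cut_L2:
  assumes "0 < a" "b < 1"
  shows "q_cut a b x \<in> L2 {0<..<1}"
proof -
  obtain Q where Q: "\<And>s. s \<in> {a..b} \<Longrightarrow> cmod (q_plus s x) \<le> Q" using q_plus_bound[OF assms] by blast
  show ?thesis
  proof (rule bounded_L2)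
    have [measurable]: "(\<lambda>s. q_plus s x) \<in> borel_measurable borel" by (rule q_plus_measurable)
    show "q_cut a b x \<in> borel_measurable (lebesgue_on {0<..<1})"
      unfolding q_cut_def by (intro borel_measurable_lebesgue_on) measurable
    show "cmod (q_cut a b x s) \<le> max Q 0" for s
      using Q[of s] by (auto simp: q_cut_def le_max_iff_disj)
  qed
qed

lemma q_op_q_cut:
  assumes "supported a b h"
  shows "q_op h x = integral\<^sup>L (lebesgue_on {0<..<1}) (\<lambda>s. q_cut a b x s * h s)"
  unfolding q_op_def using assms
  by (intro Bochner_Integration.integral_cong) (auto simp: q_cut_def supported_def)

lemma supported_mono: "supported a b h \<Longrightarrow> 0 < a' \<Longrightarrow> a' \<le> a \<Longrightarrow> b \<le> b' \<Longrightarrow> b' < 1 \<Longrightarrow> supported a' b' h"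
  by (auto simp: supported_def)

lemma q_op_diff:
  assumes "f \<in> L2 {0<..<1}" "g \<in> L2 {0<..<1}" "supported a b f" "supported a b g"
  shows "q_op (\<lambda>s. f s - g s) x = q_op f x - q_op g x"
proof -
  have ab: "0 < a" "b < 1" using assms(3) by (auto simp: supported_def)
  have s: "supported a b (\<lambda>s. f s - g s)" using assms(3,4) by (auto simp: supported_def)
  show ?thesis
    unfolding q_op_q_cut[OF s] q_op_q_cut[OF assms(3)] q_op_q_cut[OF assms(4)] right_diff_distrib
    by (intro Bochner_Integration.integral_diff L2_mult_integrable q_cut_L2 ab assms(1,2))
qed

lemma q_op_tendsto:
  assumes "\<And>n. F n \<in> L2 {0<..<1}" "f \<in> L2 {0<..<1}" "\<And>n. supported a b (F n)" "supported a b f"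
    and "(\<lambda>n. L2_dist {0<..<1} (F n) f) \<longlonglongrightarrow> 0"
  shows "(\<lambda>n. q_op (F n) x) \<longlonglongrightarrow> q_op f x"
proof (rule LIM_zero_cancel, rule Lim_null_comparison)
  have ab: "0 < a" "b < 1" using assms(4) by (auto simp: supported_def)
  have s: "supported a b (\<lambda>s. F n s - f s)" for n using assms(3)[of n] assms(4) by (auto simp: supported_def)
  show "\<forall>\<^sub>F n in sequentially. norm (q_op (F n) x - q_op f x) \<le> L2_norm {0<..<1} (q_cut a b x) * L2_dist {0<..<1} (F n) f"
  proof (intro always_eventually allI)
    fix n
    show "norm (q_op (F n) x - q_op f x) \<le> L2_norm {0<..<1} (q_cut a b x) * L2_dist {0<..<1} (F n) f"
      unfolding q_op_diff[OF assms(1,2,3,4), symmetric] q_op_q_cut[OF s]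
      by (rule L2_Cauchy_Schwarz[OF q_cut_L2[OF ab] L2_diff[OF assms(1,2)]])
  qed
  show "(\<lambda>n. L2_norm {0<..<1} (q_cut a b x) * L2_dist {0<..<1} (F n) f) \<longlonglongrightarrow> 0"
    by (rule tendsto_mult_right_zero[OF assms(5)])
qed

lemma times_s_L2:
  assumes "h \<in> L2 {0<..<1}"
  shows "(\<lambda>s. of_real s * h s) \<in> L2 {0<..<1}"
proof -
  have "complex_of_real \<in> borel_measurable (lebesgue_on {0<..<1})"
    by (rule borel_measurable_lebesgue_on) simp
  then have m: "(\<lambda>s. of_real s * h s) \<in> borel_measurable (lebesgue_on {0<..<1})"
    using assms by (intro borel_measurable_times) (auto simp: L2_def)
  have "integrable (lebesgue_on {0<..<1}) (\<lambda>s. (cmod (of_real s * h s))\<^sup>2)"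
  proof (rule Bochner_Integration.integrable_bound)
    show "integrable (lebesgue_on {0<..<1}) (\<lambda>s. (cmod (h s))\<^sup>2)" using assms by (simp add: L2_def)
    show "AE s in lebesgue_on {0<..<1}. norm ((cmod (of_real s * h s))\<^sup>2) \<le> norm ((cmod (h s))\<^sup>2)"
      by (intro AE_I2) (auto simp: norm_mult intro!: power_mono mult_left_le_one_le)
  qed (use m in simp)
  then show ?thesis using m by (simp add: L2_def)
qed

lemma times_s_norm:
  assumes "h \<in> L2 {0<..<1}"
  shows "L2_norm {0<..<1} (\<lambda>s. of_real s * h s) \<le> L2_norm {0<..<1} h"
  unfolding L2_norm_def
proof (intro real_sqrt_le_mono integral_mono)
  show "integrable (lebesgue_on {0<..<1}) (\<lambda>s. (cmod (of_real s * h s))\<^sup>2)" using times_s_L2[OF assms] by (simp add: L2_def)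
  show "integrable (lebesgue_on {0<..<1}) (\<lambda>s. (cmod (h s))\<^sup>2)" using assms by (simp add: L2_def)
qed (auto simp: norm_mult intro!: power_mono mult_left_le_one_le)

text \<open>Continuous g n approximate h in L2 with supports in the common interval
  [a/2, (1 + b)/2]. There \<open>q_op\<close> and \<open>K_op\<close> converge at every x, and the
  isometry applied to g m - g n makes the images Cauchy in L2.\<close>

lemma
  assumes h: "h \<in> L2 {0<..<1}" "supported a b h"
  shows q_op_L2: "q_op h \<in> L2 {0<..}"
    and q_op_norm: "L2_norm {0<..} (q_op h) = L2_norm {0<..<1} h"
    and K_op_q_op: "K_op (q_op h) x = q_op (\<lambda>s. of_real s * h s) x"
proof -
  define a' b' where "a' = a / 2" and "b' = (1 + b) / 2"
  have ab: "0 < a" "b < 1" using h(2) by (auto simp: supported_def)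
  have "\<exists>g. continuous_on UNIV g \<and> supported a' b' g \<and> L2_dist {0<..<1} g h < 1 / real (Suc n)" for n
    unfolding a'_def b'_def by (rule supported_approx[OF h]) simp
  then obtain g where g: "\<And>n. continuous_on UNIV (g n)" "\<And>n. supported a' b' (g n)"
    and gl: "\<And>n. L2_dist {0<..<1} (g n) h < 1 / real (Suc n)" by metis
  have hs: "supported a' b' h" by (rule supported_mono[OF h(2)]) (use ab in \<open>auto simp: a'_def b'_def\<close>)
  have gL: "g n \<in> L2 {0<..<1}" for n by (rule q_op_continuous_arg_L2[OF g])
  have glim: "(\<lambda>n. L2_dist {0<..<1} (g n) h) \<longlonglongrightarrow> 0"
  proof (rule Lim_null_comparison)
    show "\<forall>\<^sub>F n in sequentially. norm (L2_dist {0<..<1} (g n) h) \<le> 1 / real (Suc n)"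
      using gl by (intro always_eventually allI) (simp add: L2_norm_nonneg less_imp_le)
  qed real_asymp
  have WL: "q_op (g n) \<in> L2 {0<..}" for n by (rule q_op_continuous_L2[OF g])
  have Wlim: "(\<lambda>n. q_op (g n) x) \<longlonglongrightarrow> q_op h x" for x by (rule q_op_tendsto[OF gL h(1) g(2) hs glim])
  have Wm: "q_op h \<in> borel_measurable (lebesgue_on {0<..})"
    by (rule borel_measurable_LIMSEQ_metric[OF _ Wlim]) (use WL in \<open>auto simp: L2_def\<close>)
  have Wd: "L2_dist {0<..} (q_op (g m)) (q_op (g n)) = L2_dist {0<..<1} (g m) (g n)" for m n
  proof -
    have "continuous_on UNIV (\<lambda>s. g m s - g n s)" using g(1) by (intro continuous_intros)
    moreover have "supported a' b' (\<lambda>s. g m s - g n s)" using g(2)[of m] g(2)[of n] by (auto simp: supported_def)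
    ultimately have "L2_norm {0<..} (q_op (\<lambda>s. g m s - g n s)) = L2_dist {0<..<1} (g m) (g n)"
      by (rule q_op_continuous_norm)
    moreover have "q_op (\<lambda>s. g m s - g n s) = (\<lambda>x. q_op (g m) x - q_op (g n) x)"
      by (rule ext) (rule q_op_diff[OF gL gL g(2) g(2)])
    ultimately show ?thesis by simp
  qed
  have "L2_Cauchy {0<..<1} g" by (rule L2_convergent_imp_Cauchy[OF gL h(1) glim])
  then have Wc: "L2_Cauchy {0<..} (\<lambda>n. q_op (g n))"
    using WL unfolding L2_Cauchy_def Wd by simp
  note W = L2_Cauchy_pointwise_limit[OF Wc Wm AE_I2[OF Wlim]]
  show "q_op h \<in> L2 {0<..}" by (rule W)
  show "L2_norm {0<..} (q_op h) = L2_norm {0<..<1} h"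
    using L2_norm_tendsto[OF WL W] L2_norm_tendsto[OF gL h(1) glim] q_op_continuous_norm[OF g]
    by (simp add: LIMSEQ_unique)
  have "(\<lambda>n. K_op (q_op (g n)) x) \<longlonglongrightarrow> K_op (q_op h) x" by (rule K_op_tendsto[OF WL W])
  moreover have "(\<lambda>n. q_op (\<lambda>s. of_real s * g n s) x) \<longlonglongrightarrow> q_op (\<lambda>s. of_real s * h s) x"
  proof (rule q_op_tendsto[OF times_s_L2[OF gL] times_s_L2[OF h(1)]])
    show "supported a' b' (\<lambda>s. of_real s * g n s)" for n using g(2)[of n] by (simp add: supported_def)
    show "supported a' b' (\<lambda>s. of_real s * h s)" using hs by (simp add: supported_def)
    show "(\<lambda>n. L2_norm {0<..<1} (\<lambda>s. of_real s * g n s - of_real s * h s)) \<longlonglongrightarrow> 0"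
    proof (rule Lim_null_comparison[OF _ glim], intro always_eventually allI)
      fix n
      show "norm (L2_norm {0<..<1} (\<lambda>s. of_real s * g n s - of_real s * h s)) \<le> L2_dist {0<..<1} (g n) h"
        using times_s_norm[OF L2_diff[OF gL h(1)], of n] by (simp add: L2_norm_nonneg right_diff_distrib)
    qed
  qed
  ultimately show "K_op (q_op h) x = q_op (\<lambda>s. of_real s * h s) x"
    unfolding K_op_q_op_continuous[OF g] by (rule LIMSEQ_unique)
qed

section \<open>The operator \<open>V\<close>\<close>

text \<open>Moves the truncation from the interval of integration to the function, so that truncated
  integrals become values of \<open>q_op\<close>.\<close>

definition restr :: "real \<times> real \<Rightarrow> (real \<Rightarrow> complex) \<Rightarrow> real \<Rightarrow> complex" where
  "restr p h s = (if s \<in> {fst p..1 - snd p} then h s else 0)"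

lemma restr_supported:
  assumes "0 < fst p" "0 < snd p"
  shows "supported (fst p) (1 - snd p) (restr p h)"
  using assms by (auto simp: supported_def restr_def)

lemma restr_L2:
  assumes "h \<in> L2 {0<..<1}"
  shows "restr p h \<in> L2 {0<..<1}"
proof -
  have hm: "h \<in> borel_measurable (lebesgue_on {0<..<1})" using assms by (simp add: L2_def)
  have im: "(\<lambda>s. complex_of_real (indicator {fst p..1 - snd p} s)) \<in> borel_measurable (lebesgue_on {0<..<1})"
    by (intro borel_measurable_lebesgue_on) simp
  have e: "restr p h = (\<lambda>s. complex_of_real (indicator {fst p..1 - snd p} s) * h s)"
    by (auto simp: restr_def indicator_def)
  have m: "restr p h \<in> borel_measurable (lebesgue_on {0<..<1})"
    unfolding e by (rule borel_measurable_times[OF im hm])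
  have "integrable (lebesgue_on {0<..<1}) (\<lambda>s. (cmod (restr p h s))\<^sup>2)"
  proof (rule Bochner_Integration.integrable_bound)
    show "integrable (lebesgue_on {0<..<1}) (\<lambda>s. (cmod (h s))\<^sup>2)" using assms by (simp add: L2_def)
    show "(\<lambda>s. (cmod (restr p h s))\<^sup>2) \<in> borel_measurable (lebesgue_on {0<..<1})" using m by simp
    show "AE s in lebesgue_on {0<..<1}. norm ((cmod (restr p h s))\<^sup>2) \<le> norm ((cmod (h s))\<^sup>2)"
      by (auto simp: restr_def)
  qed
  then show ?thesis using m by (simp add: L2_def)
qed

lemma V_trunc_eq_q_op:
  assumes "0 < fst p" "0 < snd p"
  shows "V_trunc h p = q_op (restr p h)"
proof (rule ext)
  fix x
  have S: "{fst p..1 - snd p} = {0<..<1} \<inter> {fst p..1 - snd p}" using assms by auto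
  have "V_trunc h p x = integral\<^sup>L (lebesgue_on {fst p..1 - snd p}) (\<lambda>s. q_plus s x * h s)"
    by (simp add: V_trunc_def split: prod.split)
  also have "\<dots> = integral\<^sup>L lebesgue (\<lambda>s. indicator {fst p..1 - snd p} s *\<^sub>R (q_plus s x * h s))"
    by (rule integral_restrict_space) simp
  also have "\<dots> = integral\<^sup>L lebesgue (\<lambda>s. indicator {0<..<1} s *\<^sub>R (q_plus s x * restr p h s))"
    using S by (intro Bochner_Integration.integral_cong) (auto simp: restr_def indicator_def)
  also have "\<dots> = q_op (restr p h) x"
    unfolding q_op_def by (rule integral_restrict_space[symmetric]) simp
  finally show "V_trunc h p x = q_op (restr p h) x" .
qed

text \<open>A diagonal sequence along which the two-parameter limit is evaluated.\<close>

definition cutoff :: "nat \<Rightarrow> real \<times> real" where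
  "cutoff n = (1 / real (Suc n), 1 / real (Suc n))"

lemma cutoff_pos: "0 < fst (cutoff n)" "0 < snd (cutoff n)"
  by (simp_all add: cutoff_def)

lemma restr_cutoff_tendsto:
  assumes "h \<in> L2 {0<..<1}"
  shows "(\<lambda>n. L2_dist {0<..<1} (restr (cutoff n) h) h) \<longlonglongrightarrow> 0"
proof (rule L2_dominated_convergence)
  show "restr (cutoff n) h \<in> borel_measurable (lebesgue_on {0<..<1})" for n
    using restr_L2[OF assms] by (simp add: L2_def)
  show "h \<in> borel_measurable (lebesgue_on {0<..<1})" "integrable (lebesgue_on {0<..<1}) (\<lambda>s. (cmod (h s))\<^sup>2)"
    using assms by (auto simp: L2_def)
  show "AE s in lebesgue_on {0<..<1}. (cmod (restr (cutoff n) h s - h s))\<^sup>2 \<le> (cmod (h s))\<^sup>2" for n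
    by (auto simp: restr_def)
  show "AE s in lebesgue_on {0<..<1}. (\<lambda>n. restr (cutoff n) h s) \<longlonglongrightarrow> h s"
  proof (rule AE_I2, rule tendsto_eventually)
    fix s :: real assume "s \<in> space (lebesgue_on {0<..<1})"
    then have s: "0 < s" "0 < 1 - s" by auto
    have "(\<lambda>n. 1 / real (Suc n)) \<longlonglongrightarrow> 0" by real_asymp
    then have "\<forall>\<^sub>F n in sequentially. 1 / real (Suc n) < s" "\<forall>\<^sub>F n in sequentially. 1 / real (Suc n) < 1 - s"
      using s by (auto intro: order_tendstoD)
    then show "\<forall>\<^sub>F n in sequentially. restr (cutoff n) h s = h s"
      by eventually_elim (auto simp: restr_def cutoff_def)
  qed
qed

text \<open>The error |restr p h - h| decreases pointwise as both coordinates of p decrease, so one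
  member of the diagonal sequence controls all smaller p.\<close>

lemma restr_tendsto:
  assumes "h \<in> L2 {0<..<1}"
  shows "((\<lambda>p. L2_dist {0<..<1} (restr p h) h) \<longlongrightarrow> 0) (at_right 0 \<times>\<^sub>F at_right 0)"
proof (rule tendstoI)
  fix e :: real assume "0 < e"
  then obtain n where n: "L2_dist {0<..<1} (restr (cutoff n) h) h < e"
    using LIMSEQ_D[OF restr_cutoff_tendsto[OF assms], of e] by (auto simp: L2_norm_nonneg)
  have "\<forall>\<^sub>F a in at_right (0::real). 0 < a \<and> a < 1 / real (Suc n)"
    by (auto simp: eventually_at_right_field intro!: exI[of _ "1 / real (Suc n)"])
  then have "\<forall>\<^sub>F p in at_right (0::real) \<times>\<^sub>F at_right (0::real). fst p < 1 / real (Suc n) \<and> snd p < 1 / real (Suc n)"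
    by (auto simp: eventually_prod_filter)
  then show "\<forall>\<^sub>F p in at_right 0 \<times>\<^sub>F at_right 0. dist (L2_dist {0<..<1} (restr p h) h) 0 < e"
  proof eventually_elim
    case (elim p)
    have "L2_dist {0<..<1} (restr p h) h \<le> L2_dist {0<..<1} (restr (cutoff n) h) h"
      unfolding L2_norm_def
    proof (intro real_sqrt_le_mono integral_mono power_mono)
      show "integrable (lebesgue_on {0<..<1}) (\<lambda>s. (cmod (restr p h s - h s))\<^sup>2)"
        "integrable (lebesgue_on {0<..<1}) (\<lambda>s. (cmod (restr (cutoff n) h s - h s))\<^sup>2)"
        using L2_diff[OF restr_L2[OF assms] assms] by (auto simp: L2_def)
      show "cmod (restr p h s - h s) \<le> cmod (restr (cutoff n) h s - h s)" for s
        using elim by (auto simp: restr_def cutoff_def)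
    qed simp
    then show ?case using n by (simp add: L2_norm_nonneg)
  qed
qed

text \<open>Two truncations share the interval between the smaller lower end and the larger upper
  end, so \<open>q_op_norm\<close> applies to their difference.\<close>

lemma q_op_restr_dist:
  assumes "h \<in> L2 {0<..<1}" "k \<in> L2 {0<..<1}" "0 < fst p" "0 < snd p" "0 < fst r" "0 < snd r"
  shows "L2_dist {0<..} (q_op (restr p h)) (q_op (restr r k)) =
    L2_dist {0<..<1} (restr p h) (restr r k)"
proof -
  define a b where "a = min (fst p) (fst r)" and "b = max (1 - snd p) (1 - snd r)"
  have sp: "supported a b (restr p h)" "supported a b (restr r k)"
    using assms(3-6) by (auto simp: supported_def restr_def a_def b_def)
  then have sd: "supported a b (\<lambda>s. restr p h s - restr r k s)" by (auto simp: supported_def)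
  have "(\<lambda>x. q_op (restr p h) x - q_op (restr r k) x) = q_op (\<lambda>s. restr p h s - restr r k s)"
    by (rule ext) (rule q_op_diff[OF restr_L2 restr_L2 sp, symmetric]; rule assms)
  then show ?thesis using q_op_norm[OF L2_diff[OF restr_L2 restr_L2] sd] assms(1,2) by simp
qed

lemma q_op_restr_L2:
  assumes "h \<in> L2 {0<..<1}" "0 < fst p" "0 < snd p"
  shows "q_op (restr p h) \<in> L2 {0<..}"
  by (rule q_op_L2[OF restr_L2[OF assms(1)] restr_supported[OF assms(2,3)]])

lemma eventually_pos_pair: "\<forall>\<^sub>F p in at_right (0::real) \<times>\<^sub>F at_right (0::real). 0 < fst p \<and> 0 < snd p"
  unfolding eventually_prod_filter
  by (intro exI[of _ "\<lambda>a. 0 < a"] conjI) (auto simp: eventually_at_right_less)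

text \<open>Justifies the choice in \<open>V_op\<close>. The images along the diagonal are Cauchy;
  their limit f is within ||restr p h - h|| of \<open>V_trunc h p\<close>, which covers the whole
  product filter.\<close>

lemma V_trunc_L2_tendsto_ex:
  assumes h: "h \<in> L2 {0<..<1}"
  shows "\<exists>f. L2_tendsto {0<..} (V_trunc h) f (at_right 0 \<times>\<^sub>F at_right 0)"
proof -
  let ?F = "\<lambda>n. q_op (restr (cutoff n) h)"
  let ?L = "L2_norm {0<..<1} :: (real \<Rightarrow> complex) \<Rightarrow> real"
  have FL: "?F n \<in> L2 {0<..}" for n by (rule q_op_restr_L2[OF h cutoff_pos])
  have tL: "restr p h \<in> L2 {0<..<1}" for p by (rule restr_L2[OF h])
  have "L2_Cauchy {0<..<1} (\<lambda>n. restr (cutoff n) h)"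
    by (rule L2_convergent_imp_Cauchy[OF tL h restr_cutoff_tendsto[OF h]])
  then have "L2_Cauchy {0<..} ?F"
    using FL unfolding L2_Cauchy_def q_op_restr_dist[OF h h cutoff_pos cutoff_pos] by simp
  then obtain f where f: "f \<in> L2 {0<..}" "(\<lambda>n. L2_dist {0<..} (?F n) f) \<longlonglongrightarrow> 0"
    using L2_complete by blast
  have bound: "L2_dist {0<..} (V_trunc h p) f \<le> ?L (\<lambda>s. restr p h s - h s)"
    if p: "0 < fst p" "0 < snd p" for p
  proof (rule LIMSEQ_le_const)
    show "(\<lambda>n. ?L (\<lambda>s. restr p h s - h s) + ?L (\<lambda>s. restr (cutoff n) h s - h s) + L2_dist {0<..} (?F n) f)
       \<longlonglongrightarrow> ?L (\<lambda>s. restr p h s - h s)"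
      using tendsto_add[OF tendsto_add[OF tendsto_const restr_cutoff_tendsto[OF h]] f(2)] by simp
    have "L2_dist {0<..} (q_op (restr p h)) f \<le>
      ?L (\<lambda>s. restr p h s - h s) + ?L (\<lambda>s. restr (cutoff n) h s - h s) + L2_dist {0<..} (?F n) f" for n
      using L2_norm_diff_triangle[OF q_op_restr_L2[OF h p] FL[of n] f(1)]
        L2_norm_diff_triangle[OF tL[of p] h tL[of "cutoff n"]] L2_norm_minus_commute[of "{0<..<1}" h]
        q_op_restr_dist[OF h h p cutoff_pos, of n] by simp
    then show "\<exists>N. \<forall>n\<ge>N. L2_dist {0<..} (V_trunc h p) f \<le>
      ?L (\<lambda>s. restr p h s - h s) + ?L (\<lambda>s. restr (cutoff n) h s - h s) + L2_dist {0<..} (?F n) f"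
      unfolding V_trunc_eq_q_op[OF p] by blast
  qed
  have "L2_tendsto {0<..} (V_trunc h) f (at_right 0 \<times>\<^sub>F at_right 0)"
    unfolding L2_tendsto_def
  proof (intro conjI f(1))
    show "\<forall>\<^sub>F p in at_right 0 \<times>\<^sub>F at_right 0. V_trunc h p \<in> L2 {0<..}"
      using eventually_pos_pair by eventually_elim (simp add: V_trunc_eq_q_op q_op_restr_L2[OF h])
    show "((\<lambda>p. L2_dist {0<..} (V_trunc h p) f) \<longlongrightarrow> 0) (at_right 0 \<times>\<^sub>F at_right 0)"
    proof (rule Lim_null_comparison[OF _ restr_tendsto[OF h]])
      show "\<forall>\<^sub>F p in at_right 0 \<times>\<^sub>F at_right 0.
        norm (L2_dist {0<..} (V_trunc h p) f) \<le> ?L (\<lambda>s. restr p h s - h s)"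
        using eventually_pos_pair by eventually_elim (simp add: bound L2_norm_nonneg)
    qed
  qed
  then show ?thesis by blast
qed

lemma filterlim_cutoff: "filterlim cutoff (at_right 0 \<times>\<^sub>F at_right 0) sequentially"
proof -
  have "filterlim (\<lambda>n. 1 / real (Suc n)) (at_right 0) sequentially" by real_asymp
  then show ?thesis unfolding cutoff_def by (intro filterlim_Pair)
qed

lemma
  assumes h: "h \<in> L2 {0<..<1}"
  shows V_op_L2: "V_op h \<in> L2 {0<..}"
    and q_op_restr_tendsto_V_op: "(\<lambda>n. L2_dist {0<..} (q_op (restr (cutoff n) h)) (V_op h)) \<longlonglongrightarrow> 0"
proof -
  have "L2_tendsto {0<..} (V_trunc h) (V_op h) (at_right 0 \<times>\<^sub>F at_right 0)"
    unfolding V_op_def by (rule someI_ex[OF V_trunc_L2_tendsto_ex[OF h]])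
  then have V: "V_op h \<in> L2 {0<..}"
    "((\<lambda>p. L2_dist {0<..} (V_trunc h p) (V_op h)) \<longlongrightarrow> 0) (at_right 0 \<times>\<^sub>F at_right 0)"
    by (auto simp: L2_tendsto_def)
  show "V_op h \<in> L2 {0<..}" by (rule V)
  show "(\<lambda>n. L2_dist {0<..} (q_op (restr (cutoff n) h)) (V_op h)) \<longlonglongrightarrow> 0"
    using filterlim_compose[OF V(2) filterlim_cutoff] by (simp add: V_trunc_eq_q_op[OF cutoff_pos])
qed

text \<open>Linearity is not built into a choice of representatives, so h and k are compared through
  their truncations, on which \<open>q_op\<close> preserves distances.\<close>

lemma V_op_inject_AE:
  assumes h: "h \<in> L2 {0<..<1}" and k: "k \<in> L2 {0<..<1}"
    and eq: "AE x in lebesgue_on {0<..}. V_op h x = V_op k x"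
  shows "AE s in lebesgue_on {0<..<1}. h s = k s"
proof -
  let ?H = "\<lambda>n. q_op (restr (cutoff n) h)" and ?K = "\<lambda>n. q_op (restr (cutoff n) k)"
  let ?D = "\<lambda>n. L2_dist {0<..<1} (restr (cutoff n) h) (restr (cutoff n) k)"
  have HL: "?H n \<in> L2 {0<..}" and KL: "?K n \<in> L2 {0<..}" for n
    by (rule q_op_restr_L2[OF h cutoff_pos], rule q_op_restr_L2[OF k cutoff_pos])
  have V0: "L2_dist {0<..} (V_op h) (V_op k) = 0"
  proof -
    have "L2_dist {0<..} (V_op h) (V_op k) = L2_norm {0<..} (\<lambda>x. 0)"
      using L2_diff[OF V_op_L2[OF h] V_op_L2[OF k]] eq by (intro L2_norm_cong_AE) (auto simp: L2_def)
    then show ?thesis by (simp add: L2_norm_def)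
  qed
  have D0: "?D \<longlonglongrightarrow> 0"
  proof (rule Lim_null_comparison)
    show "(\<lambda>n. L2_dist {0<..} (?H n) (V_op h) + L2_dist {0<..} (?K n) (V_op k)) \<longlonglongrightarrow> 0"
      using tendsto_add[OF q_op_restr_tendsto_V_op[OF h] q_op_restr_tendsto_V_op[OF k]] by simp
    have "?D n \<le> L2_dist {0<..} (?H n) (V_op h) + L2_dist {0<..} (?K n) (V_op k)" for n
      unfolding q_op_restr_dist[OF h k cutoff_pos cutoff_pos, symmetric]
      using L2_norm_diff_triangle[OF HL V_op_L2[OF h] KL, of n n] L2_norm_diff_triangle[OF V_op_L2[OF h] V_op_L2[OF k] KL[of n]]
        L2_norm_minus_commute[of "{0<..}" "V_op k" "?K n"] V0 by simp
    then show "\<forall>\<^sub>F n in sequentially. norm (?D n) \<le> L2_dist {0<..} (?H n) (V_op h) + L2_dist {0<..} (?K n) (V_op k)"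
      by (simp add: L2_norm_nonneg)
  qed
  have "L2_dist {0<..<1} h k \<le> 0"
  proof (rule LIMSEQ_le_const)
    show "(\<lambda>n. L2_dist {0<..<1} (restr (cutoff n) h) h + ?D n + L2_dist {0<..<1} (restr (cutoff n) k) k) \<longlonglongrightarrow> 0"
      using tendsto_add[OF tendsto_add[OF restr_cutoff_tendsto[OF h] D0] restr_cutoff_tendsto[OF k]] by simp
    have "L2_dist {0<..<1} h k \<le> L2_dist {0<..<1} (restr (cutoff n) h) h + ?D n + L2_dist {0<..<1} (restr (cutoff n) k) k" for n
      using L2_norm_diff_triangle[OF h restr_L2[OF h] k, of "cutoff n"]
        L2_norm_diff_triangle[OF restr_L2[OF h] restr_L2[OF k] k, of "cutoff n" "cutoff n"]
        L2_norm_minus_commute[of "{0<..<1}" h "restr (cutoff n) h"] by simp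
    then show "\<exists>N. \<forall>n\<ge>N. L2_dist {0<..<1} h k \<le> L2_dist {0<..<1} (restr (cutoff n) h) h + ?D n + L2_dist {0<..<1} (restr (cutoff n) k) k"
      by blast
  qed
  then have "L2_dist {0<..<1} h k = 0" using L2_norm_nonneg[of "{0<..<1}" "\<lambda>s. h s - k s"] by simp
  from L2_norm_eq_0_AE[OF L2_diff[OF h k] this] show ?thesis by simp
qed

text \<open>Truncation commutes with multiplication by s. Hence one sequence, the images of the
  truncations of s h, converges in L2 to \<open>V_op\<close> of s h and at every x to
  \<open>K_op (V_op h) x\<close>.\<close>

lemma V_op_times_s:
  assumes h: "h \<in> L2 {0<..<1}"
  shows "AE x in lebesgue_on {0<..}. V_op (\<lambda>s. of_real s * h s) x = K_op (V_op h) x"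
proof -
  let ?sh = "\<lambda>s. of_real s * h s"
  have sh: "?sh \<in> L2 {0<..<1}" by (rule times_s_L2[OF h])
  have "restr p ?sh = (\<lambda>s. of_real s * restr p h s)" for p by (auto simp: restr_def)
  then have KW: "K_op (q_op (restr (cutoff n) h)) x = q_op (restr (cutoff n) ?sh) x" for n x
    using K_op_q_op[OF restr_L2[OF h] restr_supported[OF cutoff_pos]] by simp
  have lim: "(\<lambda>n. q_op (restr (cutoff n) ?sh) x) \<longlonglongrightarrow> K_op (V_op h) x" for x
    using K_op_tendsto[OF q_op_restr_L2[OF h cutoff_pos] V_op_L2[OF h] q_op_restr_tendsto_V_op[OF h]] unfolding KW .
  have L: "q_op (restr (cutoff n) ?sh) \<in> L2 {0<..}" for n by (rule q_op_restr_L2[OF sh cutoff_pos])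
  \<comment> \<open>Measurability of \<open>K_op (V_op h)\<close> is inherited from this pointwise
    limit.\<close>
  have "K_op (V_op h) \<in> borel_measurable (lebesgue_on {0<..})"
    by (rule borel_measurable_LIMSEQ_metric[OF _ lim]) (use L in \<open>auto simp: L2_def\<close>)
  from L2_pointwise_limit_AE_eq[OF L V_op_L2[OF sh] q_op_restr_tendsto_V_op[OF sh] this] lim
  show ?thesis by simp
qed

theorem mainTheorem1:
  fixes h :: "real \<Rightarrow> complex"
  assumes "h \<in> L2 {0<..<1}"
  shows "AE s in lebesgue_on {0<..<1}. V_inv (K_op (V_op h)) s = of_real s * h s"
proof -
  \<comment> \<open>The function s h(s) witnesses that \<open>V_inv\<close> chooses from a nonempty
    set, so the chosen element has the defining property.\<close>
  have "\<exists>k. k \<in> L2 {0<..<1} \<and> (AE x in lebesgue_on {0<..}. V_op k x = K_op (V_op h) x)"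
    using times_s_L2[OF assms] V_op_times_s[OF assms] by blast
  then have V: "V_inv (K_op (V_op h)) \<in> L2 {0<..<1} \<and>
    (AE x in lebesgue_on {0<..}. V_op (V_inv (K_op (V_op h))) x = K_op (V_op h) x)"
    unfolding V_inv_def by (rule someI_ex)
  show ?thesis
  proof (rule V_op_inject_AE[OF conjunct1[OF V] times_s_L2[OF assms]])
    show "AE x in lebesgue_on {0<..}. V_op (V_inv (K_op (V_op h))) x = V_op (\<lambda>s. of_real s * h s) x"
      using conjunct2[OF V] V_op_times_s[OF assms] by eventually_elim simp
  qed
qed

end
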